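(* Let $d\ge1$ and let $T$ be any tree of order $n$ with maximum degree $d+1$. Then for all $x>0$, $$M(S(T_{d+1}^* ),x)\le M(S(T),x)\le M(S(B_{n,d+1}),x),$$ $$\varphi(T_{d+1}^*,x)\le\varphi(T,x)\le\varphi(B_{n,d+1},x),$$ with equality on the left if and only if $T=T_{d+1}^*$, and equality on the right if and only if $T=B_{n,d+1}$ (up to isomorphism).
   Context: The subdivision tree $S(T)$ of a tree $T$ is obtained by inserting a new vertex into every edge of $T$. For a tree $T$, $m(T,k)$ is the number of matchings with exactly $k$ edges ($m(T,0)=1$) and $M(T,x)=\sum_{k\ge0}m(T,k)x^k$. Writing $\det(\lambda I_n-L(T))=\sum_{k=0}^n(-1)^kc_k(T)\lambda^{n-k}$ for the Laplacian characteristic polynomial of $T$ (with $L(T)=D(T)-A(T)$), $\varphi(T,x)=\sum_{k=0}^{n-1}c_k(T)x^k$. $B_{n,d+1}$ is the tree obtained by identifying the center of the star $S_{d+1}=K_{1,d}$ (on $d+1$ vertices) with one pendent vertex of the path $P_{n-d}$ on $n-d$ vertices. A rooted $d$-ary tree is a rooted tree in which every vertex has $0$ or $d$ children; the complete $d$-ary tree $C_h$ is the rooted $d$-ary tree all of whose leaves are at distance $h-1$ from the root. For a vertex $u$ of a rooted tree, $T(u)$ is the subtree of $u$ and its descendants. The $(d+1)$-greedy tree $T_{d+1}^*$ (of order $n$) is a rooted tree with root $v_0$ and maximum degree $d+1$ such that: (1) $\deg(v_0)=d+1$; (2) the heights of any two pendent vertices differ by at most $1$; (3) for every vertex $v$,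 at most one of the subtrees $T(u)$, $u$ a child of $v$, is not a complete $d$-ary tree.
   Formalization: Conditions (1)–(3) do not determine the greedy tree (e.g. two such trees for d=2, n=11), so the definition is completed by requiring that every vertex lying at least two levels above some other vertex has degree d+1. *)

theory Defs
  imports "Jordan_Normal_Form.Char_Poly"
begin

record 'a ugraph =
  verts :: "'a set"
  edges :: "'a set set"

definition simple_graph :: "'a ugraph \<Rightarrow> bool" where
  "simple_graph G \<longleftrightarrow> finite (verts G) \<and> (\<forall>e\<in>edges G. e \<subseteq> verts G \<and> card e = 2)"

definition adj :: "'a ugraph \<Rightarrow> ('a \<times> 'a) set" where
  "adj G = {(u, v). {u, v} \<in> edges G}"

definition vdegree :: "'a ugraph \<Rightarrow> 'a \<Rightarrow> nat" where
  "vdegree G v = card {e \<in> edges G. v \<in> e}"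

definition max_degree :: "'a ugraph \<Rightarrow> nat" where
  "max_degree G = Max (vdegree G ` verts G)"

definition connected_graph :: "'a ugraph \<Rightarrow> bool" where
  "connected_graph G \<longleftrightarrow> verts G \<noteq> {} \<and> (\<forall>u\<in>verts G. \<forall>v\<in>verts G. (u, v) \<in> (adj G)\<^sup>*)"

definition is_cycle :: "'a ugraph \<Rightarrow> 'a list \<Rightarrow> bool" where
  "is_cycle G vs \<longleftrightarrow> 3 \<le> length vs \<and> distinct vs \<and>
     (\<forall>i<length vs. {vs ! i, vs ! ((i + 1) mod length vs)} \<in> edges G)"

definition tree :: "'a ugraph \<Rightarrow> bool" where
  "tree G \<longleftrightarrow> simple_graph G \<and> connected_graph G \<and> (\<nexists>vs. is_cycle G vs)"

definition graph_iso :: "'a ugraph \<Rightarrow> 'b ugraph \<Rightarrow> bool" (infix \<open>\<cong>\<^sub>G\<close> 50) where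
  "G \<cong>\<^sub>G H \<longleftrightarrow> (\<exists>f. bij_betw f (verts G) (verts H) \<and>
     (\<forall>u\<in>verts G. \<forall>v\<in>verts G. {u, v} \<in> edges G \<longleftrightarrow> {f u, f v} \<in> edges H))"

definition induced :: "'a ugraph \<Rightarrow> 'a set \<Rightarrow> 'a ugraph" where
  "induced G W = \<lparr>verts = verts G \<inter> W, edges = {e \<in> edges G. e \<subseteq> W}\<rparr>"

text \<open>Length of a shortest walk; only used between vertices of a connected graph.\<close>

definition gdist :: "'a ugraph \<Rightarrow> 'a \<Rightarrow> 'a \<Rightarrow> nat" where
  "gdist G u v = (LEAST k. (u, v) \<in> adj G ^^ k)"

text \<open>The new vertex inserted into the edge \<open>e\<close> is \<open>Inr e\<close>.\<close>

definition subdivision :: "'a ugraph \<Rightarrow> ('a + 'a set) ugraph" where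
  "subdivision G = \<lparr>verts = Inl ` verts G \<union> Inr ` edges G,
                     edges = {{Inl v, Inr e} | v e. e \<in> edges G \<and> v \<in> e}\<rparr>"

definition matching :: "'a ugraph \<Rightarrow> 'a set set \<Rightarrow> bool" where
  "matching G F \<longleftrightarrow> F \<subseteq> edges G \<and> pairwise disjnt F"

definition num_matchings :: "'a ugraph \<Rightarrow> nat \<Rightarrow> nat" where
  "num_matchings G k = card {F. matching G F \<and> card F = k}"

text \<open>No matching has more than \<open>card (edges G)\<close> edges, so the truncation drops only zero terms.\<close>

definition matching_poly :: "'a ugraph \<Rightarrow> real \<Rightarrow> real" where
  "matching_poly G x = (\<Sum>k\<le>card (edges G). real (num_matchings G k) * x ^ k)"

definition degree_mat :: "'a ugraph \<Rightarrow> 'a list \<Rightarrow> real mat" where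
  "degree_mat G vs = mat (length vs) (length vs)
     (\<lambda>(i, j). if i = j then real (vdegree G (vs ! i)) else 0)"

definition adjacency_mat :: "'a ugraph \<Rightarrow> 'a list \<Rightarrow> real mat" where
  "adjacency_mat G vs = mat (length vs) (length vs)
     (\<lambda>(i, j). if {vs ! i, vs ! j} \<in> edges G then 1 else 0)"

definition laplacian_mat :: "'a ugraph \<Rightarrow> 'a list \<Rightarrow> real mat" where
  "laplacian_mat G vs = degree_mat G vs - adjacency_mat G vs"

text \<open>
  Rows and columns are indexed through an arbitrary enumeration of the vertices. Changing the
  enumeration conjugates the matrix by a permutation matrix and so does not affect the
  characteristic polynomial.
\<close>

definition laplacian_char_poly :: "'a ugraph \<Rightarrow> real poly" where
  "laplacian_char_poly G =
     char_poly (laplacian_mat G (SOME vs. distinct vs \<and> set vs = verts G))"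

text \<open>
  \<open>c\<^sub>k\<close> is determined by
  \<open>det (\<lambda>I - L) = (\<Sum>k\<le>n. (-1)^k * c\<^sub>k * \<lambda>^(n - k))\<close>;
  meaningful for \<open>k \<le> n\<close> only.
\<close>

definition lap_coeff :: "'a ugraph \<Rightarrow> nat \<Rightarrow> real" where
  "lap_coeff G k = (-1) ^ k * coeff (laplacian_char_poly G) (card (verts G) - k)"

definition lap_poly :: "'a ugraph \<Rightarrow> real \<Rightarrow> real" where
  "lap_poly G x = (\<Sum>k<card (verts G). lap_coeff G k * x ^ k)"

definition path_graph :: "nat \<Rightarrow> nat ugraph" where
  "path_graph m = \<lparr>verts = {..<m}, edges = {{i, i + 1} | i. i + 1 < m}\<rparr>"

definition star_graph :: "'a \<Rightarrow> 'a set \<Rightarrow> 'a ugraph" where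
  "star_graph c L = \<lparr>verts = insert c L, edges = {{c, l} | l. l \<in> L}\<rparr>"

definition graph_union :: "'a ugraph \<Rightarrow> 'a ugraph \<Rightarrow> 'a ugraph" where
  "graph_union G H = \<lparr>verts = verts G \<union> verts H, edges = edges G \<union> edges H\<rparr>"

text \<open>
  The path \<open>P\<^bsub>n-d\<^esub>\<close> on \<open>{..<n - d}\<close> and the star with \<open>d\<close> leaves \<open>{n - d..<n}\<close> share exactly the
  vertex \<open>0\<close>, which is an end of the path and the center of the star. Intended for \<open>n \<ge> d + 2\<close>.
\<close>

definition broom :: "nat \<Rightarrow> nat \<Rightarrow> nat ugraph" where
  "broom n d = graph_union (path_graph (n - d)) (star_graph 0 {n - d..<n})"

definition child_rel :: "'a ugraph \<Rightarrow> 'a \<Rightarrow> ('a \<times> 'a) set" where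
  "child_rel G r = {(v, u) \<in> adj G. gdist G r u = gdist G r v + 1}"

definition children :: "'a ugraph \<Rightarrow> 'a \<Rightarrow> 'a \<Rightarrow> 'a set" where
  "children G r v = {u. (v, u) \<in> child_rel G r}"

text \<open>\<open>T(u)\<close>, to be read as rooted at \<open>u\<close>.\<close>

definition subtree :: "'a ugraph \<Rightarrow> 'a \<Rightarrow> 'a \<Rightarrow> 'a ugraph" where
  "subtree G r u = induced G {w. (u, w) \<in> (child_rel G r)\<^sup>*}"

definition rooted_dary :: "nat \<Rightarrow> 'a ugraph \<Rightarrow> 'a \<Rightarrow> bool" where
  "rooted_dary d G r \<longleftrightarrow> tree G \<and> r \<in> verts G \<and>
     (\<forall>v\<in>verts G. card (children G r v) = 0 \<or> card (children G r v) = d)"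

definition complete_dary :: "nat \<Rightarrow> nat \<Rightarrow> 'a ugraph \<Rightarrow> 'a \<Rightarrow> bool" where
  "complete_dary d h G r \<longleftrightarrow> 1 \<le> h \<and> rooted_dary d G r \<and>
     (\<forall>v\<in>verts G. children G r v = {} \<longrightarrow> gdist G r v = h - 1)"

text \<open>
  The height of a vertex is its distance from the root. The last conjunct makes explicit that
  the levels of the greedy tree are filled from the root: every vertex lying at least two levels
  above some other vertex has the full degree \<open>d + 1\<close>. The other conditions do not determine the
  tree uniquely: for \<open>d = 2\<close>, let the root have three children, two with two leaf children each,
  the third with a single child that carries two leaves; these 11 vertices satisfy all conjuncts
  but the last one, and so does the level-filled tree with 11 vertices.
\<close>

definition greedy_tree_rooted :: "nat \<Rightarrow> nat \<Rightarrow> 'a ugraph \<Rightarrow> 'a \<Rightarrow> bool" where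
  "greedy_tree_rooted n d G r \<longleftrightarrow>
     tree G \<and> card (verts G) = n \<and> max_degree G = d + 1 \<and> r \<in> verts G \<and>
     vdegree G r = d + 1 \<and>
     (\<forall>v\<in>verts G. \<forall>w\<in>verts G. vdegree G v = 1 \<and> vdegree G w = 1 \<longrightarrow>
        gdist G r v \<le> gdist G r w + 1) \<and>
     (\<forall>v\<in>verts G.
        card {u \<in> children G r v. \<not> (\<exists>h. complete_dary d h (subtree G r u) u)} \<le> 1) \<and>
     (\<forall>v\<in>verts G. (\<exists>w\<in>verts G. gdist G r v + 2 \<le> gdist G r w) \<longrightarrow> vdegree G v = d + 1)"

definition greedy_tree :: "nat \<Rightarrow> nat \<Rightarrow> 'a ugraph \<Rightarrow> bool" where
  "greedy_tree n d G \<longleftrightarrow> (\<exists>r. greedy_tree_rooted n d G r)"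

end

theory Submission
  imports Defs
begin

text \<open>
  For a tree \<open>T\<close> and \<open>x > 0\<close> both polynomials equal \<open>det (I + x L(T))\<close>. Eliminating vertices from the
  leaves upwards reads this determinant as a product of pivots of an electrical network in which
  every edge and every connection of a vertex to the ground is a resistor: a branch enters only
  through the conductance to the ground seen from its root and through a positive factor.

  Fix a path from \<open>u\<close> to \<open>v\<close> and let \<open>a\<close>, \<open>b\<close> be the total conductances of the other branches at
  \<open>u\<close> and \<open>v\<close>. The determinant is \<open>A + B a + C b + D a b\<close> with \<open>D > 0\<close>, hence strictly concave
  along \<open>a + b = const\<close>. In a minimal tree (with empty slots added up to degree \<open>d + 1\<close>) the branches
  at \<open>u\<close> therefore all have conductance at most, or all at least, that of the branches at \<open>v\<close>. By induction this
  numerical statement becomes structural: of two branches pointing away from each other, one has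
  height at most the number of filled levels of the other. Rooted at its centre, such a tree is greedy.
  For the upper bound, straightening the branches at a vertex of degree \<open>d + 1\<close> into paths and then
  making their lengths as unequal as possible only increases the determinant.
\<close>

section \<open>Conductances of rooted trees with slots\<close>

text \<open>Detaching a branch and attaching it elsewhere is an exchange of two branches only if an
  empty place counts as a branch. Slots of conductance 0 achieve this, so one exchange argument
  covers every competitor of bounded degree.

  Conductances require a root, while minimality concerns unrooted trees. \<open>rooted_det\<close>
  is unchanged when the root crosses an edge, so the root is always moved to where the next
  comparison takes place, and the equality cases assert \<open>reroot\<close>, from which an
  isomorphism of graphs follows.

  The minimizer might a priori vary with \<open>x\<close>. The exchange argument, however, ends in
  the predicate \<open>greedy_root\<close>, in which \<open>x\<close> does not occur and which, for
  given \<open>d\<close> and order, at most one multiset satisfies. This identifies the minimizers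
  for all \<open>x\<close> at once and settles the left equality case.

  The determinant appears in two disguises: matchings of the subdivision satisfy the recursion for
  joining two trees by an edge, and the Laplacian characteristic polynomial at \<open>-1/x\<close>
  is, up to a power of \<open>-x\<close>, the determinant of \<open>I + x L\<close>.\<close>

text \<open>
  Rooted trees with slots: \<open>Vacant\<close> is an unused slot for a child, which lets all vertices of a
  tree of bounded degree have the same number of slots.
\<close>

datatype stree = Vacant | Node "stree multiset"

primrec nodes :: "stree \<Rightarrow> nat" where
  "nodes Vacant = 0"
| "nodes (Node M) = Suc (sum_mset (image_mset nodes M))"

text \<open>
  \<open>cnd x t\<close> is the conductance to the ground of the branch \<open>t\<close> seen through its connecting edge, of
  conductance \<open>x\<close>; every vertex has conductance \<open>1\<close> to the ground. \<open>elim x t\<close> is the product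
  of the pivots that occur when \<open>t\<close> is eliminated.
\<close>

primrec cnd :: "real \<Rightarrow> stree \<Rightarrow> real" where
  "cnd x Vacant = 0"
| "cnd x (Node M) = (1 + sum_mset (image_mset (cnd x) M)) * x / (1 + sum_mset (image_mset (cnd x) M) + x)"

definition pivot :: "real \<Rightarrow> stree multiset \<Rightarrow> real" where
  "pivot x M = 1 + (\<Sum>t\<in>#M. cnd x t)"

primrec elim :: "real \<Rightarrow> stree \<Rightarrow> real" where
  "elim x Vacant = 1"
| "elim x (Node M) = (pivot x M + x) * prod_mset (image_mset (elim x) M)"

text \<open>The determinant of \<open>I + x L\<close> with the row and column of the root deleted;
  equally, the matching polynomial of the subdivision with the root removed.\<close>

definition forest :: "real \<Rightarrow> stree multiset \<Rightarrow> real" where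
  "forest x M = (\<Prod>t\<in>#M. elim x t)"

definition rooted_det :: "real \<Rightarrow> stree multiset \<Rightarrow> real" where
  "rooted_det x M = pivot x M * forest x M"

lemma cnd_Node: "cnd x (Node M) = pivot x M * x / (pivot x M + x)"
  by (simp add: pivot_def)

lemma elim_Node: "elim x (Node M) = (pivot x M + x) * forest x M"
  by (simp add: forest_def)

declare cnd.simps(2) [simp del] elim.simps(2) [simp del]

lemma pivot_empty [simp]: "pivot x {#} = 1"
  and pivot_add [simp]: "pivot x (add_mset t M) = cnd x t + pivot x M"
  and forest_empty [simp]: "forest x {#} = 1"
  and forest_add [simp]: "forest x (add_mset t M) = elim x t * forest x M"
  by (simp_all add: pivot_def forest_def)

lemma stree_branch_induct [case_names Vacant Node]:
  assumes "P Vacant" and "\<And>M. (\<And>t. t \<in># M \<Longrightarrow> P t) \<Longrightarrow> P (Node M)"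
  shows "P t"
  using assms by (induction t) auto

lemma nodes_less: "t \<in># M \<Longrightarrow> nodes t < nodes (Node M)"
  by (induction M) auto

lemma nodes_eq_0 [simp]: "nodes t = 0 \<longleftrightarrow> t = Vacant"
  by (cases t) auto

lemma cnd_nonneg: "0 < x \<Longrightarrow> 0 \<le> cnd x t"
proof (induction t rule: stree_branch_induct)
  case (Node M)
  then have "1 \<le> pivot x M"
    unfolding pivot_def by (induction M) (auto simp: add_increasing)
  with Node show ?case by (simp add: cnd_Node)
qed simp

lemma pivot_ge_1: "0 < x \<Longrightarrow> 1 \<le> pivot x M"
  unfolding pivot_def by (induction M) (auto simp: add_increasing cnd_nonneg)

lemma cnd_Node_pos: "0 < x \<Longrightarrow> 0 < cnd x (Node M)"
  using pivot_ge_1[of x M] by (simp add: cnd_Node)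

lemma elim_pos: "0 < x \<Longrightarrow> 0 < elim x t"
proof (induction t rule: stree_branch_induct)
  case (Node M)
  then have "0 < forest x M"
    by (induction M) auto
  with Node.prems pivot_ge_1[of x M] show ?case by (simp add: elim_Node)
qed simp

lemma forest_pos: "0 < x \<Longrightarrow> 0 < forest x M"
  by (induction M) (auto simp: elim_pos)

lemma cnd_elim_Node: "0 < x \<Longrightarrow> cnd x (Node M) * elim x (Node M) = x * rooted_det x M"
  using pivot_ge_1[of x M] by (simp add: cnd_Node elim_Node rooted_det_def)

lemma elim_eq: "elim x (Node M) = rooted_det x M + x * forest x M"
  by (simp add: elim_Node rooted_det_def algebra_simps)

lemma rooted_det_add:
  "rooted_det x (add_mset t M) = elim x t * rooted_det x M + cnd x t * elim x t * forest x M"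
  by (simp add: rooted_det_def algebra_simps)

lemma rooted_det_add_Node:
  assumes "0 < x"
  shows "rooted_det x (add_mset (Node X) M) =
    (rooted_det x X + x * forest x X) * rooted_det x M + x * rooted_det x X * forest x M"
  using rooted_det_add[of x "Node X" M] cnd_elim_Node[OF assms, of X] elim_eq[of x X]
  by simp

text \<open>The right-hand side of \<open>rooted_det_add_Node\<close> is symmetric in the two sides
  of the edge.\<close>

lemma rooted_det_reroot:
  "0 < x \<Longrightarrow> rooted_det x (add_mset (Node X) R) = rooted_det x (add_mset (Node R) X)"
  by (simp add: rooted_det_add_Node algebra_simps)

text \<open>
  \<open>hang Ls Y\<close> is a branch whose root starts a path along which the vertices carry the additional
  branches listed in \<open>Ls\<close>; the last vertex of the path carries \<open>Y\<close>.
\<close>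

primrec hang :: "stree multiset list \<Rightarrow> stree multiset \<Rightarrow> stree" where
  "hang [] Y = Node Y"
| "hang (L # Ls) Y = Node (add_mset (hang Ls Y) L)"

lemma hang_snoc: "hang (Ls @ [L]) Y = hang Ls (add_mset (Node Y) L)"
  by (induction Ls) auto

definition hang_kids :: "stree multiset list \<Rightarrow> stree multiset \<Rightarrow> stree multiset" where
  "hang_kids Ls Y = (case hang Ls Y of Node M \<Rightarrow> M)"

lemma hang_eq_Node: "\<exists>M. hang Ls Y = Node M"
  by (cases Ls) auto

lemma hang_kids: "hang Ls Y = Node (hang_kids Ls Y)"
proof -
  obtain M where "hang Ls Y = Node M" using hang_eq_Node by blast
  then show ?thesis by (simp add: hang_kids_def)
qed

lemma hang_kids_simps:
  "hang_kids [] Y = Y" "hang_kids (L # Ls) Y = add_mset (Node (hang_kids Ls Y)) L"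
  using hang_kids[of Ls Y] by (simp_all add: hang_kids_def)

text \<open>The recursion along the path mixes the two quantities, so they are treated together. The
  coefficients depend on the path but not on \<open>Y\<close>. Only \<open>p1\<close> is strictly
  positive; for the empty path \<open>q1\<close> is 0.\<close>

lemma hang_bilinear:
  assumes "0 < x"
  shows "\<exists>p0 p1 q0 q1. 0 < p1 \<and> 0 \<le> q1 \<and> (\<forall>Y.
    rooted_det x (hang_kids Ls Y) = forest x Y * (p0 + p1 * pivot x Y) \<and>
    forest x (hang_kids Ls Y) = forest x Y * (q0 + q1 * pivot x Y))"
proof (induction Ls)
  case Nil
  show ?case
    by (rule exI[of _ 0], rule exI[of _ 1], rule exI[of _ 1], rule exI[of _ 0])
      (simp add: hang_kids_simps rooted_det_def)
next
  case (Cons L Ls)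
  then obtain p0 p1 q0 q1 where pq: "0 < p1" "0 \<le> q1"
    "\<And>Y. rooted_det x (hang_kids Ls Y) = forest x Y * (p0 + p1 * pivot x Y)"
    "\<And>Y. forest x (hang_kids Ls Y) = forest x Y * (q0 + q1 * pivot x Y)"
    by blast
  let ?a = "rooted_det x L" and ?b = "forest x L"
  have pos: "0 < ?b" "0 < ?a"
    using forest_pos[OF assms] pivot_ge_1[OF assms, of L] by (auto simp: rooted_det_def)
  show ?case
  proof (intro exI conjI allI)
    show "0 < (p1 + x * q1) * ?a + x * p1 * ?b"
      using pq assms pos by (simp add: add_pos_nonneg)
    show "0 \<le> (p1 + x * q1) * ?b" using pq assms pos by simp
    fix Y
    show "rooted_det x (hang_kids (L # Ls) Y) = forest x Y *
      (((p0 + x * q0) * ?a + x * p0 * ?b) + ((p1 + x * q1) * ?a + x * p1 * ?b) * pivot x Y)"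
      by (simp add: hang_kids_simps rooted_det_add_Node[OF assms] pq algebra_simps)
    show "forest x (hang_kids (L # Ls) Y) = forest x Y *
       ((p0 + x * q0) * ?b + ((p1 + x * q1) * ?b) * pivot x Y)"
      by (simp add: hang_kids_simps elim_eq pq algebra_simps)
  qed
qed

text \<open>The strict positivity of \<open>D\<close>, here \<open>p1 + x * q1\<close>, is the
  source of the concavity.\<close>

lemma rooted_det_hang:
  assumes "0 < x"
  shows "\<exists>A B C D. 0 < D \<and> (\<forall>X Y. rooted_det x (add_mset (hang Ls Y) X) =
    forest x X * forest x Y * (A + B * pivot x X + C * pivot x Y + D * (pivot x X * pivot x Y)))"
proof -
  obtain p0 p1 q0 q1 where pq: "0 < p1" "0 \<le> q1"
    "\<And>Y. rooted_det x (hang_kids Ls Y) = forest x Y * (p0 + p1 * pivot x Y)"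
    "\<And>Y. forest x (hang_kids Ls Y) = forest x Y * (q0 + q1 * pivot x Y)"
    using hang_bilinear[OF assms, of Ls] by blast
  show ?thesis
  proof (intro exI conjI allI)
    show "0 < p1 + x * q1" using pq assms by (simp add: add_pos_nonneg)
    fix X Y
    show "rooted_det x (add_mset (hang Ls Y) X) = forest x X * forest x Y *
      (x * p0 + (p0 + x * q0) * pivot x X + x * p1 * pivot x Y
       + (p1 + x * q1) * (pivot x X * pivot x Y))"
      unfolding hang_kids rooted_det_add_Node[OF assms] pq
      by (simp add: rooted_det_def algebra_simps)
  qed
qed

section \<open>Minimal slot trees and the exchange of branches\<close>

primrec regular :: "nat \<Rightarrow> stree \<Rightarrow> bool" where
  "regular d Vacant \<longleftrightarrow> True"
| "regular d (Node M) \<longleftrightarrow> size M = d \<and> (\<forall>b\<in>#image_mset (regular d) M. b)"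

text \<open>The root has one slot more than the other vertices because at those the edge to the
  parent takes a place; so the condition survives rerooting.\<close>

definition root_regular :: "nat \<Rightarrow> stree multiset \<Rightarrow> bool" where
  "root_regular d M \<longleftrightarrow> size M = Suc d \<and> (\<forall>t\<in>#M. regular d t)"

lemma regular_Node: "regular d (Node M) \<longleftrightarrow> size M = d \<and> (\<forall>t\<in>#M. regular d t)"
  by auto

declare regular.simps(2) [simp del]
declare regular_Node [simp]

definition optimal :: "real \<Rightarrow> nat \<Rightarrow> stree multiset \<Rightarrow> bool" where
  "optimal x d M \<longleftrightarrow> root_regular d M \<and>
     (\<forall>M'. root_regular d M' \<and> nodes (Node M') = nodes (Node M) \<longrightarrow> rooted_det x M \<le> rooted_det x M')"

lemma optimal_reroot:
  assumes "0 < x" "optimal x d (add_mset (Node X) R)"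
  shows "optimal x d (add_mset (Node R) X)"
proof -
  have "root_regular d (add_mset (Node R) X)"
    using assms(2) by (auto simp: optimal_def root_regular_def)
  moreover have "nodes (Node (add_mset (Node R) X)) = nodes (Node (add_mset (Node X) R))"
    by simp
  ultimately show ?thesis
    using assms(2) unfolding optimal_def rooted_det_reroot[OF assms(1), of X R] by presburger
qed

text \<open>Moving the root to the vertex carrying \<open>X'\<close> turns the old root, with its
  remaining branches \<open>X\<close>, into the first inner vertex of the path.\<close>

lemma optimal_deeper_left:
  assumes "0 < x" "optimal x d (add_mset (hang Ls Y) (add_mset (Node X') X))"
  shows "optimal x d (add_mset (hang (X # Ls) Y) X')"
  using optimal_reroot[OF assms(1), of d X' "add_mset (hang Ls Y) X"] assms(2)
  by (simp add: add_mset_commute)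

lemma optimal_deeper_right:
  "optimal x d (add_mset (hang Ls (add_mset (Node Y') Y)) X) \<longleftrightarrow>
   optimal x d (add_mset (hang (Ls @ [Y]) Y') X)"
  by (simp add: hang_snoc)

lemma regular_hang_cong:
  "regular d (hang Ls Y) \<Longrightarrow> size Y' = size Y \<Longrightarrow> \<forall>t\<in>#Y'. regular d t \<Longrightarrow> regular d (hang Ls Y')"
  by (induction Ls) auto

lemma regular_hang_kids: "regular d (hang Ls Y) \<Longrightarrow> size Y = d \<and> (\<forall>t\<in>#Y. regular d t)"
  by (induction Ls) auto

lemma nodes_hang: "nodes (hang Ls Y) = sum_list (map (\<lambda>L. nodes (Node L)) Ls) + nodes (Node Y)"
  by (induction Ls) auto

lemma optimal_slots:
  assumes "0 < x" "optimal x d (add_mset (hang Ls Y) X)"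
  shows "size X = d" "size Y = d" "\<And>t. t \<in># X \<Longrightarrow> regular d t" "\<And>t. t \<in># Y \<Longrightarrow> regular d t"
  using assms regular_hang_kids[of d Ls Y] by (auto simp: optimal_def root_regular_def)

text \<open>Swapping two branches moves the conductance \<open>cnd x t - cnd x s\<close> from \<open>Y\<close> to \<open>X\<close>.\<close>

lemma optimal_swap:
  assumes x: "0 < x" and opt: "optimal x d (add_mset (hang Ls (add_mset t Y)) (add_mset s X))"
  shows "rooted_det x (add_mset (hang Ls (add_mset t Y)) (add_mset s X)) \<le>
    rooted_det x (add_mset (hang Ls (add_mset s Y)) (add_mset t X))"
proof -
  have "regular d (hang Ls (add_mset t Y))" "regular d s"
    using opt by (auto simp: optimal_def root_regular_def)
  moreover have "regular d t" "\<forall>u\<in>#Y. regular d u"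
    using optimal_slots(4)[OF x opt] by auto
  ultimately have "regular d (hang Ls (add_mset s Y))"
    using regular_hang_cong[of d Ls "add_mset t Y" "add_mset s Y"] by auto
  with opt \<open>regular d t\<close> have "root_regular d (add_mset (hang Ls (add_mset s Y)) (add_mset t X))"
    by (auto simp: optimal_def root_regular_def)
  with opt show ?thesis
    by (auto simp: optimal_def nodes_hang)
qed

text \<open>Along \<open>a + b\<close> constant the expression is a quadratic with leading
  coefficient \<open>- D\<close>, and a strictly concave function has no interior minimum.\<close>

lemma no_two_way_improvement:
  fixes A B C D a b u v :: real
  assumes "0 < D" "0 < u" "0 < v"
    and up: "A + B * a + C * b + D * (a * b) \<le> A + B * (a + u) + C * (b - u) + D * ((a + u) * (b - u))"
    and down: "A + B * a + C * b + D * (a * b) \<le> A + B * (a - v) + C * (b + v) + D * ((a - v) * (b + v))"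
  shows False
proof -
  have "0 \<le> u * (B - C + D * (b - a) - D * u)" using up by (simp add: algebra_simps)
  then have 1: "0 \<le> B - C + D * (b - a) - D * u" using \<open>0 < u\<close> by (simp add: zero_le_mult_iff)
  have "0 \<le> v * (- (B - C + D * (b - a)) - D * v)" using down by (simp add: algebra_simps)
  then have 2: "0 \<le> - (B - C + D * (b - a)) - D * v" using \<open>0 < v\<close> by (simp add: zero_le_mult_iff)
  have "0 < D * u" "0 < D * v" using assms by auto
  with 1 2 show False by linarith
qed

text \<open>If neither order held, swapping one pair of branches would move conductance towards
  \<open>X\<close> and swapping another pair would move it towards \<open>Y\<close>. Concavity makes
  one of the two swaps decrease the determinant.\<close>

lemma optimal_separated:
  assumes x: "0 < x" and opt: "optimal x d (add_mset (hang Ls Y) X)"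
  shows "(\<forall>s\<in>#X. \<forall>t\<in>#Y. cnd x s \<le> cnd x t) \<or> (\<forall>s\<in>#X. \<forall>t\<in>#Y. cnd x t \<le> cnd x s)"
proof (rule ccontr)
  assume "\<not> ?thesis"
  then obtain s1 t1 s2 t2 where st: "s1 \<in># X" "t1 \<in># Y" "cnd x s1 > cnd x t1"
    "s2 \<in># X" "t2 \<in># Y" "cnd x s2 < cnd x t2" by (auto simp: not_le)
  obtain A B C D where D: "0 < D" and det: "\<And>X Y. rooted_det x (add_mset (hang Ls Y) X) =
    forest x X * forest x Y * (A + B * pivot x X + C * pivot x Y + D * (pivot x X * pivot x Y))"
    using rooted_det_hang[OF x, of Ls] by blast
  let ?f = "\<lambda>a b. A + B * a + C * b + D * (a * b)"
  have swap: "?f (pivot x X) (pivot x Y) \<le>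
      ?f (pivot x X + (cnd x t - cnd x s)) (pivot x Y - (cnd x t - cnd x s))"
    if st': "s \<in># X" "t \<in># Y" for s t
  proof -
    obtain X' Y' where XY: "X = add_mset s X'" "Y = add_mset t Y'"
      using multi_member_split[OF st'(1)] multi_member_split[OF st'(2)] by blast
    have "forest x X * forest x Y * ?f (pivot x X) (pivot x Y) \<le>
        forest x X * forest x Y * ?f (cnd x t + pivot x X') (cnd x s + pivot x Y')"
      using optimal_swap[OF x opt[unfolded XY]] unfolding det by (simp add: XY algebra_simps)
    moreover have "0 < forest x X * forest x Y" using forest_pos[OF x] by simp
    ultimately have "?f (pivot x X) (pivot x Y) \<le> ?f (cnd x t + pivot x X') (cnd x s + pivot x Y')"
      by (rule mult_left_le_imp_le)
    moreover have "cnd x t + pivot x X' = pivot x X + (cnd x t - cnd x s)"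
      "cnd x s + pivot x Y' = pivot x Y - (cnd x t - cnd x s)" by (simp_all add: XY)
    ultimately show ?thesis by simp
  qed
  have "?f (pivot x X) (pivot x Y) \<le>
      ?f (pivot x X - (cnd x s1 - cnd x t1)) (pivot x Y + (cnd x s1 - cnd x t1))"
    using swap[OF st(1,2)] by (simp add: algebra_simps)
  from no_two_way_improvement[OF D _ _ swap[OF st(4,5)] this] st show False by simp
qed

section \<open>Structure of minimal trees\<close>

text \<open>The tree \<open>C_h\<close>. Counting levels of vertices makes an empty slot the
  complete tree of height 0, so slots fit into all comparisons with complete trees.\<close>

primrec full_tree :: "nat \<Rightarrow> nat \<Rightarrow> stree" where
  "full_tree d 0 = Vacant"
| "full_tree d (Suc h) = Node (replicate_mset d (full_tree d h))"

fun height_le :: "nat \<Rightarrow> stree \<Rightarrow> bool" where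
  "height_le h Vacant \<longleftrightarrow> True"
| "height_le 0 (Node M) \<longleftrightarrow> False"
| "height_le (Suc h) (Node M) \<longleftrightarrow> (\<forall>t. t \<in># M \<longrightarrow> height_le h t)"

fun filled :: "nat \<Rightarrow> stree \<Rightarrow> bool" where
  "filled 0 t \<longleftrightarrow> True"
| "filled (Suc h) Vacant \<longleftrightarrow> False"
| "filled (Suc h) (Node M) \<longleftrightarrow> (\<forall>t. t \<in># M \<longrightarrow> filled h t)"

lemma height_le_0 [simp]: "height_le 0 t \<longleftrightarrow> t = Vacant"
  by (cases t) auto

lemma height_le_mono: "height_le h t \<Longrightarrow> h \<le> k \<Longrightarrow> height_le k t"
proof (induction h t arbitrary: k rule: height_le.induct)
  case (3 h M)
  then show ?case by (cases k) auto
qed auto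

lemma filled_antimono: "filled k t \<Longrightarrow> h \<le> k \<Longrightarrow> filled h t"
proof (induction k t arbitrary: h rule: filled.induct)
  case (3 k M)
  then show ?case by (cases h) auto
qed auto

lemma regular_Suc_nonempty: "regular d (Node M) \<Longrightarrow> 1 \<le> d \<Longrightarrow> \<exists>t. t \<in># M"
  by (metis multiset_nonemptyE not_one_le_zero regular_Node size_empty)

lemma filled_le_height:
  assumes "1 \<le> d"
  shows "regular d t \<Longrightarrow> filled h t \<Longrightarrow> height_le k t \<Longrightarrow> h \<le> k"
proof (induction h t arbitrary: k rule: filled.induct)
  case (3 h M)
  obtain t where t: "t \<in># M" using regular_Suc_nonempty[OF 3(2) assms] by blast
  obtain k' where "k = Suc k'" using 3(4) by (cases k) auto
  with 3 t show ?case by auto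
qed auto

lemma mset_all_eq_replicate: "(\<And>t. t \<in># M \<Longrightarrow> t = a) \<Longrightarrow> size M = n \<Longrightarrow> M = replicate_mset n a"
  by (metis set_mset_subset_singletonD singletonI subsetI)

lemma filled_height_complete:
  "regular d t \<Longrightarrow> filled h t \<Longrightarrow> height_le h t \<Longrightarrow> t = full_tree d h"
proof (induction h t rule: filled.induct)
  case (3 h M)
  then have "M = replicate_mset d (full_tree d h)"
    by (intro mset_all_eq_replicate) auto
  then show ?case by simp
qed auto

lemma complete_props:
  "regular d (full_tree d h)" "filled h (full_tree d h)" "height_le h (full_tree d h)"
  by (induction h) (auto simp: in_replicate_mset)

text \<open>The equality clause identifies every member from a single total. The type is general
  because totals of conductances (reals) and of vertices (naturals) are both treated this
  way.\<close>

lemma sum_mset_le_replicate: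
  fixes f :: "'b \<Rightarrow> 'c :: linordered_semidom"
  assumes "\<forall>t\<in>#M. f t \<le> K"
  shows "(\<Sum>t\<in>#M. f t) \<le> of_nat (size M) * K \<and>
    ((\<Sum>t\<in>#M. f t) = of_nat (size M) * K \<longrightarrow> (\<forall>t\<in>#M. f t = K))"
  using assms
proof (induction M)
  case (add a M)
  have le: "f a \<le> K" using add.prems by simp
  have IH: "(\<Sum>t\<in>#M. f t) \<le> of_nat (size M) * K"
      "(\<Sum>t\<in>#M. f t) = of_nat (size M) * K \<longrightarrow> (\<forall>t\<in>#M. f t = K)"
    using add by simp_all
  have K: "of_nat (size (add_mset a M)) * K = K + of_nat (size M) * K"
    by (simp add: distrib_right)
  have "f a = K \<and> (\<Sum>t\<in>#M. f t) = of_nat (size M) * K"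
    if "f a + (\<Sum>t\<in>#M. f t) = K + of_nat (size M) * K"
  proof -
    have "\<not> f a < K" using add_less_le_mono[OF _ IH(1), of "f a" K] that by auto
    with le have "f a = K" by simp
    with that show ?thesis by simp
  qed
  with IH add_mono[OF le IH(1)] show ?case
    unfolding K image_mset_add_mset sum_mset.add_mset set_mset_add_mset_insert by blast
qed simp

lemma sum_mset_ge_replicate:
  fixes f :: "'b \<Rightarrow> 'c :: linordered_semidom"
  assumes "\<forall>t\<in>#M. K \<le> f t"
  shows "of_nat (size M) * K \<le> (\<Sum>t\<in>#M. f t) \<and>
    ((\<Sum>t\<in>#M. f t) = of_nat (size M) * K \<longrightarrow> (\<forall>t\<in>#M. f t = K))"
  using assms
proof (induction M)
  case (add a M)
  have le: "K \<le> f a" using add.prems by simp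
  have IH: "of_nat (size M) * K \<le> (\<Sum>t\<in>#M. f t)"
      "(\<Sum>t\<in>#M. f t) = of_nat (size M) * K \<longrightarrow> (\<forall>t\<in>#M. f t = K)"
    using add by simp_all
  have K: "of_nat (size (add_mset a M)) * K = K + of_nat (size M) * K"
    by (simp add: distrib_right)
  have "f a = K \<and> (\<Sum>t\<in>#M. f t) = of_nat (size M) * K"
    if "f a + (\<Sum>t\<in>#M. f t) = K + of_nat (size M) * K"
  proof -
    have "\<not> K < f a" using add_less_le_mono[OF _ IH(1), of K "f a"] that by auto
    with le have "f a = K" by simp
    with that show ?thesis by simp
  qed
  with IH add_mono[OF le IH(1)] show ?case
    unfolding K image_mset_add_mset sum_mset.add_mset set_mset_add_mset_insert by blast
qed simp

lemma series_conductance_mono: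
  fixes x a b :: real
  assumes "0 < x" "0 \<le> a" "0 \<le> b"
  shows "a * x / (a + x) \<le> b * x / (b + x) \<longleftrightarrow> a \<le> b"
proof -
  have "a * x / (a + x) \<le> b * x / (b + x) \<longleftrightarrow> a * x * (b + x) \<le> b * x * (a + x)"
    using assms by (simp add: field_simps)
  also have "\<dots> \<longleftrightarrow> x * x * a \<le> x * x * b" by (simp add: algebra_simps)
  also have "\<dots> \<longleftrightarrow> a \<le> b" using assms by simp
  finally show ?thesis .
qed

lemma cnd_le_iff:
  assumes "0 < x"
  shows "cnd x (Node M) \<le> cnd x (Node M') \<longleftrightarrow> pivot x M \<le> pivot x M'"
  using series_conductance_mono[OF assms, of "pivot x M" "pivot x M'"]
    pivot_ge_1[OF assms, of M] pivot_ge_1[OF assms, of M'] by (simp add: cnd_Node)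

lemma pivot_replicate: "pivot x (replicate_mset d t) = 1 + real d * cnd x t"
  by (induction d) (simp_all add: algebra_simps)

text \<open>Passing through the connecting edge is strictly monotone in the pivot, so equality at
  the root forces equality in every slot, and the induction reaches the empty slots.\<close>

lemma height_le_cnd:
  assumes "0 < x" "1 \<le> d"
  shows "regular d t \<Longrightarrow> height_le h t \<Longrightarrow> cnd x t \<le> cnd x (full_tree d h) \<and>
    (cnd x t = cnd x (full_tree d h) \<longrightarrow> t = full_tree d h)"
proof (induction h t rule: height_le.induct)
  case (1 h)
  then show ?case
    using cnd_Node_pos[OF assms(1), of "replicate_mset d (full_tree d (h - 1))"] by (cases h) auto
next
  case (3 h M)
  have le: "cnd x t \<le> cnd x (full_tree d h)" and eq: "cnd x t = cnd x (full_tree d h) \<Longrightarrow> t = full_tree d h"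
    if "t \<in># M" for t using 3 that by auto
  have sz: "size M = d" using 3 by simp
  note sum = sum_mset_le_replicate[of M "cnd x", OF ballI, OF le]
  have "pivot x M \<le> pivot x (replicate_mset d (full_tree d h))"
    using sum sz by (simp add: pivot_replicate) (simp add: pivot_def)
  moreover have "M = replicate_mset d (full_tree d h)"
    if "pivot x M = pivot x (replicate_mset d (full_tree d h))"
  proof (rule mset_all_eq_replicate)
    have "(\<Sum>t\<in>#M. cnd x t) = real (size M) * cnd x (full_tree d h)"
      using that unfolding pivot_replicate by (simp add: pivot_def sz)
    then show "t = full_tree d h" if "t \<in># M" for t using sum eq that by blast
  qed (rule sz)
  ultimately show ?case using cnd_le_iff[OF assms(1)]
    by (metis full_tree.simps(2) order_antisym order_refl)
qed auto

lemma filled_cnd: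
  assumes "0 < x" "1 \<le> d"
  shows "regular d t \<Longrightarrow> filled h t \<Longrightarrow> cnd x (full_tree d h) \<le> cnd x t \<and>
    (cnd x t = cnd x (full_tree d h) \<longrightarrow> t = full_tree d h)"
proof (induction h t rule: filled.induct)
  case (1 t)
  then show ?case
    by (cases t) (use cnd_Node_pos[OF assms(1)] in \<open>simp_all add: less_imp_le less_imp_neq[symmetric]\<close>)
next
  case (3 h M)
  have le: "cnd x (full_tree d h) \<le> cnd x t" and eq: "cnd x t = cnd x (full_tree d h) \<Longrightarrow> t = full_tree d h"
    if "t \<in># M" for t using 3 that by auto
  have sz: "size M = d" using 3 by simp
  note sum = sum_mset_ge_replicate[of M _ "cnd x", OF ballI, OF le]
  have "pivot x (replicate_mset d (full_tree d h)) \<le> pivot x M"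
    using sum sz by (simp add: pivot_replicate) (simp add: pivot_def)
  moreover have "M = replicate_mset d (full_tree d h)"
    if "pivot x M = pivot x (replicate_mset d (full_tree d h))"
  proof (rule mset_all_eq_replicate)
    have "(\<Sum>t\<in>#M. cnd x t) = real (size M) * cnd x (full_tree d h)"
      using that unfolding pivot_replicate by (simp add: pivot_def sz)
    then show "t = full_tree d h" if "t \<in># M" for t using sum eq that by blast
  qed (rule sz)
  ultimately show ?case using cnd_le_iff[OF assms(1)]
    by (metis full_tree.simps(2) order_antisym order_refl)
qed auto

text \<open>Some complete tree fits between the two: it is large enough to hold \<open>s\<close>,
  and \<open>t\<close> contains it.\<close>

definition layered :: "stree \<Rightarrow> stree \<Rightarrow> bool" where
  "layered s t \<longleftrightarrow> (\<exists>h. height_le h s \<and> filled h t)"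

text \<open>Otherwise \<open>t\<close> fits into a complete tree that \<open>s\<close> contains, and
  the assumed inequality makes all three conductances equal. By strictness both branches are that
  complete tree, and then they are comparable in either order.\<close>

lemma layered_if_cnd_le:
  assumes "0 < x" "1 \<le> d" "regular d s" "regular d t"
    and "layered s t \<or> layered t s" and le: "cnd x s \<le> cnd x t"
  shows "layered s t"
proof (rule ccontr)
  assume "\<not> layered s t"
  then obtain h where h: "height_le h t" "filled h s"
    using assms by (auto simp: layered_def)
  then have "cnd x t = cnd x (full_tree d h)" "cnd x s = cnd x (full_tree d h)"
    using height_le_cnd[OF assms(1,2,4) h(1)] filled_cnd[OF assms(1,2,3) h(2)] le by linarith+
  then have "s = full_tree d h" "t = full_tree d h"
    using height_le_cnd[OF assms(1,2,4) h(1)] filled_cnd[OF assms(1,2,3) h(2)] by auto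
  then have "layered s t" unfolding layered_def using complete_props by blast
  with \<open>\<not> layered s t\<close> show False by simp
qed

lemma height_le_nodes: "height_le (nodes t) t"
proof (induction t rule: stree_branch_induct)
  case (Node M)
  have "height_le (sum_mset (image_mset nodes M)) t" if "t \<in># M" for t
    using Node[OF that] nodes_less[OF that] height_le_mono by auto
  then show ?case by simp
qed simp

text \<open>The separating heights may differ from pair to pair. The least common bound
  \<open>h\<close> is attained by some \<open>s\<close> in \<open>X\<close>, and the height
  separating this \<open>s\<close> from a given \<open>t\<close> is at least \<open>h\<close>; so
  \<open>h\<close> serves all pairs.\<close>

lemma layered_Node:
  assumes "\<And>s t. s \<in># X \<Longrightarrow> t \<in># Y \<Longrightarrow> layered s t"
  shows "layered (Node X) (Node Y)"
proof -
  define h where "h = (LEAST h. \<forall>s. s \<in># X \<longrightarrow> height_le h s)"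
  have "\<exists>h. \<forall>s. s \<in># X \<longrightarrow> height_le h s"
    using height_le_nodes[of "Node X"] by auto
  then have h: "\<forall>s. s \<in># X \<longrightarrow> height_le h s"
    unfolding h_def by (rule LeastI_ex)
  have "filled h t" if t: "t \<in># Y" for t
  proof (cases h)
    case (Suc k)
    then have "\<not> (\<forall>s. s \<in># X \<longrightarrow> height_le k s)"
      using not_less_Least[of k "\<lambda>h. \<forall>s. s \<in># X \<longrightarrow> height_le h s"] by (simp flip: h_def)
    then obtain s where s: "s \<in># X" "\<not> height_le k s" by blast
    obtain j where j: "height_le j s" "filled j t"
      using assms[OF s(1) t] by (auto simp: layered_def)
    have "h \<le> j" using s(2) j(1) height_le_mono Suc not_less_eq_eq by blast
    with j(2) show ?thesis using filled_antimono by blast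
  qed simp
  with h have "height_le (Suc h) (Node X) \<and> filled (Suc h) (Node Y)" by simp
  then show ?thesis unfolding layered_def by blast
qed

lemma layered_Vacant [simp]: "layered Vacant t"
  unfolding layered_def by (rule exI[of _ 0]) simp

text \<open>
  Branches that point away from each other are comparable: the numerical separation of the
  conductances of their sub-branches is turned into a separation by complete trees, and the
  strictness in \<open>height_le_cnd\<close> and \<open>filled_cnd\<close> takes care of equal conductances.
\<close>

lemma optimal_layered:
  assumes x: "0 < x" and d: "1 \<le> d"
  shows "optimal x d (add_mset (hang Ls Y) X) \<Longrightarrow>
    layered (Node X) (Node Y) \<or> layered (Node Y) (Node X)"
proof (induction "nodes (Node X)" arbitrary: X Y Ls rule: less_induct)
  case less
  note slots = optimal_slots[OF x less.prems]
  have comparable: "layered s t \<or> layered t s" if st: "s \<in># X" "t \<in># Y" for s t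
  proof (cases "s = Vacant \<or> t = Vacant")
    case False
    then obtain X1 Y1 where N: "s = Node X1" "t = Node Y1" by (metis stree.exhaust)
    obtain X2 Y2 where XY: "X = add_mset s X2" "Y = add_mset t Y2"
      using multi_member_split[OF st(1)] multi_member_split[OF st(2)] by blast
    \<comment> \<open>The path is prolonged at both ends, to the roots of \<open>s\<close> and
      \<open>t\<close>. The induction is on the near end alone: \<open>s\<close> has fewer vertices
      than \<open>Node X\<close>, while the path and the far end are arbitrary.\<close>
    have "optimal x d (add_mset (hang (X2 # Ls) Y) X1)"
      using optimal_deeper_left[OF x] less.prems unfolding XY N by blast
    then have "optimal x d (add_mset (hang ((X2 # Ls) @ [Y2]) Y1) X1)"
      unfolding XY N by (rule optimal_deeper_right[THEN iffD1])
    from less.hyps[OF _ this] show ?thesis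
      using nodes_less[OF st(1)] N by simp
  qed auto
  from optimal_separated[OF x less.prems]
  show ?case
  proof
    assume "\<forall>s\<in>#X. \<forall>t\<in>#Y. cnd x s \<le> cnd x t"
    then have "layered s t" if "s \<in># X" "t \<in># Y" for s t
      using layered_if_cnd_le[OF x d slots(3)[OF that(1)] slots(4)[OF that(2)]] comparable that by blast
    then show ?thesis using layered_Node by blast
  next
    assume "\<forall>s\<in>#X. \<forall>t\<in>#Y. cnd x t \<le> cnd x s"
    then have "layered t s" if "s \<in># X" "t \<in># Y" for s t
      using layered_if_cnd_le[OF x d slots(4)[OF that(2)] slots(3)[OF that(1)]] comparable that by blast
    then show ?thesis using layered_Node by blast
  qed
qed

lemma layered_filled:
  assumes "1 \<le> d" "regular d s" "layered s t" "filled h s"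
  shows "filled h t"
  using assms filled_le_height filled_antimono unfolding layered_def by blast

lemma layered_height_le:
  assumes "1 \<le> d" "regular d t" "layered s t" "height_le h t"
  shows "height_le h s"
  using assms filled_le_height height_le_mono unfolding layered_def by blast

text \<open>Only the root moves, so both multisets represent the same graph
  (\<open>reroot_rep\<close>).\<close>

inductive reroot :: "stree multiset \<Rightarrow> stree multiset \<Rightarrow> bool" where
  reroot_refl: "reroot M M"
| reroot_step: "reroot M (add_mset (Node X) R) \<Longrightarrow> reroot M (add_mset (Node R) X)"

lemma reroot_optimal: "reroot M M' \<Longrightarrow> 0 < x \<Longrightarrow> optimal x d M \<Longrightarrow> optimal x d M'"
  by (induction rule: reroot.induct) (auto intro: optimal_reroot)

text \<open>
  Rooting the tree at a centre (a vertex minimizing the eccentricity \<open>H\<close>), or at one of its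
  neighbours, makes the levels filled.
\<close>

lemma optimal_centre:
  assumes x: "0 < x" and d: "1 \<le> d" and opt: "optimal x d M" and n: "1 < nodes (Node M)"
  shows "\<exists>M' H. reroot M M' \<and> (\<forall>s. s \<in># M' \<longrightarrow> height_le (Suc H) s \<and> filled H s)"
proof -
  define Q where "Q h \<longleftrightarrow> (\<exists>M'. reroot M M' \<and> (\<forall>s. s \<in># M' \<longrightarrow> height_le h s))" for h
  define H where "H = (LEAST h. Q h)"
  have "Q (sum_mset (image_mset nodes M))"
    unfolding Q_def using height_le_nodes[of "Node M"] by (auto intro: reroot_refl)
  then have "Q H" unfolding H_def by (rule LeastI)
  then obtain M1 where M1: "reroot M M1" "\<And>s. s \<in># M1 \<Longrightarrow> height_le H s"
    unfolding Q_def by blast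
  have nodes_eq: "nodes (Node M') = nodes (Node M)" if "reroot M M'" for M'
    using that by (induction rule: reroot.induct) auto
  have "H \<noteq> 0"
  proof
    assume "H = 0"
    then have "\<And>s. s \<in># M1 \<Longrightarrow> s = Vacant" using M1(2) by simp
    then have "image_mset nodes M1 = image_mset (\<lambda>_. 0) M1" by (intro image_mset_cong) auto
    then have "sum_mset (image_mset nodes M1) = 0" by (simp only: sum_mset.neutral_const)
    then have "nodes (Node M1) = 1" by (simp only: nodes.simps)
    then show False using nodes_eq[OF M1(1)] n by linarith
  qed
  then obtain h where H: "H = Suc h" by (cases H) auto
  have notQ: "\<not> Q h" using not_less_Least[of h Q] H unfolding H_def by simp
  then obtain s1 where s1: "s1 \<in># M1" "\<not> height_le h s1" using M1(1) unfolding Q_def by blast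
  then obtain X where X: "s1 = Node X" by (cases s1) auto
  obtain R where R: "M1 = add_mset (Node X) R" using multi_member_split[OF s1(1)] X by blast
  have hX: "height_le H (Node X)" "\<not> height_le h (Node X)" using M1(2) s1 X by auto
  have hR: "height_le H s" if "s \<in># R" for s using M1(2) that R by auto
  have reM2: "reroot M (add_mset (Node R) X)" using M1(1) R by (auto intro: reroot_step)
  have hX': "height_le h s" if "s \<in># X" for s using hX(1) H that by auto
  \<comment> \<open>At the other end of the edge every branch in \<open>X\<close> has at most
    \<open>h\<close> levels; minimality of \<open>H\<close> leaves only \<open>Node R\<close> to
    exceed \<open>h\<close>.\<close>
  have hR': "\<not> height_le h (Node R)"
  proof
    assume "height_le h (Node R)"
    with hX' have "\<forall>s. s \<in># add_mset (Node R) X \<longrightarrow> height_le h s" by simp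
    then have "Q h" unfolding Q_def using reM2 by blast
    with notQ show False by simp
  qed
  have optM1: "optimal x d (add_mset (Node X) R)" using reroot_optimal[OF M1(1) x opt] R by simp
  have optM2: "optimal x d (add_mset (hang [] R) X)" using reroot_optimal[OF reM2 x opt] by simp
  note slots = optimal_slots[OF x optM2]
  have reg: "regular d (Node X)" "regular d (Node R)" using slots by simp_all
  have member: "\<exists>N K. regular d (Node N) \<and> filled h (Node N) \<and> L = add_mset (Node N) K"
    if L: "regular d (Node L)" "filled H (Node L)" "h \<noteq> 0" for L
  proof -
    obtain s where s: "s \<in># L" using regular_Suc_nonempty[OF L(1) d] by blast
    then have f: "filled h s" using L(2) H by simp
    then obtain N where N: "s = Node N" using L(3) by (cases s; cases h) auto
    obtain K where "L = add_mset s K" using multi_member_split[OF s] by blast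
    then show ?thesis using f N L(1) s by auto
  qed
  have pairX: "layered (Node X) (Node R) \<or> layered (Node R) (Node X)"
    by (rule optimal_layered[OF x d optM2])
  then show ?thesis
  proof
    assume "layered (Node X) (Node R)"
    then have fR: "filled H (Node R)"
      using hX(2) H filled_antimono height_le_mono unfolding layered_def by (metis not_less_eq_eq)
    \<comment> \<open>The root of \<open>M1\<close> is kept. The branches in \<open>R\<close> are
      filled to \<open>h\<close>, so only \<open>Node X\<close> is in question. It is compared with
      a branch \<open>Y\<close> of \<open>R\<close>; if \<open>Y\<close> turns out to be the larger
      one, it has a branch \<open>Z\<close> filled to \<open>h\<close> and of height at most
      \<open>h\<close>, and \<open>Z\<close> is too low to dominate \<open>Node X\<close>.\<close>
    have "filled h (Node X)"
    proof (cases "h = 0")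
      case False
      obtain Y R' where Y: "regular d (Node Y)" "filled h (Node Y)" "R = add_mset (Node Y) R'"
        using member[OF reg(2) fR False] by blast
      have optY: "optimal x d (add_mset (hang [R'] Y) X)"
        using optM2 Y(3) by (simp add: hang_snoc)
      have "layered (Node X) (Node Y) \<or> layered (Node Y) (Node X)"
        by (rule optimal_layered[OF x d optY])
      then show ?thesis
      proof
        assume "layered (Node X) (Node Y)"
        then have fY: "filled H (Node Y)"
          using hX(2) H filled_antimono height_le_mono unfolding layered_def by (metis not_less_eq_eq)
        obtain Z Y' where Z: "regular d (Node Z)" "filled h (Node Z)" "Y = add_mset (Node Z) Y'"
          using member[OF Y(1) fY False] by blast
        have "height_le H (Node Y)" using hR Y(3) by simp
        then have hZ: "height_le h (Node Z)" using Z(3) H by simp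
        have optZ: "optimal x d (add_mset (hang ([R'] @ [Y']) Z) X)"
          using optY Z(3) by simp
        from optimal_layered[OF x d optZ] show ?thesis
        proof
          assume "layered (Node X) (Node Z)"
          then have "height_le h (Node X)" using layered_height_le[OF d Z(1) _ hZ] by blast
          with hX show ?thesis by simp
        next
          assume "layered (Node Z) (Node X)"
          then show ?thesis using layered_filled[OF d Z(1) _ Z(2)] by blast
        qed
      next
        assume "layered (Node Y) (Node X)"
        then show ?thesis using layered_filled[OF d Y(1) _ Y(2)] by blast
      qed
    qed simp
    then have "\<forall>s. s \<in># M1 \<longrightarrow> height_le (Suc h) s \<and> filled h s"
      using M1(2) fR H R by auto
    with M1(1) show ?thesis by blast
  next
    assume "layered (Node R) (Node X)"
    then have fX: "filled H (Node X)"
      using hR' H filled_antimono height_le_mono unfolding layered_def by (metis not_less_eq_eq)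
    have hRH: "height_le H (Node R)"
      using layered_height_le[OF d reg(1) \<open>layered (Node R) (Node X)\<close> hX(1)] .
    \<comment> \<open>Now the root lies across the edge and only \<open>Node R\<close> is in
      question. A branch \<open>Z\<close> of \<open>X\<close> has height at most \<open>h\<close>,
      so it cannot dominate \<open>Node R\<close>, which is higher; hence \<open>Node R\<close>
      dominates \<open>Z\<close>, which is filled to \<open>h\<close>.\<close>
    have "filled h (Node R)"
    proof (cases "h = 0")
      case False
      obtain Z X' where Z: "regular d (Node Z)" "filled h (Node Z)" "X = add_mset (Node Z) X'"
        using member[OF reg(1) fX False] by blast
      have hZ: "height_le h (Node Z)" using hX' Z(3) by simp
      have optZ: "optimal x d (add_mset (hang [X'] R) Z)"
        using optimal_deeper_left[OF x, of d "[]" R Z X'] optM2 Z(3) by simp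
      from optimal_layered[OF x d optZ] show ?thesis
      proof
        assume "layered (Node R) (Node Z)"
        then have "height_le h (Node R)" using layered_height_le[OF d Z(1) _ hZ] by blast
        with hR' show ?thesis by simp
      next
        assume "layered (Node Z) (Node R)"
        then show ?thesis using layered_filled[OF d Z(1) _ Z(2)] by blast
      qed
    qed simp
    then have "\<forall>s. s \<in># add_mset (Node R) X \<longrightarrow> height_le (Suc h) s \<and> filled h s"
      using hX' fX hRH H height_le_mono[of h _ "Suc h"] by auto
    with reM2 show ?thesis by blast
  qed
qed

text \<open>Condition (3) of the greedy tree at one vertex, restricted to the two heights that
  complete subtrees can have on a given level.\<close>

definition almost_complete :: "nat \<Rightarrow> nat \<Rightarrow> stree multiset \<Rightarrow> bool" where
  "almost_complete d k M \<longleftrightarrow> size {#t \<in># M. t \<noteq> full_tree d k \<and> t \<noteq> full_tree d (Suc k)#} \<le> 1"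

text \<open>\<open>k\<close> levels are completely filled and one further level may be partly
  filled. For \<open>k = 0\<close> this leaves an empty slot or a single vertex, which is
  \<open>full_tree d 1\<close>.\<close>

fun greedy :: "nat \<Rightarrow> nat \<Rightarrow> stree \<Rightarrow> bool" where
  "greedy d 0 t \<longleftrightarrow> t = Vacant \<or> t = full_tree d 1"
| "greedy d (Suc k) Vacant \<longleftrightarrow> False"
| "greedy d (Suc k) (Node M) \<longleftrightarrow>
     size M = d \<and> (\<forall>t. t \<in># M \<longrightarrow> greedy d k t) \<and> almost_complete d k M"

lemma size_filter_le_1I:
  assumes "\<And>s t M'. M = add_mset s (add_mset t M') \<Longrightarrow> \<not> P s \<or> \<not> P t"
  shows "size {#t \<in># M. P t#} \<le> 1"
proof (rule ccontr)
  assume "\<not> ?thesis"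
  then obtain s K where s: "filter_mset P M = add_mset s K" "K \<noteq> {#}"
    by (cases "filter_mset P M") auto
  then obtain t K' where t: "filter_mset P M = add_mset s (add_mset t K')"
    by (cases K) auto
  then have "add_mset s (add_mset t K') \<subseteq># M" by (metis multiset_filter_subset)
  then obtain M' where "M = add_mset s (add_mset t M')"
    by (metis mset_subset_eq_exists_conv union_mset_add_mset_left)
  moreover have "P s" "P t"
    using t by (metis add_mset_commute filter_mset_eq_conv union_single_eq_member)+
  ultimately show False using assms by blast
qed

text \<open>Siblings point away from each other along the path through their parent, so a complete
  tree fits between them. Its height can only be \<open>k\<close> or \<open>Suc k\<close>: in the
  first case the smaller sibling equals it, in the second the larger one.\<close>

lemma optimal_siblings:
  assumes x: "0 < x" and d: "1 \<le> d"
    and opt: "optimal x d (add_mset s (add_mset t M))"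
    and s: "height_le (Suc k) s" "filled k s" and t: "height_le (Suc k) t" "filled k t"
  shows "s = full_tree d k \<or> s = full_tree d (Suc k) \<or> t = full_tree d k \<or> t = full_tree d (Suc k)"
proof -
  have reg: "regular d s" "regular d t" using opt by (auto simp: optimal_def root_regular_def)
  show ?thesis
  proof (cases "s = Vacant \<or> t = Vacant")
    case True
    with s t have "k = 0" by (cases k) auto
    with True show ?thesis by auto
  next
    case False
    then obtain S T where N: "s = Node S" "t = Node T" by (metis stree.exhaust)
    have "optimal x d (add_mset (hang [M] T) S)"
      using optimal_reroot[OF x, of d S "add_mset t M"] opt N by (simp add: hang_snoc)
    from optimal_layered[OF x d this] have "layered s t \<or> layered t s" by (simp add: N)
    moreover have "u = full_tree d k \<or> v = full_tree d (Suc k)"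
      if "layered u v" "regular d u" "regular d v" "filled k u" "height_le (Suc k) v" for u v
    proof -
      obtain h where h: "height_le h u" "filled h v" using \<open>layered u v\<close> by (auto simp: layered_def)
      have "k \<le> h" "h \<le> Suc k"
        using filled_le_height[OF d that(2,4) h(1)] filled_le_height[OF d that(3) h(2) that(5)] by auto
      then have "h = k \<or> h = Suc k" by auto
      then show ?thesis using filled_height_complete h that by blast
    qed
    ultimately show ?thesis using reg s t by blast
  qed
qed

lemma optimal_greedy_branch:
  assumes x: "0 < x" and d: "1 \<le> d"
  shows "optimal x d (add_mset U R) \<Longrightarrow> height_le (Suc k) U \<Longrightarrow> filled k U \<Longrightarrow> greedy d k U"
proof (induction k arbitrary: U R)
  case 0
  have "regular d U" using 0 by (auto simp: optimal_def root_regular_def)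
  then show ?case
  proof (cases U)
    case (Node M)
    with 0 \<open>regular d U\<close> have "M = replicate_mset d Vacant"
      by (intro mset_all_eq_replicate) auto
    with Node show ?thesis by simp
  qed simp
next
  case (Suc k)
  then obtain M where M: "U = Node M" by (cases U) auto
  \<comment> \<open>With the root moved into \<open>U\<close>, the rest of the tree becomes one more
    branch, and the children of \<open>U\<close> become siblings at the root.\<close>
  have opt: "optimal x d (add_mset (Node R) M)" using optimal_reroot[OF x] Suc.prems(1) M by blast
  have hf: "height_le (Suc k) s \<and> filled k s" if "s \<in># M" for s
    using Suc.prems(2,3) M that by auto
  have "size M = d" using opt by (auto simp: optimal_def root_regular_def)
  moreover have "greedy d k s" if "s \<in># M" for s
  proof -
    obtain M' where "M = add_mset s M'" using multi_member_split[OF \<open>s \<in># M\<close>] by blast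
    with opt have "optimal x d (add_mset s (add_mset (Node R) M'))" by (simp add: add_mset_commute)
    with Suc.IH show ?thesis using hf that by blast
  qed
  moreover have "almost_complete d k M"
    unfolding almost_complete_def
  proof (rule size_filter_le_1I)
    fix s t M' assume st: "M = add_mset s (add_mset t M')"
    with opt have "optimal x d (add_mset s (add_mset t (add_mset (Node R) M')))"
      by (simp add: add_mset_commute)
    from optimal_siblings[OF x d this, of k] hf st
    show "\<not> (s \<noteq> full_tree d k \<and> s \<noteq> full_tree d (Suc k)) \<or> \<not> (t \<noteq> full_tree d k \<and> t \<noteq> full_tree d (Suc k))"
      by auto
  qed
  ultimately show ?case by (simp add: M)
qed

definition greedy_root :: "nat \<Rightarrow> nat \<Rightarrow> stree multiset \<Rightarrow> bool" where
  "greedy_root d k M \<longleftrightarrow> size M = Suc d \<and> Vacant \<notin># M \<and> (\<forall>t. t \<in># M \<longrightarrow> greedy d k t) \<and> almost_complete d k M"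

theorem optimal_greedy_root:
  assumes x: "0 < x" and d: "1 \<le> d" and opt: "optimal x d M" and n: "d + 2 \<le> nodes (Node M)"
  shows "\<exists>M' k. reroot M M' \<and> greedy_root d k M'"
proof -
  obtain M' k where M': "reroot M M'" "\<And>s. s \<in># M' \<Longrightarrow> height_le (Suc k) s \<and> filled k s"
    using optimal_centre[OF x d opt] n by auto
  have opt': "optimal x d M'" using reroot_optimal[OF M'(1) x opt] .
  have "nodes (Node M') = nodes (Node M)"
    using M'(1) by (induction rule: reroot.induct) auto
  have size: "size M' = Suc d" using opt' by (simp add: optimal_def root_regular_def)
  have "greedy d k s" if "s \<in># M'" for s
    using optimal_greedy_branch[OF x d] M'(2) opt' that by (metis multi_member_split)
  moreover have "almost_complete d k M'"
    unfolding almost_complete_def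
  proof (rule size_filter_le_1I)
    fix s t K assume st: "M' = add_mset s (add_mset t K)"
    from optimal_siblings[OF x d, of s t K k] opt' M'(2) st
    show "\<not> (s \<noteq> full_tree d k \<and> s \<noteq> full_tree d (Suc k)) \<or> \<not> (t \<noteq> full_tree d k \<and> t \<noteq> full_tree d (Suc k))"
      by auto
  qed
  moreover have "Vacant \<notin># M'"
  proof
    \<comment> \<open>An empty slot at the root forces \<open>k = 0\<close>, hence at most one
      vertex in each of the other \<open>d\<close> branches and at most \<open>d + 1\<close>
      vertices in all.\<close>
    assume V: "Vacant \<in># M'"
    then have "k = 0" using M'(2)[OF V] by (cases k) auto
    then have le1: "nodes s \<le> 1" if "s \<in># M'" for s
      using calculation(1)[OF that] by (auto simp: sum_mset_0_iff in_replicate_mset)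
    obtain K where K: "M' = add_mset Vacant K" using multi_member_split[OF V] by blast
    then have "nodes s \<le> 1" if "s \<in># K" for s using le1 that by simp
    then have "sum_mset (image_mset nodes K) \<le> size K"
      by (induction K) (auto simp: add_le_mono[of _ 1, simplified])
    then show False using size K n \<open>nodes (Node M') = nodes (Node M)\<close> by simp
  qed
  ultimately show ?thesis using M'(1) size unfolding greedy_root_def by blast
qed

section \<open>Uniqueness of greedy trees and the lower bound\<close>

lemma nodes_full_less:
  assumes "1 \<le> d"
  shows "nodes (full_tree d k) < nodes (full_tree d (Suc k))"
proof -
  have "nodes (full_tree d k) \<le> d * nodes (full_tree d k)"
    using mult_le_mono1[OF assms, of "nodes (full_tree d k)"] by simp
  then have "nodes (full_tree d k) < Suc (d * nodes (full_tree d k))" by linarith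
  then show ?thesis by simp
qed

lemma nodes_full_strict_mono:
  "1 \<le> d \<Longrightarrow> strict_mono (\<lambda>k. nodes (full_tree d k))"
  unfolding strict_mono_Suc_iff using nodes_full_less by blast

lemma greedy_nodes:
  assumes d: "1 \<le> d"
  shows "greedy d k t \<Longrightarrow> nodes (full_tree d k) \<le> nodes t \<and> nodes t \<le> nodes (full_tree d (Suc k)) \<and>
    (nodes t = nodes (full_tree d k) \<longrightarrow> t = full_tree d k) \<and>
    (nodes t = nodes (full_tree d (Suc k)) \<longrightarrow> t = full_tree d (Suc k))"
proof (induction d k t rule: greedy.induct)
  case (3 d k M)
  have sz: "size M = d" using 3 by simp
  have lo: "nodes (full_tree d k) \<le> nodes t" and hi: "nodes t \<le> nodes (full_tree d (Suc k))"
    and eqs: "nodes t = nodes (full_tree d k) \<Longrightarrow> t = full_tree d k"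
      "nodes t = nodes (full_tree d (Suc k)) \<Longrightarrow> t = full_tree d (Suc k)" if "t \<in># M" for t
    using 3 that by auto
  note L = sum_mset_ge_replicate[of M _ nodes, OF ballI, OF lo]
  note U = sum_mset_le_replicate[of M nodes, OF ballI, OF hi]
  have "M = replicate_mset d (full_tree d k)" if "nodes (Node M) = nodes (full_tree d (Suc k))"
  proof (rule mset_all_eq_replicate)
    have "(\<Sum>t\<in>#M. nodes t) = of_nat (size M) * nodes (full_tree d k)"
      using that sz by simp
    then show "t = full_tree d k" if "t \<in># M" for t
      using L eqs(1) that by blast
  qed (rule sz)
  moreover have "M = replicate_mset d (full_tree d (Suc k))"
    if "nodes (Node M) = nodes (full_tree d (Suc (Suc k)))"
  proof (rule mset_all_eq_replicate)
    have "(\<Sum>t\<in>#M. nodes t) = of_nat (size M) * nodes (full_tree d (Suc k))"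
      using that sz unfolding full_tree.simps(2)[of d "Suc k"]
      by (simp del: full_tree.simps)
    then show "t = full_tree d (Suc k)" if "t \<in># M" for t
      using U eqs(2) that by blast
  qed (rule sz)
  moreover have "nodes (full_tree d (Suc k)) \<le> nodes (Node M)"
    using L sz by simp
  moreover have "nodes (Node M) \<le> nodes (full_tree d (Suc (Suc k)))"
    using U sz unfolding full_tree.simps(2)[of d "Suc k"] by (simp del: full_tree.simps)
  ultimately show ?case by (metis full_tree.simps(2))
qed auto

text \<open>The distinguished member \<open>s\<close> must differ from the larger complete tree but
  may be the smaller one, which stands in for it when there is no genuine exception. Its excess over
  the smaller tree is then a remainder below the difference of the two sizes.\<close>

lemma greedy_mset_normal_form:
  assumes greedy: "\<And>t. t \<in># M \<Longrightarrow> greedy d k t" and ac: "almost_complete d k M"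
  shows "M = replicate_mset (size M) (full_tree d (Suc k)) \<or>
    (\<exists>i s j. greedy d k s \<and> s \<noteq> full_tree d (Suc k) \<and>
      M = replicate_mset i (full_tree d (Suc k)) + add_mset s (replicate_mset j (full_tree d k)))"
proof -
  let ?F = "full_tree d (Suc k)" and ?G = "full_tree d k"
  define i where "i = size (filter_mset (\<lambda>t. t = ?F) M)"
  define R where "R = filter_mset (\<lambda>t. t \<noteq> ?F) M"
  have "filter_mset (\<lambda>t. t = ?F) M = replicate_mset i ?F"
    unfolding i_def by (rule mset_all_eq_replicate) auto
  then have M: "M = replicate_mset i ?F + R"
    unfolding R_def using multiset_partition[of M "\<lambda>t. t = ?F"] by simp
  define S where "S = filter_mset (\<lambda>t. t \<noteq> ?G) R"
  define j where "j = size (filter_mset (\<lambda>t. t = ?G) R)"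
  have "filter_mset (\<lambda>t. t = ?G) R = replicate_mset j ?G"
    unfolding j_def by (rule mset_all_eq_replicate) auto
  then have R: "R = S + replicate_mset j ?G"
    unfolding S_def using multiset_partition[of R "\<lambda>t. t = ?G"] by (metis add.commute)
  have "S = {#t \<in># M. t \<noteq> ?G \<and> t \<noteq> ?F#}"
    unfolding S_def R_def by (simp add: filter_filter_mset conj_commute)
  then have "size S \<le> 1" using ac by (simp add: almost_complete_def)
  then consider "S = {#}" "j = 0" | j' where "S = {#}" "j = Suc j'" | s where "S = {#s#}"
    by (metis One_nat_def le_Suc_eq le_zero_eq not0_implies_Suc size_1_singleton_mset size_eq_0_iff_empty)
  then show ?thesis
  proof cases
    case 1
    then show ?thesis using M R by simp
  next
    case 2
    then have "R = add_mset ?G (replicate_mset j' ?G)" using R by simp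
    moreover have "?G \<in># R" using calculation by simp
    then have "?G \<in># M" "?G \<noteq> ?F" unfolding R_def by auto
    ultimately show ?thesis using M greedy by blast
  next
    case 3
    then have "R = add_mset s (replicate_mset j ?G)" using R by simp
    moreover have "s \<in># R" using calculation by simp
    then have "s \<in># M" "s \<noteq> ?F" unfolding R_def by auto
    ultimately show ?thesis using M greedy by blast
  qed
qed

text \<open>Beyond \<open>size M\<close> copies of the smaller complete tree there are
  \<open>i * D + r\<close> vertices with \<open>r < D\<close>. Division with remainder recovers the
  number \<open>i\<close> of larger trees and the size of the exceptional branch, which
  \<open>IH\<close> then determines.\<close>

lemma greedy_mset_unique:
  assumes d: "1 \<le> d"
    and IH: "\<And>s t. greedy d k s \<Longrightarrow> greedy d k t \<Longrightarrow> nodes s = nodes t \<Longrightarrow> s = t"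
    and M: "\<And>t. t \<in># M \<Longrightarrow> greedy d k t" "almost_complete d k M"
    and M': "\<And>t. t \<in># M' \<Longrightarrow> greedy d k t" "almost_complete d k M'"
    and sz: "size M = size M'" and nd: "(\<Sum>t\<in>#M. nodes t) = (\<Sum>t\<in>#M'. nodes t)"
  shows "M = M'"
proof -
  let ?F = "full_tree d (Suc k)" and ?G = "full_tree d k"
  define D where "D = nodes ?F - nodes ?G"
  have F: "nodes ?F = nodes ?G + D" "0 < D"
    using nodes_full_less[OF d, of k] by (simp_all add: D_def)
  have nf: "\<exists>i r. r < D \<and> (\<Sum>t\<in>#M. nodes t) = size M * nodes ?G + (i * D + r) \<and>
      (M = replicate_mset (size M) ?F \<and> i = size M \<or>
       (\<exists>s j. greedy d k s \<and> nodes s = nodes ?G + r \<and> Suc (i + j) = size M \<and>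
         M = replicate_mset i ?F + add_mset s (replicate_mset j ?G)))"
    if "\<And>t. t \<in># M \<Longrightarrow> greedy d k t" "almost_complete d k M" for M
    using greedy_mset_normal_form[of M d k, OF that]
  proof
    assume *: "M = replicate_mset (size M) ?F"
    have "(\<Sum>t\<in>#M. nodes t) = size M * nodes ?F"
      by (subst *) (simp del: full_tree.simps)
    then show ?thesis using * F
      by (intro exI[of _ "size M"] exI[of _ 0]) (simp add: algebra_simps del: full_tree.simps)
  next
    assume "\<exists>i s j. greedy d k s \<and> s \<noteq> ?F \<and>
      M = replicate_mset i ?F + add_mset s (replicate_mset j ?G)"
    then obtain i s j where s: "greedy d k s" "s \<noteq> ?F"
      "M = replicate_mset i ?F + add_mset s (replicate_mset j ?G)" by blast
    have "nodes ?G \<le> nodes s" "nodes s < nodes ?F"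
      using greedy_nodes[OF d s(1)] s(2) by (auto simp: le_less simp del: full_tree.simps)
    then have r: "nodes s - nodes ?G < D" "nodes s = nodes ?G + (nodes s - nodes ?G)"
      using F by linarith+
    have size: "Suc (i + j) = size M" by (simp add: s(3))
    have "(\<Sum>t\<in>#M. nodes t) = i * nodes ?F + (nodes s + j * nodes ?G)"
      unfolding s(3) by (simp del: full_tree.simps)
    also have "\<dots> = size M * nodes ?G + (i * D + (nodes s - nodes ?G))"
      using r(2) unfolding F(1) size[symmetric] by (simp add: algebra_simps)
    finally show ?thesis using r s(1,3) size by blast
  qed
  obtain i r where 1: "r < D" "(\<Sum>t\<in>#M. nodes t) = size M * nodes ?G + (i * D + r)"
    "M = replicate_mset (size M) ?F \<and> i = size M \<or>
       (\<exists>s j. greedy d k s \<and> nodes s = nodes ?G + r \<and> Suc (i + j) = size M \<and>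
         M = replicate_mset i ?F + add_mset s (replicate_mset j ?G))"
    using nf[OF M] by blast
  obtain i' r' where 2: "r' < D" "(\<Sum>t\<in>#M'. nodes t) = size M' * nodes ?G + (i' * D + r')"
    "M' = replicate_mset (size M') ?F \<and> i' = size M' \<or>
       (\<exists>s j. greedy d k s \<and> nodes s = nodes ?G + r' \<and> Suc (i' + j) = size M' \<and>
         M' = replicate_mset i' ?F + add_mset s (replicate_mset j ?G))"
    using nf[OF M'] by blast
  have "i * D + r = i' * D + r'" using 1(2) 2(2) nd sz by simp
  then have "(i * D + r) div D = (i' * D + r') div D" "(i * D + r) mod D = (i' * D + r') mod D"
    by simp_all
  then have ir: "i = i'" "r = r'" using 1(1) 2(1) by simp_all
  from 1(3) show ?thesis
  proof
    assume "M = replicate_mset (size M) ?F \<and> i = size M"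
    then show ?thesis using 2(3) ir sz by auto
  next
    assume "\<exists>s j. greedy d k s \<and> nodes s = nodes ?G + r \<and> Suc (i + j) = size M \<and>
         M = replicate_mset i ?F + add_mset s (replicate_mset j ?G)"
    then obtain s j where s: "greedy d k s" "nodes s = nodes ?G + r" "Suc (i + j) = size M"
      "M = replicate_mset i ?F + add_mset s (replicate_mset j ?G)" by blast
    then obtain s' j' where s': "greedy d k s'" "nodes s' = nodes ?G + r" "Suc (i + j') = size M"
      "M' = replicate_mset i ?F + add_mset s' (replicate_mset j' ?G)"
      using 2(3) ir sz by (metis lessI less_add_Suc1 less_irrefl)
    have "s = s'" "j = j'" using IH[OF s(1) s'(1)] s s' by auto
    then show ?thesis using s(4) s'(4) by simp
  qed
qed

lemma greedy_unique:
  assumes d: "1 \<le> d"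
  shows "greedy d k s \<Longrightarrow> greedy d k t \<Longrightarrow> nodes s = nodes t \<Longrightarrow> s = t"
proof (induction k arbitrary: s t)
  case (Suc k)
  then obtain M M' where N: "s = Node M" "t = Node M'"
    by (metis greedy.simps(2) stree.exhaust)
  have "M = M'"
    using Suc.prems unfolding N
    by (intro greedy_mset_unique[OF d Suc.IH]) auto
  then show ?case using N by simp
qed auto

lemma greedy_root_unique:
  assumes d: "1 \<le> d" and M: "greedy_root d k M" and M': "greedy_root d k' M'"
    and nd: "nodes (Node M) = nodes (Node M')"
  shows "M = M'"
proof -
  \<comment> \<open>For \<open>k < k'\<close> the largest total possible with \<open>k\<close> is at
    most the smallest possible with \<open>k'\<close>. Equal totals make all branches complete with
    \<open>k' = Suc k\<close>: a tree that satisfies the condition for both parameters, so the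
    multisets agree after all.\<close>
  have impossible: False if "k < k'" "greedy_root d k M" "greedy_root d k' M'"
    "nodes (Node M) = nodes (Node M')" "M \<noteq> M'" for k k' M M'
  proof -
    note mono = nodes_full_strict_mono[OF d]
    have sz: "size M = Suc d" "size M' = Suc d" using that by (auto simp: greedy_root_def)
    have U: "nodes t \<le> nodes (full_tree d (Suc k))" if "t \<in># M" for t
      using greedy_nodes[OF d] \<open>greedy_root d k M\<close> that unfolding greedy_root_def by blast
    have L: "nodes (full_tree d k') \<le> nodes t" if "t \<in># M'" for t
      using greedy_nodes[OF d] \<open>greedy_root d k' M'\<close> that unfolding greedy_root_def by blast
    note U' = sum_mset_le_replicate[of M nodes, OF ballI, OF U] and L' = sum_mset_ge_replicate[of M' _ nodes, OF ballI, OF L]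
    have ge: "nodes (full_tree d (Suc k)) \<le> nodes (full_tree d k')"
      using strict_mono_less_eq[OF mono, of "Suc k" k'] \<open>k < k'\<close> by simp
    have sums: "(\<Sum>t\<in>#M. nodes t) \<le> Suc d * nodes (full_tree d (Suc k))"
      "Suc d * nodes (full_tree d k') \<le> (\<Sum>t\<in>#M'. nodes t)"
      "(\<Sum>t\<in>#M. nodes t) = (\<Sum>t\<in>#M'. nodes t)"
      using conjunct1[OF U'] conjunct1[OF L'] that(4) unfolding sz by (simp_all only: of_nat_id nodes.simps)
    have "Suc d * nodes (full_tree d (Suc k)) \<le> Suc d * nodes (full_tree d k')"
      using ge by (rule mult_le_mono2)
    with sums have eq: "(\<Sum>t\<in>#M. nodes t) = Suc d * nodes (full_tree d (Suc k))"
      "(\<Sum>t\<in>#M'. nodes t) = Suc d * nodes (full_tree d k')"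
      "Suc d * nodes (full_tree d (Suc k)) = Suc d * nodes (full_tree d k')"
      by (metis order_antisym order_trans)+
    then have "nodes (full_tree d (Suc k)) = nodes (full_tree d k')"
      by (metis Suc_mult_cancel1)
    then have "k' = Suc k" using strict_mono_eq[OF mono, of "Suc k" k'] by simp
    have "t = full_tree d (Suc k)" if "t \<in># M" for t
      using U' eq(1) sz greedy_nodes[OF d] \<open>greedy_root d k M\<close> that
      unfolding greedy_root_def by (metis of_nat_id)
    moreover have "t = full_tree d k'" if "t \<in># M'" for t
      using L' eq(2) sz greedy_nodes[OF d] \<open>greedy_root d k' M'\<close> that
      unfolding greedy_root_def by (metis of_nat_id)
    ultimately have "M = replicate_mset (Suc d) (full_tree d (Suc k))"
      "M' = replicate_mset (Suc d) (full_tree d k')"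
      using sz by (metis mset_all_eq_replicate)+
    then show False using \<open>M \<noteq> M'\<close> \<open>k' = Suc k\<close> by simp
  qed
  show ?thesis
  proof (cases k k' rule: linorder_cases)
    case equal
    then show ?thesis
      using M M' nd by (intro greedy_mset_unique[OF d greedy_unique[OF d, of k]]) (auto simp: greedy_root_def)
  next
    case less
    then show ?thesis using impossible[OF _ M M' nd] by blast
  next
    case greater
    then show ?thesis using impossible[OF _ M' M nd[symmetric]] by metis
  qed
qed

text \<open>Bounding the number of vertices bounds the trees because the number of slots, empty ones
  included, is fixed; this is what makes a minimum exist.\<close>

lemma finite_regular: "finite {t. regular d t \<and> nodes t \<le> n}"
proof (induction n)
  case 0
  have "{t. regular d t \<and> nodes t \<le> 0} \<subseteq> {Vacant}" by auto
  then show ?case by (rule finite_subset) simp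
next
  case (Suc n)
  let ?A = "{t. regular d t \<and> nodes t \<le> n}"
  have "{t. regular d t \<and> nodes t \<le> Suc n} \<subseteq> insert Vacant (Node ` multisets_of_size ?A d)"
  proof
    fix t assume "t \<in> {t. regular d t \<and> nodes t \<le> Suc n}"
    then show "t \<in> insert Vacant (Node ` multisets_of_size ?A d)"
    proof (cases t)
      case (Node M)
      then have "regular d u \<and> nodes u \<le> n" if "u \<in># M" for u
        using nodes_less[OF that] that \<open>t \<in> _\<close> by simp
      moreover have "size M = d" using \<open>t \<in> _\<close> Node by simp
      ultimately have "M \<in> multisets_of_size ?A d"
        unfolding multisets_of_size_def by blast
      then show ?thesis using Node by blast
    qed simp
  qed
  then show ?case
    by (rule finite_subset) (intro finite_insert[THEN iffD2] finite_imageI finite_multisets_of_size Suc)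
qed

lemma optimal_exists:
  assumes "root_regular d M"
  shows "\<exists>M'. optimal x d M' \<and> nodes (Node M') = nodes (Node M)"
proof -
  let ?A = "{M'. root_regular d M' \<and> nodes (Node M') = nodes (Node M)}"
  have "?A \<subseteq> multisets_of_size {t. regular d t \<and> nodes t \<le> nodes (Node M)} (Suc d)"
    using nodes_less by (fastforce simp: multisets_of_size_def root_regular_def intro: less_imp_le)
  then have fin: "finite ?A"
    by (rule finite_subset) (intro finite_multisets_of_size finite_regular)
  moreover have "M \<in> ?A" using assms by simp
  ultimately have "arg_min_on (rooted_det x) ?A \<in> ?A"
      "\<not> (\<exists>N\<in>?A. rooted_det x N < rooted_det x (arg_min_on (rooted_det x) ?A))"
    using arg_min_if_finite[of ?A "rooted_det x"] by blast+
  then obtain M' where "M' \<in> ?A" "\<And>N. N \<in> ?A \<Longrightarrow> rooted_det x M' \<le> rooted_det x N"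
    by (meson not_le)
  then show ?thesis unfolding optimal_def by auto
qed

theorem greedy_minimal:
  assumes x: "0 < x" and d: "1 \<le> d" and M: "root_regular d M" "d + 2 \<le> nodes (Node M)"
  shows "\<exists>G k. greedy_root d k G \<and> root_regular d G \<and> nodes (Node G) = nodes (Node M) \<and>
    rooted_det x G \<le> rooted_det x M \<and> (rooted_det x G = rooted_det x M \<longrightarrow> reroot M G)"
proof -
  have reroot_nodes: "nodes (Node M') = nodes (Node M)" if "reroot M M'" for M M'
    using that by (induction rule: reroot.induct) auto
  obtain M0 where M0: "optimal x d M0" "nodes (Node M0) = nodes (Node M)"
    using optimal_exists[OF M(1)] by blast
  obtain G k where G: "reroot M0 G" "greedy_root d k G"
    using optimal_greedy_root[OF x d M0(1)] M(2) M0(2) by auto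
  have opt: "optimal x d G" using reroot_optimal[OF G(1) x M0(1)] .
  have nd: "nodes (Node G) = nodes (Node M)" using reroot_nodes[OF G(1)] M0(2) by simp
  \<comment> \<open>With equal determinants \<open>M\<close> is itself a minimizer, so it can be
    rerooted to a greedy multiset, and uniqueness makes that multiset \<open>G\<close>.\<close>
  have "reroot M G" if eq: "rooted_det x G = rooted_det x M"
  proof -
    have "optimal x d M" using opt M(1) nd unfolding optimal_def eq by simp
    then obtain G' k' where G': "reroot M G'" "greedy_root d k' G'"
      using optimal_greedy_root[OF x d] M(2) by blast
    have "G' = G"
      using greedy_root_unique[OF d G'(2) G(2)] reroot_nodes[OF G'(1)] nd by simp
    with G'(1) show ?thesis by simp
  qed
  moreover have "rooted_det x G \<le> rooted_det x M" "root_regular d G"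
    using opt M(1) nd by (auto simp: optimal_def)
  ultimately show ?thesis using G(2) nd by blast
qed

section \<open>The upper bound\<close>

primrec no_vacant :: "stree \<Rightarrow> bool" where
  "no_vacant Vacant \<longleftrightarrow> False"
| "no_vacant (Node M) \<longleftrightarrow> (\<forall>b\<in>#image_mset no_vacant M. b)"

lemma no_vacant_Node: "no_vacant (Node M) \<longleftrightarrow> (\<forall>t\<in>#M. no_vacant t)"
  by auto

declare no_vacant.simps(2) [simp del]
declare no_vacant_Node [simp]

primrec path_kids :: "nat \<Rightarrow> stree multiset" where
  "path_kids 0 = {#}"
| "path_kids (Suc k) = {#Node (path_kids k)#}"

abbreviation "leaf \<equiv> Node {#}"

text \<open>Rooted at the vertex of degree \<open>k + 1\<close>. The long branch has
  \<open>m + 1\<close> vertices, so \<open>m = 0\<close> gives a star.\<close>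

definition broom_kids :: "nat \<Rightarrow> nat \<Rightarrow> stree multiset" where
  "broom_kids k m = add_mset (Node (path_kids m)) (replicate_mset k leaf)"

lemma nodes_path: "nodes (Node (path_kids k)) = Suc k"
  by (induction k) auto

context
  fixes x :: real
  assumes x: "0 < x"
begin

text \<open>Together with \<open>pforest\<close> these are the matching polynomials of paths:
  \<open>pdet k\<close> belongs to the path on \<open>2k + 1\<close> vertices, which is the
  subdivision of the path on \<open>k + 1\<close> vertices, and \<open>pforest k\<close> to the path
  on \<open>2k\<close> vertices. Interleaved they obey
  \<open>p (n + 2) = p (n + 1) + x * p n\<close>.\<close>

definition pdet :: "nat \<Rightarrow> real" where "pdet k = rooted_det x (path_kids k)"
definition pforest :: "nat \<Rightarrow> real" where "pforest k = forest x (path_kids k)"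

lemma pforest_0 [simp]: "pforest 0 = 1" and pdet_0 [simp]: "pdet 0 = 1"
  by (simp_all add: pforest_def pdet_def rooted_det_def)

lemma pforest_Suc: "pforest (Suc k) = pdet k + x * pforest k"
  by (simp add: pforest_def pdet_def elim_eq)

lemma pdet_Suc: "pdet (Suc k) = pforest (Suc k) + x * pdet k"
  using rooted_det_add_Node[OF x, of "path_kids k" "{#}"]
  by (simp add: pforest_Suc, simp add: pforest_def pdet_def rooted_det_def)

lemma elim_path: "elim x (Node (path_kids k)) = pforest (Suc k)"
  by (simp add: pforest_def)

lemma pforest_pos: "0 < pforest k" and pdet_pos: "0 < pdet k"
  using forest_pos[OF x] pivot_ge_1[OF x, of "path_kids k"]
  by (auto simp: pforest_def pdet_def rooted_det_def)

lemma pforest_le_pdet: "pforest k \<le> pdet k" "0 < k \<Longrightarrow> pforest k < pdet k"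
  using pdet_pos x by (cases k; simp add: pdet_Suc less_imp_le)+

lemma rooted_det_pos: "0 < rooted_det x M"
  using forest_pos[OF x, of M] pivot_ge_1[OF x, of M] by (simp add: rooted_det_def)

lemma rooted_det_two_paths:
  "rooted_det x (add_mset (Node (path_kids a)) (path_kids b)) = pdet (Suc (a + b))"
proof (induction b arbitrary: a)
  case 0
  then show ?case by (simp add: pdet_def)
next
  case (Suc b)
  have "rooted_det x (add_mset (Node (path_kids a)) (path_kids (Suc b))) =
    rooted_det x (add_mset (Node (path_kids b)) {#Node (path_kids a)#})"
    by (simp add: add_mset_commute)
  also have "\<dots> = rooted_det x (add_mset (Node (path_kids (Suc a))) (path_kids b))"
    using rooted_det_reroot[OF x, of "path_kids b" "{#Node (path_kids a)#}"] by simp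
  also have "\<dots> = pdet (Suc (Suc a + b))" by (rule Suc.IH)
  finally show ?case by simp
qed

lemma pdet_split: "pforest (Suc a) * pdet b + x * pdet a * pforest b = pdet (Suc (a + b))"
  using rooted_det_two_paths[of a b] rooted_det_add_Node[OF x, of "path_kids a" "path_kids b"]
  by (simp add: pforest_Suc) (simp add: pdet_def pforest_def)

text \<open>Deleting an edge of a path loses matchings. The two families are handled together
  because their recurrences alternate.\<close>

lemma pforest_mult:
  assumes "0 < i"
  shows "pforest i * pdet j < pdet (i + j) \<and> pforest i * pforest j \<le> pforest (i + j) \<and>
    (0 < j \<longrightarrow> pforest i * pforest j < pforest (i + j))"
proof (induction j)
  case (Suc j)
  have 1: "pforest i * pforest (Suc j) < pforest (Suc (i + j))"
  proof -
    have "x * (pforest i * pforest j) \<le> x * pforest (i + j)" using Suc x by simp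
    with Suc show ?thesis by (simp add: pforest_Suc algebra_simps)
  qed
  moreover have "pforest i * pdet (Suc j) < pdet (Suc (i + j))"
  proof -
    have "x * (pforest i * pdet j) \<le> x * pdet (i + j)" using Suc x by simp
    with 1 show ?thesis by (simp add: pdet_Suc algebra_simps)
  qed
  ultimately show ?case by simp
qed (use pforest_le_pdet assms in simp)

lemma pforest_mult_le: "pforest i * pforest j \<le> pforest (i + j)"
  using pforest_mult[of i j] by (cases i) auto

text \<open>Among ways to cut a path of even length-2 pieces, cutting off the shortest nonempty
  piece loses the least. Both sides satisfy the same recurrences in \<open>j\<close>, so everything
  is decided at \<open>j = 0\<close>; there the second inequality is an equality, hence the extra
  condition for its strict form.\<close>

lemma pforest_shift:
  "pforest (Suc i) * pdet j \<le> pforest 1 * pdet (i + j) \<and>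
   pforest (Suc i) * pforest (Suc j) \<le> pforest 1 * pforest (Suc (i + j)) \<and>
   (0 < i \<longrightarrow> pforest (Suc i) * pdet j < pforest 1 * pdet (i + j)) \<and>
   (0 < i \<longrightarrow> 0 < j \<longrightarrow> pforest (Suc i) * pforest (Suc j) < pforest 1 * pforest (Suc (i + j)))"
proof (induction j)
  case 0
  have p1: "pforest 1 = 1 + x" using pforest_Suc[of 0] by simp
  have "x * pforest i \<le> x * pdet i" "0 < i \<Longrightarrow> x * pforest i < x * pdet i"
    using pforest_le_pdet x by auto
  then show ?case by (simp only: p1) (simp add: pforest_Suc[of i] pforest_Suc[of 0] algebra_simps)
next
  case (Suc j)
  let ?P = "pforest (Suc i)" and ?Q = "pforest 1"
  have A: "?P * pdet (Suc j) = ?P * pforest (Suc j) + x * (?P * pdet j)"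
    "?Q * pdet (i + Suc j) = ?Q * pforest (Suc (i + j)) + x * (?Q * pdet (i + j))"
    by (simp_all add: pdet_Suc algebra_simps)
  have B: "?P * pforest (Suc (Suc j)) = ?P * pdet (Suc j) + x * (?P * pforest (Suc j))"
    "?Q * pforest (Suc (i + Suc j)) = ?Q * pdet (i + Suc j) + x * (?Q * pforest (Suc (i + j)))"
    by (simp_all add: pforest_Suc[of "Suc j"] pforest_Suc[of "Suc (i + j)"] algebra_simps)
  have C: "x * (?P * pdet j) \<le> x * (?Q * pdet (i + j))"
    "x * (?P * pforest (Suc j)) \<le> x * (?Q * pforest (Suc (i + j)))"
    "0 < i \<Longrightarrow> x * (?P * pdet j) < x * (?Q * pdet (i + j))"
    using Suc x by simp_all
  have D: "?P * pdet (Suc j) \<le> ?Q * pdet (i + Suc j)"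
    "0 < i \<Longrightarrow> ?P * pdet (Suc j) < ?Q * pdet (i + Suc j)"
    unfolding A using Suc C by (simp_all add: add_mono add_le_less_mono)
  have "?P * pforest (Suc (Suc j)) \<le> ?Q * pforest (Suc (i + Suc j))"
    "0 < i \<Longrightarrow> ?P * pforest (Suc (Suc j)) < ?Q * pforest (Suc (i + Suc j))"
    unfolding B using C D by (simp_all add: add_mono add_less_le_mono)
  with D show ?case by blast
qed

text \<open>Uniqueness is claimed through \<open>forest\<close> only: a path rooted at an inner
  vertex has the same \<open>rooted_det\<close> as one rooted at its end.\<close>

lemma path_maximal:
  "no_vacant (Node M) \<Longrightarrow> nodes (Node M) = Suc k \<Longrightarrow>
   rooted_det x M \<le> pdet k \<and> forest x M \<le> pforest k \<and> (forest x M = pforest k \<longrightarrow> M = path_kids k)"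
proof (induction k arbitrary: M rule: less_induct)
  case (less k)
  show ?case
  proof (cases M)
    case empty
    then show ?thesis using less.prems by (simp add: rooted_det_def)
  next
    case (add t R)
    then obtain X where t: "t = Node X" using less.prems by (cases t) auto
    obtain a where a: "nodes (Node X) = Suc a" by simp
    obtain b where b: "nodes (Node R) = Suc b" by simp
    have k: "k = Suc (a + b)" using less.prems(2) a b add t by simp
    have X: "rooted_det x X \<le> pdet a" "forest x X \<le> pforest a" "forest x X = pforest a \<longrightarrow> X = path_kids a"
      using less.IH[OF _ _ a] less.prems(1) k add t by simp_all
    have R: "rooted_det x R \<le> pdet b" "forest x R \<le> pforest b"
      using less.IH[OF _ _ b] less.prems(1) k add t by simp_all
    have eX: "elim x (Node X) \<le> pforest (Suc a)"
      using X x by (simp add: elim_eq pforest_Suc add_mono)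
    have pos: "0 < elim x (Node X)" "0 < rooted_det x X" "0 < forest x R" "0 < rooted_det x R"
      using elim_pos[OF x] rooted_det_pos forest_pos[OF x] by blast+
    have "rooted_det x M = elim x (Node X) * rooted_det x R + x * rooted_det x X * forest x R"
      using rooted_det_add_Node[OF x, of X R] by (simp add: add t elim_eq)
    also have "\<dots> \<le> pforest (Suc a) * pdet b + x * pdet a * pforest b"
      using eX X R pos x pforest_pos[of "Suc a"] pdet_pos[of a]
      by (intro add_mono mult_mono) (auto intro: less_imp_le)
    also have "\<dots> = pdet k" using pdet_split k by simp
    finally have 1: "rooted_det x M \<le> pdet k" .
    have fM: "forest x M = elim x (Node X) * forest x R" by (simp add: add t)
    have 2: "forest x M \<le> pforest (Suc a) * pforest b"
      unfolding fM using eX R pos pforest_pos[of "Suc a"] by (intro mult_mono) auto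
    have 3: "pforest (Suc a) * pforest b \<le> pforest k"
      using pforest_mult_le[of "Suc a" b] k by simp
    have "M = path_kids k" if eq: "forest x M = pforest k"
    proof -
      \<comment> \<open>Strictness in \<open>pforest_mult\<close> leaves no room for a second branch
        at the root.\<close>
      have "\<not> 0 < b" using pforest_mult[of "Suc a" b] 2 eq k by auto
      then have "b = 0" by simp
      then have "R = {#}" using b less.prems(1) add by (cases R) auto
      then have "elim x (Node X) = pforest (Suc a)"
        using eq fM \<open>b = 0\<close> k by simp
      then have "rooted_det x X + x * forest x X = pdet a + x * pforest a"
        by (simp add: elim_eq pforest_Suc)
      moreover have "x * forest x X \<le> x * pforest a" using X x by simp
      ultimately have "x * forest x X = x * pforest a" using X(1) by linarith
      then have "X = path_kids a" using X(3) x by simp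
      then show ?thesis using add t \<open>R = {#}\<close> k \<open>b = 0\<close> by simp
    qed
    then show ?thesis using 1 2 3 by simp
  qed
qed

lemma elim_le_path:
  assumes "no_vacant (Node X)" "nodes (Node X) = Suc a"
  shows "elim x (Node X) \<le> pforest (Suc a)" "elim x (Node X) = pforest (Suc a) \<Longrightarrow> X = path_kids a"
proof -
  note X = path_maximal[OF assms]
  have *: "x * forest x X \<le> x * pforest a" using X x by simp
  with X show "elim x (Node X) \<le> pforest (Suc a)" by (simp add: elim_eq pforest_Suc)
  assume "elim x (Node X) = pforest (Suc a)"
  then have "x * forest x X = x * pforest a"
    using conjunct1[OF X] * unfolding elim_eq pforest_Suc by linarith
  with X x show "X = path_kids a" by simp
qed

lemma forest_replicate: "forest x (replicate_mset k t) = elim x t ^ k"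
  by (induction k) simp_all

lemma elim_leaf: "elim x leaf = pforest 1"
  using elim_path[of 0] by simp

lemma forest_broom: "forest x (broom_kids k m) = pforest 1 ^ k * pforest (Suc m)"
  by (simp add: broom_kids_def elim_path forest_replicate elim_leaf)

text \<open>For fixed \<open>a + b\<close> the two lengths matter only through the product
  \<open>pforest (Suc a) * pforest (Suc b)\<close>, whose weight is the total conductance of the
  other branches. Without others, shifting vertices between the two paths changes nothing.\<close>

lemma two_path_branches:
  "rooted_det x (add_mset (Node (path_kids a)) (add_mset (Node (path_kids b)) L)) =
    forest x L * ((pivot x L - 1) * (pforest (Suc a) * pforest (Suc b)) + pdet (Suc (Suc (a + b))))"
proof -
  have "pdet (Suc (a + Suc b)) =
      rooted_det x (add_mset (Node (path_kids a)) {#Node (path_kids b)#})"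
    using rooted_det_two_paths[of a "Suc b"] by simp
  then show ?thesis by (simp add: rooted_det_def elim_path algebra_simps)
qed

lemma pivot_leaves: "pivot x (replicate_mset k leaf) - 1 = real k * cnd x leaf"
  by (simp add: pivot_replicate)

lemma broom_kids_step:
  "rooted_det x (add_mset (Node (path_kids a)) (broom_kids k m)) \<le> rooted_det x (broom_kids (Suc k) (a + m))"
  (is ?le)
  and broom_kids_step_strict: "0 < k \<Longrightarrow>
   rooted_det x (add_mset (Node (path_kids a)) (broom_kids k m)) = rooted_det x (broom_kids (Suc k) (a + m)) \<Longrightarrow>
   a = 0 \<or> m = 0" (is "_ \<Longrightarrow> ?eq \<Longrightarrow> _")
proof -
  let ?L = "replicate_mset k leaf"
  have L: "0 < forest x ?L" using forest_pos[OF x] .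
  have r: "rooted_det x (broom_kids (Suc k) (a + m)) =
    rooted_det x (add_mset (Node (path_kids 0)) (add_mset (Node (path_kids (a + m))) ?L))"
    by (simp add: broom_kids_def add_mset_commute)
  have K: "0 \<le> real k * cnd x leaf" "0 < k \<Longrightarrow> 0 < real k * cnd x leaf"
    using cnd_Node_pos[OF x, of "{#}"] by simp_all
  have sh: "pforest (Suc a) * pforest (Suc m) \<le> pforest (Suc 0) * pforest (Suc (a + m))"
    "a \<noteq> 0 \<Longrightarrow> m \<noteq> 0 \<Longrightarrow> pforest (Suc a) * pforest (Suc m) < pforest (Suc 0) * pforest (Suc (a + m))"
    using pforest_shift[of a m] by simp_all
  show ?le
    unfolding r unfolding broom_kids_def two_path_branches pivot_leaves
    using mult_left_mono[OF sh(1) K(1)] L by simp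
  assume "0 < k" and eq: ?eq
  have "forest x ?L * (real k * cnd x leaf * (pforest (Suc a) * pforest (Suc m)) + pdet (Suc (Suc (a + m))))
     = forest x ?L * (real k * cnd x leaf * (pforest (Suc 0) * pforest (Suc (a + m))) + pdet (Suc (Suc (a + m))))"
    using eq[unfolded r, unfolded broom_kids_def two_path_branches pivot_leaves] by (simp only: add_0)
  then have "real k * cnd x leaf * (pforest (Suc a) * pforest (Suc m)) =
      real k * cnd x leaf * (pforest (Suc 0) * pforest (Suc (a + m)))"
    using L by (simp only: mult_cancel_left add_right_cancel) simp
  then have "pforest (Suc a) * pforest (Suc m) = pforest (Suc 0) * pforest (Suc (a + m))"
    using K(2)[OF \<open>0 < k\<close>] by (metis less_irrefl mult_cancel_left)
  then show "a = 0 \<or> m = 0" using sh(2) by force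
qed

text \<open>One branch after another is straightened and merged into the broom. For \<open>k\<close>
  at most 1 the broom is a path, whose determinant does not reveal the position of the root; so
  \<open>rooted_det\<close> determines \<open>M\<close> only for larger \<open>k\<close>. The
  uniqueness clause for \<open>forest\<close> holds for every \<open>k\<close> and feeds the
  induction.\<close>

lemma broom_maximal:
  assumes "\<forall>t\<in>#M. no_vacant t" "size M = Suc k" "(\<Sum>t\<in>#M. nodes t) = Suc (k + m)"
  shows "forest x M \<le> forest x (broom_kids k m) \<and> rooted_det x M \<le> rooted_det x (broom_kids k m) \<and>
    (forest x M = forest x (broom_kids k m) \<longrightarrow> M = broom_kids k m) \<and>
    (1 < k \<longrightarrow> rooted_det x M = rooted_det x (broom_kids k m) \<longrightarrow> M = broom_kids k m)"
  using assms
proof (induction k arbitrary: M m)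
  case 0
  then obtain t where M: "M = {#t#}" by (metis One_nat_def size_1_singleton_mset)
  then obtain X where t: "t = Node X" using 0 by (cases t) auto
  have X: "no_vacant (Node X)" "nodes (Node X) = Suc m" using 0 M t by simp_all
  note e = elim_le_path[OF X]
  have "rooted_det x M = elim x (Node X) + x * rooted_det x X"
    using rooted_det_add_Node[OF x, of X "{#}"] by (simp add: M t elim_eq) (simp add: rooted_det_def)
  also have "\<dots> \<le> pforest (Suc m) + x * pdet m"
    using e(1) path_maximal[OF X] x by (intro add_mono) auto
  also have "\<dots> = rooted_det x (broom_kids 0 m)"
    using pdet_Suc[of m] by (simp add: broom_kids_def) (simp add: pdet_def)
  finally show ?case using e unfolding forest_broom by (auto simp: M t broom_kids_def)
next
  case (Suc k)
  then obtain t R where M: "M = add_mset t R" "size R = Suc k"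
    by (metis size_eq_Suc_imp_eq_union size_add_mset nat.inject)
  then obtain X where t: "t = Node X" using Suc.prems by (cases t) auto
  obtain a where a: "nodes (Node X) = Suc a" by simp
  have nvX: "no_vacant (Node X)" and nvR: "\<forall>t\<in>#R. no_vacant t" using Suc.prems(1) M t by auto
  have "\<forall>t\<in>#R. 1 \<le> nodes t"
  proof
    fix u assume "u \<in># R"
    then have "no_vacant u" using nvR by blast
    then show "1 \<le> nodes u" by (cases u) simp_all
  qed
  then have "size R \<le> (\<Sum>t\<in>#R. nodes t)" using sum_mset_ge_replicate[of R 1 nodes] by simp
  then obtain m' where m': "(\<Sum>t\<in>#R. nodes t) = Suc (k + m')"
    using M(2) by (metis add_Suc less_eqE)
  have m: "m = a + m'" using Suc.prems(3) M(1) t a m' by simp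
  note IH = Suc.IH[OF nvR M(2) m']
  note e = elim_le_path[OF nvX a] and X = path_maximal[OF nvX a]
  have pos: "0 < elim x (Node X)" "0 < rooted_det x X" "0 < forest x R" "0 < rooted_det x R"
     "0 < pforest (Suc a)" "0 < pdet a" "0 < forest x (broom_kids k m')" "0 < rooted_det x (broom_kids k m')"
    using elim_pos[OF x] rooted_det_pos forest_pos[OF x] pforest_pos pdet_pos by blast+
  have f1: "0 < pforest 1 ^ k" using pforest_pos by simp
  have sh: "pforest (Suc a) * pforest (Suc m') \<le> pforest 1 * pforest (Suc (a + m'))"
    "a \<noteq> 0 \<Longrightarrow> m' \<noteq> 0 \<Longrightarrow> pforest (Suc a) * pforest (Suc m') < pforest 1 * pforest (Suc (a + m'))"
    using pforest_shift[of a m'] by simp_all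
  have concl: "M = broom_kids (Suc k) m"
    if "elim x (Node X) = pforest (Suc a)" "forest x R = forest x (broom_kids k m')" "a = 0 \<or> m' = 0"
  proof -
    have "X = path_kids a" "R = broom_kids k m'" using that e(2) IH by auto
    then show ?thesis using that(3) by (auto simp: M t m broom_kids_def add_mset_commute)
  qed
  have fM: "forest x M = elim x (Node X) * forest x R" by (simp add: M t)
  have le1: "elim x (Node X) * forest x R \<le> pforest (Suc a) * forest x (broom_kids k m')"
    using e(1) IH pos by (intro mult_mono) auto
  have le2: "pforest (Suc a) * forest x (broom_kids k m') \<le> forest x (broom_kids (Suc k) m)"
    using mult_left_mono[OF sh(1), of "pforest 1 ^ k"] f1 unfolding forest_broom m
    by (simp add: mult_ac)
  have eqf: "M = broom_kids (Suc k) m" if "forest x M = forest x (broom_kids (Suc k) m)"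
  proof (rule concl)
    have eq1: "elim x (Node X) * forest x R = pforest (Suc a) * forest x (broom_kids k m')"
      and eq2: "pforest (Suc a) * forest x (broom_kids k m') = forest x (broom_kids (Suc k) m)"
      using that le1 le2 fM by linarith+
    have "\<not> elim x (Node X) < pforest (Suc a)"
      using mult_less_le_imp_less[of "elim x (Node X)" "pforest (Suc a)" "forest x R" "forest x (broom_kids k m')"]
        eq1 IH pos by auto
    then show ee: "elim x (Node X) = pforest (Suc a)" using e(1) by simp
    then show "forest x R = forest x (broom_kids k m')" using eq1 pos by simp
    show "a = 0 \<or> m' = 0"
    proof (rule ccontr)
      assume "\<not> ?thesis"
      then have "pforest 1 ^ k * (pforest (Suc a) * pforest (Suc m')) <
          pforest 1 ^ k * (pforest 1 * pforest (Suc (a + m')))"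
        using sh(2) f1 by simp
      moreover have "pforest 1 ^ k * (pforest (Suc a) * pforest (Suc m')) =
          pforest 1 ^ k * (pforest 1 * pforest (Suc (a + m')))"
        using eq2 unfolding forest_broom m power_Suc by (simp only: mult_ac)
      ultimately show False by linarith
    qed
  qed
  have rM: "rooted_det x M = elim x (Node X) * rooted_det x R + x * rooted_det x X * forest x R"
    using rooted_det_add_Node[OF x, of X R] by (simp add: M t elim_eq)
  have rB: "rooted_det x (add_mset (Node (path_kids a)) (broom_kids k m')) =
      pforest (Suc a) * rooted_det x (broom_kids k m') + x * pdet a * forest x (broom_kids k m')"
    using rooted_det_add_Node[OF x, of "path_kids a" "broom_kids k m'"]
    by (simp add: pforest_Suc) (simp add: pdet_def pforest_def)
  have t1: "elim x (Node X) * rooted_det x R \<le> pforest (Suc a) * rooted_det x (broom_kids k m')"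
    using e(1) IH pos by (intro mult_mono) auto
  have t2: "x * rooted_det x X * forest x R \<le> x * pdet a * forest x (broom_kids k m')"
    using X IH pos x by (intro mult_mono) (auto intro: less_imp_le)
  have le3: "rooted_det x M \<le> rooted_det x (add_mset (Node (path_kids a)) (broom_kids k m'))"
    unfolding rM rB using t1 t2 by (rule add_mono)
  note le4 = broom_kids_step[of a k m', folded m]
  have eqr: "M = broom_kids (Suc k) m"
    if "1 < Suc k" "rooted_det x M = rooted_det x (broom_kids (Suc k) m)"
  proof (rule concl)
    have eq1: "rooted_det x M = rooted_det x (add_mset (Node (path_kids a)) (broom_kids k m'))"
      and eq2: "rooted_det x (add_mset (Node (path_kids a)) (broom_kids k m')) = rooted_det x (broom_kids (Suc k) m)"
      using that(2) le3 le4 by linarith+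
    \<comment> \<open>Equality of the sums forces equality of both summands. The second one yields
      equality of the \<open>forest\<close> values of \<open>R\<close> and the smaller broom, and
      the clause for \<open>forest\<close> is available even where the one for
      \<open>rooted_det\<close> is not.\<close>
    have e1: "elim x (Node X) * rooted_det x R = pforest (Suc a) * rooted_det x (broom_kids k m')"
      and e2: "x * rooted_det x X * forest x R = x * pdet a * forest x (broom_kids k m')"
      using eq1 t1 t2 unfolding rM rB by linarith+
    have "\<not> elim x (Node X) < pforest (Suc a)"
      using mult_less_le_imp_less[of "elim x (Node X)" "pforest (Suc a)" "rooted_det x R" "rooted_det x (broom_kids k m')"]
        e1 IH pos by auto
    then show "elim x (Node X) = pforest (Suc a)" using e(1) by simp
    have "\<not> forest x R < forest x (broom_kids k m')"
      using mult_le_less_imp_less[of "x * rooted_det x X" "x * pdet a" "forest x R" "forest x (broom_kids k m')"]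
        e2 X pos x by auto
    then show "forest x R = forest x (broom_kids k m')" using IH by simp
    show "a = 0 \<or> m' = 0"
      using broom_kids_step_strict[of k a m'] that(1) eq2 m by simp
  qed
  show ?case using fM le1 le2 le3 le4 eqf eqr by auto
qed

end

primrec branching_le :: "nat \<Rightarrow> stree \<Rightarrow> bool" where
  "branching_le d Vacant \<longleftrightarrow> True"
| "branching_le d (Node M) \<longleftrightarrow> size M \<le> d \<and> (\<forall>b\<in>#image_mset (branching_le d) M. b)"

lemma branching_le_Node: "branching_le d (Node M) \<longleftrightarrow> size M \<le> d \<and> (\<forall>t\<in>#M. branching_le d t)"
  by auto

declare branching_le.simps(2) [simp del]
declare branching_le_Node [simp]

lemma branching_le_1_path: "no_vacant (Node M) \<Longrightarrow> branching_le 1 (Node M) \<Longrightarrow> \<exists>k. M = path_kids k"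
proof (induction "nodes (Node M)" arbitrary: M rule: less_induct)
  case less
  show ?case
  proof (cases M)
    case empty
    then show ?thesis by (metis path_kids.simps(1))
  next
    case (add t R)
    then have "R = {#}" using less.prems by simp
    obtain X where t: "t = Node X" using less.prems add by (cases t) auto
    have "\<exists>k. X = path_kids k"
      using less.hyps[of X] less.prems add t by simp
    then show ?thesis using add t \<open>R = {#}\<close> by (metis path_kids.simps(2))
  qed
qed

lemma reroot_two_paths:
  "reroot M {#Node (path_kids a), Node (path_kids b)#} \<Longrightarrow>
   reroot M {#Node (path_kids (a + b)), leaf#}"
proof (induction a arbitrary: b)
  case 0
  then show ?case by (simp add: add_mset_commute)
next
  case (Suc a)
  then have "reroot M (add_mset (Node {#Node (path_kids a)#}) {#Node (path_kids b)#})" by simp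
  then have "reroot M (add_mset (Node {#Node (path_kids b)#}) {#Node (path_kids a)#})"
    by (rule reroot_step)
  then have "reroot M {#Node (path_kids a), Node (path_kids (Suc b))#}"
    by (simp add: add_mset_commute)
  then show ?case using Suc.IH[of "Suc b"] by simp
qed

theorem broom_maximum:
  assumes x: "0 < x" and d: "1 \<le> d" and M: "\<forall>t\<in>#M. no_vacant t \<and> branching_le d t" "size M = Suc d"
    and m: "nodes (Node M) = d + 2 + m"
  shows "rooted_det x M \<le> rooted_det x (broom_kids d m)"
    "rooted_det x M = rooted_det x (broom_kids d m) \<Longrightarrow> reroot M (broom_kids d m)"
proof -
  have sum: "(\<Sum>t\<in>#M. nodes t) = Suc (d + m)" using m by simp
  have "\<forall>t\<in>#M. no_vacant t" using M(1) by blast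
  note max = broom_maximal[OF x this M(2) sum]
  then show "rooted_det x M \<le> rooted_det x (broom_kids d m)" by blast
  assume eq: "rooted_det x M = rooted_det x (broom_kids d m)"
  show "reroot M (broom_kids d m)"
  proof (cases "d = 1")
    \<comment> \<open>With maximum degree 2 the tree and the broom are both paths, and only the
      position of the root can differ.\<close>
    case True
    then obtain s t where st: "M = {#s, t#}"
      using M(2) by (metis One_nat_def size_1_singleton_mset size_eq_Suc_imp_eq_union size_add_mset nat.inject)
    then obtain S T where "s = Node S" "t = Node T" using M(1) by (cases s; cases t) auto
    then obtain a b where "s = Node (path_kids a)" "t = Node (path_kids b)"
      using branching_le_1_path M(1) st True by (metis add_mset_commute union_single_eq_member)
    then have M': "M = {#Node (path_kids a), Node (path_kids b)#}" using st by simp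
    then have "m = a + b" using sum True nodes_path[of a] nodes_path[of b] by simp
    then show ?thesis
      using reroot_two_paths[of M a b] reroot_refl[of M] M' True by (simp add: broom_kids_def)
  next
    case False
    then have "M = broom_kids d m" using max d eq by auto
    then show ?thesis by (simp add: reroot_refl)
  qed
qed

section \<open>Trees as graphs\<close>

definition link :: "'a ugraph \<Rightarrow> 'a \<Rightarrow> 'a ugraph \<Rightarrow> 'a \<Rightarrow> 'a ugraph" where
  "link G r H s = \<lparr>verts = verts G \<union> verts H, edges = insert {r, s} (edges G \<union> edges H)\<rparr>"

definition singleton_graph :: "'a \<Rightarrow> 'a ugraph" where
  "singleton_graph r = \<lparr>verts = {r}, edges = {}\<rparr>"

lemma verts_link [simp]: "verts (link G r H s) = verts G \<union> verts H"
  and edges_link [simp]: "edges (link G r H s) = insert {r, s} (edges G \<union> edges H)"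
  by (simp_all add: link_def)

lemma verts_singleton_graph [simp]: "verts (singleton_graph r) = {r}"
  and edges_singleton_graph [simp]: "edges (singleton_graph r) = {}"
  by (simp_all add: singleton_graph_def)

text \<open>\<open>rep G r M\<close>: the graph \<open>G\<close> is a tree whose branches at \<open>r\<close> are the non-vacant elements of \<open>M\<close>.\<close>

inductive rep :: "'a ugraph \<Rightarrow> 'a \<Rightarrow> stree multiset \<Rightarrow> bool" where
  single: "rep (singleton_graph r) r (replicate_mset k Vacant)"
| link: "rep G r M \<Longrightarrow> rep H s N \<Longrightarrow> verts G \<inter> verts H = {} \<Longrightarrow>
    rep (link G r H s) r (add_mset (Node N) M)"

lemma simple_graph_finite_edges: "simple_graph G \<Longrightarrow> finite (edges G)"
  unfolding simple_graph_def by (metis Pow_iff finite_Pow_iff finite_subset subsetI)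

lemma rep_simple: "rep G r M \<Longrightarrow> simple_graph G \<and> r \<in> verts G"
proof (induction rule: rep.induct)
  case (link G r M H s N)
  then have "r \<noteq> s" by auto
  with link show ?case by (auto simp: simple_graph_def)
qed (simp add: simple_graph_def)

lemma rep_card: "rep G r M \<Longrightarrow> card (verts G) = nodes (Node M)"
proof (induction rule: rep.induct)
  case (link G r M H s N)
  then have "finite (verts G)" "finite (verts H)" using rep_simple by (auto simp: simple_graph_def)
  with link show ?case by (simp add: card_Un_disjoint)
qed simp

lemma rep_finite: "rep G r M \<Longrightarrow> finite (verts G) \<and> finite (edges G)"
  using rep_simple[of G r M] simple_graph_finite_edges[of G] by (simp add: simple_graph_def)

lemma link_swap:
  "link (link G r H s) r H' s' = link (link G r H' s') r H s"
  by (auto simp: link_def)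

lemma link_sym: "link G r H s = link H s G r"
  by (auto simp: link_def insert_commute)

text \<open>The inductive definition attaches branches in some order; \<open>link_swap\<close>
  allows any chosen branch to be the one attached last.\<close>

lemma rep_inv:
  "rep G r K \<Longrightarrow> K = add_mset (Node N) M \<Longrightarrow>
   \<exists>G' H s. rep G' r M \<and> rep H s N \<and> verts G' \<inter> verts H = {} \<and> G = link G' r H s"
proof (induction arbitrary: M rule: rep.induct)
  case (single r k)
  then have "Node N \<in># replicate_mset k Vacant" by simp
  then have False unfolding in_replicate_mset by simp
  then show ?case ..
next
  case (link G r M1 H s N1)
  show ?case
  proof (cases "N1 = N")
    case True
    with link show ?thesis by auto
  next
    case False
    then obtain K where K: "M1 = add_mset (Node N) K" "M = add_mset (Node N1) K"
      using link.prems by (auto simp: add_eq_conv_ex)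
    then obtain G' H' s' where G': "rep G' r K" "rep H' s' N" "verts G' \<inter> verts H' = {}"
      "G = link G' r H' s'" using link.IH(1) by blast
    have "verts G' \<inter> verts H = {}" using G' link.hyps by auto
    then have 1: "rep (link G' r H s) r M" using rep.link[OF G'(1) link.hyps(2)] K by simp
    have 2: "link G r H s = link (link G' r H s) r H' s'"
      unfolding G' by (rule link_swap)
    have 3: "verts (link G' r H s) \<inter> verts H' = {}" using G' link.hyps by auto
    show ?thesis
      by (rule exI[of _ "link G' r H s"], rule exI[of _ H'], rule exI[of _ s'])
        (use 1 2 3 G' in blast)
  qed
qed

lemma rep_replicate_Vacant: "rep G r (replicate_mset k Vacant) \<Longrightarrow> G = singleton_graph r"
proof (erule rep.cases)
  fix G' M H s N r'
  assume "replicate_mset k Vacant = add_mset (Node N) M"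
  then have "Node N \<in># replicate_mset k Vacant" by simp
  then have False unfolding in_replicate_mset by simp
  then show ?thesis ..
qed auto

lemma rep_add_Vacant: "rep G r M \<Longrightarrow> rep G r (add_mset Vacant M)"
proof (induction rule: rep.induct)
  case (single r k)
  then show ?case using rep.single[of r "Suc k"] by simp
next
  case (link G r M H s N)
  then show ?case using rep.link[OF link.IH(1) link.hyps(2)] by (simp add: add_mset_commute)
qed

lemma rep_reroot:
  assumes "rep G r (add_mset (Node X) R)"
  shows "\<exists>s. rep G s (add_mset (Node R) X)"
proof -
  obtain G' H s where G': "rep G' r R" "rep H s X" "verts G' \<inter> verts H = {}" "G = link G' r H s"
    using rep_inv[OF assms refl] by blast
  then have "rep (link H s G' r) s (add_mset (Node R) X)" by (intro rep.link) auto
  then show ?thesis using G' link_sym by metis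
qed

lemma reroot_rep: "reroot M M' \<Longrightarrow> rep G r M \<Longrightarrow> \<exists>r'. rep G r' M'"
proof (induction rule: reroot.induct)
  case (reroot_step M X R)
  then show ?case using rep_reroot by meson
qed blast

section \<open>Isomorphisms of represented graphs\<close>

definition map_graph :: "('a \<Rightarrow> 'b) \<Rightarrow> 'a ugraph \<Rightarrow> 'b ugraph" where
  "map_graph f G = \<lparr>verts = f ` verts G, edges = (`) f ` edges G\<rparr>"

lemma rep_map: "rep G r M \<Longrightarrow> inj_on f (verts G) \<Longrightarrow> rep (map_graph f G) (f r) M"
proof (induction rule: rep.induct)
  case (single r k)
  then show ?case using rep.single[of "f r" k] by (simp add: map_graph_def singleton_graph_def)
next
  case (link G r M H s N)
  have "inj_on f (verts G)" "inj_on f (verts H)"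
    using link.prems by (auto simp: inj_on_Un)
  moreover have "f ` verts G \<inter> f ` verts H = {}"
    using link.prems link.hyps(3) by (auto simp: inj_on_def)
  ultimately have "rep (link (map_graph f G) (f r) (map_graph f H) (f s)) (f r) (add_mset (Node N) M)"
    using link.IH by (intro rep.link) (auto simp: map_graph_def)
  then show ?case by (simp add: map_graph_def link_def image_Un)
qed

text \<open>The partial isomorphisms respect the roots, so gluing them also preserves the linking
  edge.\<close>

lemma rep_unique:
  "rep G r M \<Longrightarrow> rep G' r' M \<Longrightarrow> \<exists>f. inj_on f (verts G) \<and> f r = r' \<and> G' = map_graph f G"
proof (induction arbitrary: G' r' rule: rep.induct)
  case (single r k)
  then have "G' = singleton_graph r'" by (rule rep_replicate_Vacant)
  then show ?case by (intro exI[of _ "\<lambda>_. r'"]) (simp add: map_graph_def singleton_graph_def)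
next
  case (link G r M H s N)
  obtain G1 H1 s1 where G1: "rep G1 r' M" "rep H1 s1 N" "verts G1 \<inter> verts H1 = {}" "G' = link G1 r' H1 s1"
    using rep_inv[OF link.prems refl] by blast
  obtain f where f: "inj_on f (verts G)" "f r = r'" "G1 = map_graph f G" using link.IH(1) G1(1) by blast
  obtain g where g: "inj_on g (verts H)" "g s = s1" "H1 = map_graph g H" using link.IH(2) G1(2) by blast
  define h where "h v = (if v \<in> verts G then f v else g v)" for v
  have hG: "h v = f v" if "v \<in> verts G" for v using that by (simp add: h_def)
  have hH: "h v = g v" if "v \<in> verts H" for v using that link.hyps(3) by (auto simp: h_def)
  have eG: "(`) h ` edges G = (`) f ` edges G"
    using rep_simple[OF link.hyps(1)] hG
    by (intro image_cong) (auto simp: simple_graph_def intro!: image_cong)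
  have eH: "(`) h ` edges H = (`) g ` edges H"
    using rep_simple[OF link.hyps(2)] hH
    by (intro image_cong) (auto simp: simple_graph_def intro!: image_cong)
  have vG: "h ` verts G = f ` verts G" and vH: "h ` verts H = g ` verts H"
    using hG hH by auto
  have rs: "h r = r'" "h s = s1"
    using hG hH rep_simple[OF link.hyps(1)] rep_simple[OF link.hyps(2)] f g by auto
  have "inj_on h (verts G)" "inj_on h (verts H)"
    using f(1) g(1) hG hH by (auto simp: inj_on_def)
  moreover have "h ` verts G \<inter> h ` verts H = {}"
    using G1(3) f(3) g(3) vG vH by (simp add: map_graph_def)
  ultimately have "inj_on h (verts G \<union> verts H)"
    unfolding inj_on_Un by blast
  moreover have "G' = map_graph h (link G r H s)"
    unfolding G1(4) f(3) g(3)
    by (simp add: map_graph_def link_def image_Un eG eH vG vH rs)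
  ultimately show ?case using rs by (intro exI[of _ h]) simp
qed

lemma map_graph_iso:
  assumes "simple_graph G" "inj_on f (verts G)"
  shows "G \<cong>\<^sub>G map_graph f G"
proof -
  have "{u, v} \<in> edges G \<longleftrightarrow> {f u, f v} \<in> edges (map_graph f G)" if uv: "u \<in> verts G" "v \<in> verts G" for u v
  proof
    assume "{f u, f v} \<in> edges (map_graph f G)"
    then obtain e where e: "e \<in> edges G" "f ` {u, v} = f ` e" by (auto simp: map_graph_def)
    then have "{u, v} = e"
      using inj_on_image_eq_iff[OF assms(2), of "{u, v}" e] uv assms(1) by (auto simp: simple_graph_def)
    with e show "{u, v} \<in> edges G" by simp
  next
    assume "{u, v} \<in> edges G"
    then show "{f u, f v} \<in> edges (map_graph f G)"
      by (auto simp: map_graph_def intro: rev_image_eqI)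
  qed
  with assms(2) show ?thesis
    unfolding graph_iso_def by (intro exI[of _ f]) (auto simp: bij_betw_def map_graph_def)
qed

lemma iso_map_graph:
  assumes "G \<cong>\<^sub>G H" "simple_graph G" "simple_graph H"
  shows "\<exists>f. inj_on f (verts G) \<and> H = map_graph f G"
proof -
  obtain f where f: "bij_betw f (verts G) (verts H)"
    "\<And>u v. u \<in> verts G \<Longrightarrow> v \<in> verts G \<Longrightarrow> {u, v} \<in> edges G \<longleftrightarrow> {f u, f v} \<in> edges H"
    using assms(1) by (auto simp: graph_iso_def)
  have img: "verts H = f ` verts G" using f(1) by (simp add: bij_betw_def)
  have "edges H = (`) f ` edges G"
  proof (intro equalityI subsetI)
    fix e assume e: "e \<in> edges H"
    then obtain a b where ab: "e = {a, b}" "a \<in> verts H" "b \<in> verts H"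
      using assms(3) by (auto simp: simple_graph_def card_2_iff)
    then obtain u v where "u \<in> verts G" "v \<in> verts G" "a = f u" "b = f v" using img by auto
    with e ab f(2) show "e \<in> (`) f ` edges G" by (intro image_eqI[of _ _ "{u, v}"]) auto
  next
    fix e assume "e \<in> (`) f ` edges G"
    then obtain e' where e': "e' \<in> edges G" "e = f ` e'" by blast
    then obtain u v where "e' = {u, v}" "u \<in> verts G" "v \<in> verts G"
      using assms(2) by (auto simp: simple_graph_def card_2_iff)
    with e' f(2) show "e \<in> edges H" by auto
  qed
  then show ?thesis using f(1) img
    by (intro exI[of _ f]) (simp add: bij_betw_def map_graph_def)
qed

lemma rep_iso: "rep G r M \<Longrightarrow> rep G' r' M \<Longrightarrow> G \<cong>\<^sub>G G'"
  using rep_unique rep_simple map_graph_iso by metis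

lemma iso_rep:
  assumes "G \<cong>\<^sub>G H" "simple_graph H" "rep G r M"
  shows "\<exists>s. rep H s M"
  using iso_map_graph[OF assms(1) _ assms(2)] rep_simple[OF assms(3)] rep_map[OF assms(3)] by blast

lemma rep_exists_nat: "t = Node M \<Longrightarrow> \<exists>(G :: nat ugraph) r. rep G r M"
proof (induction t arbitrary: M rule: stree_branch_induct)
  case (Node M')
  have "\<And>t N. t \<in># M \<Longrightarrow> t = Node N \<Longrightarrow> \<exists>(G :: nat ugraph) r. rep G r N"
    using Node by auto
  then show ?case
  proof (induction M)
    case empty
    then show ?case using rep.single[of 0 0] by (metis replicate_mset_0)
  next
    case (add t M)
    then obtain G :: "nat ugraph" and r where G: "rep G r M" by fastforce
    show ?case
    proof (cases t)
      case Vacant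
      then show ?thesis using rep_add_Vacant[OF G] by blast
    next
      case (Node N)
      then obtain H :: "nat ugraph" and s where H: "rep H s N" using add.prems by fastforce
      define k where "k = Suc (Max (verts G))"
      have "rep (map_graph ((+) k) H) (k + s) N" using H by (rule rep_map) simp
      moreover have "verts G \<inter> verts (map_graph ((+) k) H) = {}"
      proof -
        have "v < k" if "v \<in> verts G" for v
          using that rep_finite[OF G] by (simp add: k_def le_imp_less_Suc)
        then show ?thesis by (fastforce simp: map_graph_def)
      qed
      ultimately show ?thesis using rep.link[OF G] Node by blast
    qed
  qed
qed simp

section \<open>Degrees and numbers of slots\<close>

lemma vdegree_link:
  assumes "simple_graph G" "simple_graph H" "r \<in> verts G" "s \<in> verts H" "verts G \<inter> verts H = {}"
  shows "v \<in> verts G \<Longrightarrow> vdegree (link G r H s) v = (if v = r then Suc (vdegree G r) else vdegree G v)"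
proof -
  assume v: "v \<in> verts G"
  have fin: "finite (edges G)" by (rule simple_graph_finite_edges[OF assms(1)])
  have "s \<notin> verts G" "v \<noteq> s" using assms(4,5) v by auto
  then have "{r, s} \<notin> edges G" using assms(1) by (auto simp: simple_graph_def)
  moreover have "{e \<in> edges (link G r H s). v \<in> e} =
      (if v = r then insert {r, s} {e \<in> edges G. v \<in> e} else {e \<in> edges G. v \<in> e})"
    using assms(2,5) v \<open>v \<noteq> s\<close> by (auto simp: simple_graph_def)
  ultimately show ?thesis using fin by (simp add: vdegree_def)
qed

lemma vdegree_link':
  assumes "simple_graph G" "simple_graph H" "r \<in> verts G" "s \<in> verts H" "verts G \<inter> verts H = {}"
  shows "v \<in> verts H \<Longrightarrow> vdegree (link G r H s) v = (if v = s then Suc (vdegree H s) else vdegree H v)"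
  using vdegree_link[of H G s r v] assms unfolding link_sym[of G r H s] by blast

lemma rep_degree_root: "rep G r M \<Longrightarrow> vdegree G r = size {#t \<in># M. t \<noteq> Vacant#}"
proof (induction rule: rep.induct)
  case (single r k)
  then show ?case by (induction k) (simp_all add: vdegree_def)
next
  case (link G r M H s N)
  then have "vdegree (link G r H s) r = Suc (vdegree G r)"
    using vdegree_link[of G H r s r] rep_simple[OF link.hyps(1)] rep_simple[OF link.hyps(2)] by simp
  then show ?case using link.IH(1) by simp
qed

lemma size_filter_no_vacant: "\<forall>t\<in>#M. no_vacant t \<Longrightarrow> size {#t \<in># M. t \<noteq> Vacant#} = size M"
  by (induction M) auto

lemma rep_branching:
  "rep G r M \<Longrightarrow> \<forall>t\<in>#M. no_vacant t \<Longrightarrow> \<forall>v\<in>verts G - {r}. vdegree G v \<le> Suc d \<Longrightarrow>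
   \<forall>t\<in>#M. branching_le d t"
proof (induction rule: rep.induct)
  case (link G r M H s N)
  note sg = rep_simple[OF link.hyps(1)] rep_simple[OF link.hyps(2)]
  have sr: "s \<noteq> r" using sg link.hyps(3) by auto
  have dG: "vdegree (link G r H s) v = vdegree G v" if "v \<in> verts G - {r}" for v
    using vdegree_link[of G H r s v] sg link.hyps(3) that by simp
  have dH: "vdegree (link G r H s) v = (if v = s then Suc (vdegree H s) else vdegree H v)" if "v \<in> verts H" for v
    using vdegree_link'[of G H r s v] sg link.hyps(3) that by simp
  have "\<forall>t\<in>#M. branching_le d t"
  proof (rule link.IH(1))
    show "\<forall>v\<in>verts G - {r}. vdegree G v \<le> Suc d"
    proof
      fix v assume "v \<in> verts G - {r}"
      then show "vdegree G v \<le> Suc d" using link.prems(2) dG[of v] by force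
    qed
  qed (use link.prems in simp)
  moreover have "\<forall>t\<in>#N. branching_le d t"
  proof (rule link.IH(2))
    show "\<forall>v\<in>verts H - {s}. vdegree H v \<le> Suc d"
    proof
      fix v assume v: "v \<in> verts H - {s}"
      then have "v \<in> verts (link G r H s) - {r}" using sg link.hyps(3) by auto
      then have "vdegree (link G r H s) v \<le> Suc d" using link.prems(2) by blast
      then show "vdegree H v \<le> Suc d" using dH[of v] v by simp
    qed
  qed (use link.prems in simp)
  moreover have "size N \<le> d"
  proof -
    have "vdegree (link G r H s) s \<le> Suc d" using link.prems(2) sg sr by auto
    then show ?thesis
      using dH sg rep_degree_root[OF link.hyps(2)] link.prems(1) size_filter_no_vacant[of N] by simp
  qed
  ultimately show ?case by simp
qed (simp add: in_replicate_mset)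

lemma rep_regular_degree:
  "rep G r M \<Longrightarrow> \<forall>t\<in>#M. regular d t \<Longrightarrow> \<forall>v\<in>verts G - {r}. vdegree G v \<le> Suc d"
proof (induction rule: rep.induct)
  case (link G r M H s N)
  note sg = rep_simple[OF link.hyps(1)] rep_simple[OF link.hyps(2)]
  have "size N = d" using link.prems by simp
  then have "vdegree H s \<le> d"
    using rep_degree_root[OF link.hyps(2)] size_filter_mset_lesseq[of "\<lambda>t. t \<noteq> Vacant" N] by simp
  have IH: "\<forall>v\<in>verts G - {r}. vdegree G v \<le> Suc d" "\<forall>v\<in>verts H - {s}. vdegree H v \<le> Suc d"
    using link.IH link.prems by auto
  show ?case
  proof
    fix v assume v: "v \<in> verts (link G r H s) - {r}"
    show "vdegree (link G r H s) v \<le> Suc d"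
    proof (cases "v \<in> verts G")
      case True
      then have "vdegree (link G r H s) v = vdegree G v"
        using vdegree_link[of G H r s v] sg link.hyps(3) v by simp
      then show ?thesis using IH(1) True v by simp
    next
      case False
      then have "v \<in> verts H" using v by simp
      then have "vdegree (link G r H s) v = (if v = s then Suc (vdegree H s) else vdegree H v)"
        using vdegree_link'[of G H r s v] sg link.hyps(3) by simp
      then show ?thesis using IH(2) \<open>v \<in> verts H\<close> \<open>vdegree H s \<le> d\<close> by simp
    qed
  qed
qed simp

text \<open>Empty slots are added until a tree of bounded degree becomes a competitor in
  \<open>optimal\<close>; the represented graph stays the same (\<open>rep_pad\<close>).\<close>

primrec pad :: "nat \<Rightarrow> stree \<Rightarrow> stree" where
  "pad d Vacant = Vacant"
| "pad d (Node M) = Node (image_mset (pad d) M + replicate_mset (d - size M) Vacant)"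

lemma rep_pad: "rep G r M \<Longrightarrow> rep G r (image_mset (pad d) M + replicate_mset k Vacant)"
proof (induction arbitrary: k rule: rep.induct)
  case (single r j)
  have "replicate_mset j Vacant + replicate_mset k Vacant = replicate_mset (j + k) Vacant"
    by (induction j) simp_all
  then show ?case using rep.single[of r "j + k"] by simp
next
  case (link G r M H s N)
  show ?case using rep.link[OF link.IH(1)[of k] link.IH(2)[of "d - size N"] link.hyps(3)] by simp
qed

lemma regular_pad: "branching_le d t \<Longrightarrow> regular d (pad d t)"
  by (induction t rule: stree_branch_induct) (auto simp: in_replicate_mset)

section \<open>Connectedness and absence of cycles\<close>

lemma adj_link: "adj (link G r H s) = adj G \<union> adj H \<union> {(r, s), (s, r)}"
  by (auto simp: adj_def doubleton_eq_iff)

lemma adj_sym: "(u, v) \<in> adj G \<longleftrightarrow> (v, u) \<in> adj G"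
  by (simp add: adj_def insert_commute)

lemma adj_rtrancl_sym: "(u, v) \<in> (adj G)\<^sup>* \<Longrightarrow> (v, u) \<in> (adj G)\<^sup>*"
  using sym_rtrancl[of "adj G"] adj_sym[of _ _ G] by (meson symD symI)

lemma adj_verts: "simple_graph G \<Longrightarrow> (u, v) \<in> adj G \<Longrightarrow> u \<in> verts G \<and> v \<in> verts G \<and> u \<noteq> v"
  by (fastforce simp: adj_def simple_graph_def)

lemma connected_graphI:
  "r \<in> verts G \<Longrightarrow> (\<And>v. v \<in> verts G \<Longrightarrow> (r, v) \<in> (adj G)\<^sup>*) \<Longrightarrow> connected_graph G"
  unfolding connected_graph_def using adj_rtrancl_sym by (metis empty_iff rtrancl_trans)

lemma rep_connected: "rep G r M \<Longrightarrow> connected_graph G"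
proof (induction rule: rep.induct)
  case (single r k)
  then show ?case by (simp add: connected_graph_def)
next
  case (link G r M H s N)
  note sg = rep_simple[OF link.hyps(1)] rep_simple[OF link.hyps(2)]
  have mono: "(adj G)\<^sup>* \<subseteq> (adj (link G r H s))\<^sup>*" "(adj H)\<^sup>* \<subseteq> (adj (link G r H s))\<^sup>*"
    by (intro rtrancl_mono; auto simp: adj_link)+
  have rs: "(r, s) \<in> (adj (link G r H s))\<^sup>*" by (auto simp: adj_link)
  show ?case
  proof (rule connected_graphI)
    show "r \<in> verts (link G r H s)" using sg by simp
    fix v assume "v \<in> verts (link G r H s)"
    then consider "v \<in> verts G" | "v \<in> verts H" by auto
    then show "(r, v) \<in> (adj (link G r H s))\<^sup>*"
    proof cases
      case 1
      then show ?thesis using link.IH(1) sg mono by (auto simp: connected_graph_def)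
    next
      case 2
      then have "(s, v) \<in> (adj H)\<^sup>*" using link.IH(2) sg by (auto simp: connected_graph_def)
      then show ?thesis using mono rs by (meson rtrancl_trans subsetD)
    qed
  qed
qed

text \<open>Used in contraposed form: a cyclic walk that visits both a set and its complement leaves
  the set at some position and enters it at another.\<close>

lemma cyclic_propagation:
  fixes n :: nat
  assumes "i < n" "P i" and step: "\<And>i. i < n \<Longrightarrow> P i \<Longrightarrow> P ((i + 1) mod n)" and "j < n"
  shows "P j"
proof -
  have "P ((i + k) mod n)" for k
  proof (induction k)
    case 0
    then show ?case using assms by simp
  next
    case (Suc k)
    have "P (((i + k) mod n + 1) mod n)" using step[OF _ Suc] assms(1) by simp
    then show ?case by (simp add: mod_simps)
  qed
  from this[of "n - i + j"] assms(1,4) show ?thesis by simp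
qed

lemma is_cycle_subgraph:
  assumes cyc: "is_cycle (link G r H s) vs" and sub: "set vs \<subseteq> verts G"
    and disj: "verts G \<inter> verts H = {}" and H: "simple_graph H" "s \<in> verts H"
  shows "is_cycle G vs"
proof -
  have "{vs ! i, vs ! ((i + 1) mod length vs)} \<in> edges G" if i: "i < length vs" for i
  proof -
    have e: "{vs ! i, vs ! ((i + 1) mod length vs)} \<in> edges (link G r H s)"
      using cyc i by (simp add: is_cycle_def)
    have "(i + 1) mod length vs < length vs" using i by (intro mod_less_divisor) auto
    then have "{vs ! i, vs ! ((i + 1) mod length vs)} \<subseteq> verts G"
      using sub i by (auto dest: nth_mem)
    moreover have "\<not> f \<subseteq> verts G" if "f \<in> edges H" for f
    proof
      assume "f \<subseteq> verts G"
      moreover have "f \<subseteq> verts H" "card f = 2" using H(1) that by (auto simp: simple_graph_def)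
      ultimately have "f = {}" using disj by blast
      with \<open>card f = 2\<close> show False by simp
    qed
    moreover have "\<not> {r, s} \<subseteq> verts G" using H(2) disj by auto
    ultimately show ?thesis using e unfolding edges_link by (metis UnE insertE)
  qed
  then show ?thesis using cyc by (simp add: is_cycle_def)
qed

lemma link_crossing:
  assumes "simple_graph G" "simple_graph H" "verts G \<inter> verts H = {}"
    "r \<in> verts G" "s \<in> verts H"
    "{u, v} \<in> edges (link G r H s)" "u \<in> verts G" "v \<notin> verts G"
  shows "u = r \<and> v = s"
proof -
  have "\<not> {u, v} \<subseteq> verts G" "\<not> {u, v} \<subseteq> verts H" using assms(3,7,8) by auto
  then have "{u, v} \<notin> edges G" "{u, v} \<notin> edges H"
    using assms(1,2) unfolding simple_graph_def by blast+
  then have "{u, v} = {r, s}" using assms(6) by simp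
  then show ?thesis using assms by (auto simp: doubleton_eq_iff)
qed

text \<open>A cycle meeting both sides leaves \<open>G\<close> and returns to it through the same
  edge. As its vertices are distinct, the positions of \<open>r\<close> and \<open>s\<close> follow
  each other in both directions, so the length divides 2.\<close>

lemma link_acyclic:
  assumes G: "simple_graph G" "r \<in> verts G" "\<nexists>vs. is_cycle G vs"
    and H: "simple_graph H" "s \<in> verts H" "\<nexists>vs. is_cycle H vs"
    and disj: "verts G \<inter> verts H = {}"
  shows "\<nexists>vs. is_cycle (link G r H s) vs"
proof
  assume "\<exists>vs. is_cycle (link G r H s) vs"
  then obtain vs where vs: "is_cycle (link G r H s) vs" by blast
  define n where "n = length vs"
  have n: "3 \<le> n" "distinct vs"
    and e: "\<And>i. i < n \<Longrightarrow> {vs ! i, vs ! ((i + 1) mod n)} \<in> edges (link G r H s)"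
    using vs by (auto simp: is_cycle_def n_def)
  have mod_less: "(i + 1) mod n < n" for i using n by (intro mod_less_divisor) auto
  have inV: "vs ! i \<in> verts G \<union> verts H" if "i < n" for i
    using e[OF that] G H by (auto simp: simple_graph_def)
  have notsub: "\<not> set vs \<subseteq> verts G" using is_cycle_subgraph[OF vs _ disj H(1,2)] G(3) by blast
  have notsub': "\<not> set vs \<subseteq> verts H"
    using is_cycle_subgraph[of H s G r vs] vs disj G H(3) unfolding link_sym[of G r] by blast
  obtain i0 where i0: "i0 < n" "vs ! i0 \<in> verts G"
    using notsub' inV by (metis Un_iff in_set_conv_nth n_def subsetI)
  obtain j0 where j0: "j0 < n" "vs ! j0 \<notin> verts G"
    using notsub by (metis in_set_conv_nth n_def subsetI)
  obtain i where i: "i < n" "vs ! i \<in> verts G" "vs ! ((i + 1) mod n) \<notin> verts G"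
    using cyclic_propagation[of i0 n "\<lambda>i. vs ! i \<in> verts G" j0] i0 j0 by blast
  obtain j where j: "j < n" "vs ! j \<notin> verts G" "vs ! ((j + 1) mod n) \<in> verts G"
    using cyclic_propagation[of j0 n "\<lambda>i. vs ! i \<notin> verts G" i0] i0 j0 by blast
  have 1: "vs ! i = r" "vs ! ((i + 1) mod n) = s"
    using link_crossing[OF G(1) H(1) disj G(2) H(2) e[OF i(1)] i(2,3)] by auto
  have "{vs ! ((j + 1) mod n), vs ! j} \<in> edges (link G r H s)" using e[OF j(1)] by (simp only: insert_commute)
  then have 2: "vs ! ((j + 1) mod n) = r" "vs ! j = s"
    using link_crossing[OF G(1) H(1) disj G(2) H(2) _ j(3,2)] by auto
  have "j = (i + 1) mod n"
    using 1 2 n j mod_less nth_eq_iff_index_eq[OF n(2), of j "(i + 1) mod n"] by (simp add: n_def)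
  moreover have "i = (j + 1) mod n"
    using 1 2 n i mod_less nth_eq_iff_index_eq[OF n(2), of i "(j + 1) mod n"] by (simp add: n_def)
  ultimately have "i = ((i + 1) mod n + 1) mod n" by metis
  then have "i = (i + 2) mod n" unfolding mod_add_left_eq by (simp add: numeral_2_eq_2)
  moreover have "(i + 2) mod n = (if i + 2 < n then i + 2 else i + 2 - n)"
    using i(1) n(1) by (auto simp: mod_if)
  ultimately show False using n(1) i(1) by (auto split: if_splits)
qed

lemma rep_tree: "rep G r M \<Longrightarrow> tree G"
proof -
  assume "rep G r M"
  then have "\<nexists>vs. is_cycle G vs"
  proof (induction rule: rep.induct)
    case (single r k)
    then show ?case by (force simp: is_cycle_def)
  next
    case (link G r M H s N)
    then show ?case
      using link_acyclic[of G r H s] rep_simple[OF link.hyps(1)] rep_simple[OF link.hyps(2)] by blast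
  qed
  then show ?thesis
    using rep_connected[OF \<open>rep G r M\<close>] rep_simple[OF \<open>rep G r M\<close>] unfolding tree_def by simp
qed

text \<open>A leaf removed in an induction may hang at any vertex; here it is put back while the
  root stays in place.\<close>

lemma rep_add_leaf:
  "rep G r M \<Longrightarrow> \<forall>t\<in>#M. no_vacant t \<Longrightarrow> v \<in> verts G \<Longrightarrow> w \<notin> verts G \<Longrightarrow>
   \<exists>M'. rep (link G v (singleton_graph w) w) r M' \<and> (\<forall>t\<in>#M'. no_vacant t)"
proof (induction rule: rep.induct)
  case (single r k)
  then show ?case
    using rep.link[OF rep.single[of r k] rep.single[of w 0]] by fastforce
next
  case (link G r M H s N)
  let ?W = "singleton_graph w"
  have comm: "link (link G r H s) v ?W w = link (link G v ?W w) r H s"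
    "link (link G r H s) v ?W w = link G r (link H v ?W w) s"
    by (auto simp: link_def)
  show ?case
  proof (cases "v \<in> verts G")
    case True
    then obtain M' where M': "rep (link G v ?W w) r M'" "\<forall>t\<in>#M'. no_vacant t"
      using link by auto
    then have "rep (link (link G v ?W w) r H s) r (add_mset (Node N) M')"
      using link by (intro rep.link) auto
    then show ?thesis using M'(2) link.prems(1) unfolding comm(1) by fastforce
  next
    case False
    then obtain N' where N': "rep (link H v ?W w) s N'" "\<forall>t\<in>#N'. no_vacant t"
      using link by auto
    then have "rep (link G r (link H v ?W w) s) r (add_mset (Node N') M)"
      using link by (intro rep.link) auto
    then show ?thesis using N'(2) link.prems(1) unfolding comm(2) by fastforce
  qed
qed

section \<open>Distances, leaf removal and matchings of the subdivision\<close>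

lemma reachable_gdist: "(r, v) \<in> (adj G)\<^sup>* \<Longrightarrow> (r, v) \<in> adj G ^^ gdist G r v"
  unfolding gdist_def by (rule LeastI_ex) (simp add: rtrancl_imp_relpow)

lemma gdist_le: "(r, v) \<in> adj G ^^ k \<Longrightarrow> gdist G r v \<le> k"
  unfolding gdist_def by (rule Least_le)

lemma gdist_self [simp]: "gdist G r r = 0"
  using gdist_le[where v = r and k = 0] by fastforce

lemma gdist_edge_le: "(r, u) \<in> (adj G)\<^sup>* \<Longrightarrow> (u, v) \<in> adj G \<Longrightarrow> gdist G r v \<le> gdist G r u + 1"
  using gdist_le[where k = "Suc (gdist G r u)" and v = v] reachable_gdist[of r u G] by auto

lemma gdist_parent:
  assumes "(r, v) \<in> (adj G)\<^sup>*" "v \<noteq> r"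
  shows "\<exists>u. (r, u) \<in> (adj G)\<^sup>* \<and> (u, v) \<in> adj G \<and> gdist G r v = gdist G r u + 1"
proof -
  have *: "(r, v) \<in> adj G ^^ gdist G r v" using reachable_gdist[OF assms(1)] .
  with assms(2) obtain k where k: "gdist G r v = Suc k" by (cases "gdist G r v") auto
  with * obtain u where u: "(r, u) \<in> adj G ^^ k" "(u, v) \<in> adj G" by auto
  then have r: "(r, u) \<in> (adj G)\<^sup>*" by (simp add: relpow_imp_rtrancl)
  have "gdist G r u \<le> k" using gdist_le[OF u(1)] .
  moreover have "gdist G r v \<le> gdist G r u + 1" by (rule gdist_edge_le[OF r u(2)])
  ultimately show ?thesis using r u k by (intro exI[of _ u]) simp
qed

text \<open>The parents provide a walk of length \<open>lev v\<close>, and the step condition shows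
  that no walk is shorter.\<close>

lemma gdist_unique:
  assumes "lev r = 0"
    and step: "\<And>u v. (u, v) \<in> adj G \<Longrightarrow> lev v \<le> lev u + (1::nat)"
    and parent: "\<And>v. v \<in> verts G \<Longrightarrow> v \<noteq> r \<Longrightarrow> \<exists>u\<in>verts G. (u, v) \<in> adj G \<and> lev v = lev u + 1"
    and v: "v \<in> verts G"
  shows "gdist G r v = lev v"
proof (rule order_antisym)
  have walk: "v \<in> verts G \<Longrightarrow> (r, v) \<in> adj G ^^ lev v" for v
  proof (induction "lev v" arbitrary: v)
    case 0
    then show ?case using parent by fastforce
  next
    case (Suc k)
    then have "v \<noteq> r" using assms(1) by auto
    then obtain u where "u \<in> verts G" "(u, v) \<in> adj G" "lev v = lev u + 1"
      using parent Suc.prems by blast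
    with Suc show ?case by (metis Suc_eq_plus1 add_right_cancel relpow_Suc_I)
  qed
  then show "gdist G r v \<le> lev v" using gdist_le v by metis
  have "lev v \<le> k" if "(r, v) \<in> adj G ^^ k" for k v
    using that
  proof (induction k arbitrary: v)
    case 0
    then show ?case using assms(1) by simp
  next
    case (Suc k)
    then obtain u where "(r, u) \<in> adj G ^^ k" "(u, v) \<in> adj G" by auto
    with Suc.IH step show ?case by fastforce
  qed
  moreover have "(r, v) \<in> adj G ^^ gdist G r v"
    using reachable_gdist walk[OF v] relpow_imp_rtrancl by metis
  ultimately show "lev v \<le> gdist G r v" by blast
qed

lemma rtrancl_distinct_path:
  assumes "(u, v) \<in> R\<^sup>*"
  shows "\<exists>vs. vs \<noteq> [] \<and> hd vs = u \<and> last vs = v \<and> distinct vs \<and> successively (\<lambda>a b. (a, b) \<in> R) vs"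
  using assms
proof (induction rule: converse_rtrancl_induct)
  case base
  then show ?case by (intro exI[of _ "[v]"]) simp
next
  case (step u w)
  then obtain vs where vs: "vs \<noteq> []" "hd vs = w" "last vs = v" "distinct vs"
    "successively (\<lambda>a b. (a, b) \<in> R) vs" by blast
  show ?case
  proof (cases "u \<in> set vs")
    case True
    then obtain as bs where "vs = as @ u # bs" by (metis split_list)
    with vs show ?thesis
      by (intro exI[of _ "u # bs"]) (auto simp: successively_append_iff)
  next
    case False
    with vs step show ?thesis
      by (intro exI[of _ "u # vs"]) (auto simp: successively_Cons)
  qed
qed

lemma is_cycle_Cons:
  assumes vs: "distinct vs" "successively (\<lambda>a b. (a, b) \<in> adj G) vs" "2 \<le> length vs"
    and w: "w \<notin> set vs" "(w, hd vs) \<in> adj G" "(last vs, w) \<in> adj G"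
  shows "is_cycle G (w # vs)"
  unfolding is_cycle_def
proof (intro conjI allI impI)
  have ne: "vs \<noteq> []" using vs(3) by auto
  show "3 \<le> length (w # vs)" "distinct (w # vs)" using vs w by auto
  fix i assume i: "i < length (w # vs)"
  consider "i = 0" | j where "i = Suc j" "Suc j < length vs" | "i = length vs"
    using i by (cases i) (auto simp: less_Suc_eq)
  then show "{(w # vs) ! i, (w # vs) ! ((i + 1) mod length (w # vs))} \<in> edges G"
  proof cases
    case 1
    have "1 mod length (w # vs) = 1" using ne by (simp add: mod_if)
    with 1 w(2) ne show ?thesis by (simp add: adj_def hd_conv_nth del: length_Cons)
  next
    case 2
    have "(vs ! j, vs ! Suc j) \<in> adj G"
      using vs(2) 2(2) by (simp add: successively_conv_nth)
    with 2 show ?thesis by (simp add: adj_def)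
  next
    case 3
    then have "(i + 1) mod length (w # vs) = 0" by simp
    with 3 w(3) ne show ?thesis by (simp add: adj_def last_conv_nth nth_Cons' del: length_Cons)
  qed
qed

text \<open>A vertex \<open>w\<close> farthest from \<open>r\<close> lies on no shortest path to
  another vertex, so the rest stays connected; a second neighbour of \<open>w\<close> would then
  close a cycle.\<close>

lemma tree_unlink_leaf:
  assumes T: "tree G" and r: "r \<in> verts G" and two: "verts G \<noteq> {r}"
  shows "\<exists>G' v w. tree G' \<and> r \<in> verts G' \<and> v \<in> verts G' \<and> w \<notin> verts G' \<and>
    G = link G' v (singleton_graph w) w"
proof -
  have sg: "simple_graph G" and con: "\<And>v. v \<in> verts G \<Longrightarrow> (r, v) \<in> (adj G)\<^sup>*"
    and acyc: "\<nexists>vs. is_cycle G vs"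
    using T r by (auto simp: tree_def connected_graph_def)
  have fin: "finite (verts G)" using sg by (simp add: simple_graph_def)
  have "Max (gdist G r ` verts G) \<in> gdist G r ` verts G" using fin r by (intro Max_in) auto
  then obtain w where w': "w \<in> verts G" "gdist G r w = Max (gdist G r ` verts G)" by auto
  then have w: "w \<in> verts G" "\<And>u. u \<in> verts G \<Longrightarrow> gdist G r u \<le> gdist G r w"
    using fin by simp_all
  have "w \<noteq> r"
  proof
    assume "w = r"
    obtain u where u: "u \<in> verts G" "u \<noteq> r" using two r by blast
    then have "0 < gdist G r u" using gdist_parent[OF con] by fastforce
    with w(2)[OF u(1)] \<open>w = r\<close> show False by simp
  qed
  then obtain v where v: "(v, w) \<in> adj G" "gdist G r w = gdist G r v + 1"
    using gdist_parent[OF con[OF w(1)]] by blast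
  have vV: "v \<in> verts G" "v \<noteq> w" using adj_verts[OF sg v(1)] by auto
  define G' where "G' = \<lparr>verts = verts G - {w}, edges = {e \<in> edges G. w \<notin> e}\<rparr>"
  have adjG': "(a, b) \<in> adj G' \<longleftrightarrow> (a, b) \<in> adj G \<and> a \<noteq> w \<and> b \<noteq> w" for a b
    by (auto simp: adj_def G'_def)
  have sg': "simple_graph G'" using sg by (auto simp: simple_graph_def G'_def)
  have reach: "u \<in> verts G' \<Longrightarrow> (r, u) \<in> (adj G')\<^sup>*" for u
  proof (induction "gdist G r u" arbitrary: u rule: less_induct)
    case less
    then have u: "u \<in> verts G" "u \<noteq> w" by (auto simp: G'_def)
    show ?case
    proof (cases "u = r")
      case False
      then obtain p where p: "(p, u) \<in> adj G" "gdist G r u = gdist G r p + 1"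
        using gdist_parent[OF con[OF u(1)]] by blast
      then have "p \<noteq> w" "p \<in> verts G" using w(2)[OF u(1)] adj_verts[OF sg] by auto
      then have "(r, p) \<in> (adj G')\<^sup>*" using less.hyps[of p] p(2) by (simp add: G'_def)
      moreover have "(p, u) \<in> adj G'" using adjG' p(1) u \<open>p \<noteq> w\<close> by simp
      ultimately show ?thesis by simp
    qed simp
  qed
  have rG': "r \<in> verts G'" using r \<open>w \<noteq> r\<close> by (simp add: G'_def)
  have conG': "connected_graph G'" using connected_graphI[OF rG'] reach by blast
  have acycG': "\<nexists>vs. is_cycle G' vs" using acyc by (auto simp: is_cycle_def G'_def)
  have unique: "q = v" if "(w, q) \<in> adj G" for q
  proof (rule ccontr)
    assume "q \<noteq> v"
    have q: "q \<in> verts G'" using adj_verts[OF sg that] by (auto simp: G'_def)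
    have v': "v \<in> verts G'" using vV by (simp add: G'_def)
    have "(v, q) \<in> (adj G')\<^sup>*" using conG' q v' by (simp add: connected_graph_def)
    from rtrancl_distinct_path[OF this] obtain vs where vs: "vs \<noteq> []" "hd vs = v" "last vs = q"
      "distinct vs" "successively (\<lambda>a b. (a, b) \<in> adj G') vs" by blast
    have "2 \<le> length vs" using vs(1-3) \<open>q \<noteq> v\<close> by (cases vs) (auto simp: Suc_le_eq split: if_splits)
    moreover have "successively (\<lambda>a b. (a, b) \<in> adj G) vs"
      using vs(5) by (rule successively_mono) (simp add: adjG')
    moreover have "w \<notin> set vs"
    proof
      assume "w \<in> set vs"
      then obtain i where i: "i < length vs" "vs ! i = w" by (auto simp: in_set_conv_nth)
      show False
      proof (cases i)
        case 0
        then show False using i vs(1,2) vV by (simp add: hd_conv_nth)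
      next
        case (Suc j)
        then have "(vs ! j, w) \<in> adj G'" using vs(5) i by (auto simp: successively_conv_nth)
        then show False by (simp add: adjG')
      qed
    qed
    moreover have "(w, hd vs) \<in> adj G" "(last vs, w) \<in> adj G"
      using v(1) that adj_sym[of w v G] adj_sym[of w q G] vs(2,3) by simp_all
    ultimately have "is_cycle G (w # vs)"
      using vs(4) by (intro is_cycle_Cons)
    then show False using acyc by blast
  qed
  have "edges G = insert {v, w} (edges G')"
  proof (intro equalityI subsetI)
    fix e assume e: "e \<in> edges G"
    show "e \<in> insert {v, w} (edges G')"
    proof (cases "w \<in> e")
      case True
      moreover have "card e = 2" using e sg by (simp add: simple_graph_def)
      then obtain a b where "e = {a, b}" by (auto simp: card_2_iff)
      ultimately obtain q where "e = {w, q}" by auto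
      then show ?thesis using unique[of q] e by (auto simp: adj_def)
    qed (use e in \<open>simp add: G'_def\<close>)
  qed (use v(1) in \<open>auto simp: G'_def adj_def\<close>)
  then have "G = link G' v (singleton_graph w) w"
    using w(1) vV by (intro ugraph.equality) (auto simp: G'_def)
  moreover have "tree G'" using sg' conG' acycG' by (simp add: tree_def)
  ultimately show ?thesis using rG' vV by (intro exI[of _ G'] exI[of _ v] exI[of _ w]) (auto simp: G'_def)
qed

theorem tree_rep:
  "tree G \<Longrightarrow> r \<in> verts G \<Longrightarrow> \<exists>M. rep G r M \<and> (\<forall>t\<in>#M. no_vacant t)"
proof (induction "card (verts G)" arbitrary: G rule: less_induct)
  case less
  show ?case
  proof (cases "verts G = {r}")
    case True
    have "e \<notin> edges G" for e
    proof
      assume "e \<in> edges G"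
      then have "e \<subseteq> {r}" "card e = 2" using less.prems True by (auto simp: tree_def simple_graph_def)
      then show False using card_mono[of "{r}" e] by simp
    qed
    then have "edges G = {}" by blast
    then have "G = singleton_graph r" using True by (simp add: singleton_graph_def)
    then show ?thesis using rep.single[of r 0] by (intro exI[of _ "{#}"]) simp
  next
    case False
    then obtain G' v w where G': "tree G'" "r \<in> verts G'" "v \<in> verts G'" "w \<notin> verts G'"
      "G = link G' v (singleton_graph w) w" using tree_unlink_leaf[OF less.prems] by blast
    have "card (verts G') < card (verts G)"
      using G' by (simp add: tree_def simple_graph_def)
    then obtain M where "rep G' r M" "\<forall>t\<in>#M. no_vacant t" using less.hyps G' by blast
    from rep_add_leaf[OF this G'(3,4)] show ?thesis using G'(5) by blast
  qed
qed

section \<open>Matchings of the subdivision\<close>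

definition mpoly :: "'a set set \<Rightarrow> real \<Rightarrow> real" where
  "mpoly E x = (\<Sum>F | F \<subseteq> E \<and> pairwise disjnt F. x ^ card F)"

lemma matching_poly_eq_mpoly:
  assumes "finite (edges G)"
  shows "matching_poly G x = mpoly (edges G) x"
proof -
  let ?A = "{F. F \<subseteq> edges G \<and> pairwise disjnt F}"
  have fin: "finite ?A" using assms by simp
  have "mpoly (edges G) x = (\<Sum>k\<le>card (edges G). \<Sum>F | F \<in> ?A \<and> card F = k. x ^ card F)"
    unfolding mpoly_def
    by (rule sum.group[symmetric]) (use fin assms in \<open>auto intro: card_mono\<close>)
  also have "\<dots> = (\<Sum>k\<le>card (edges G). real (num_matchings G k) * x ^ k)"
  proof (rule sum.cong)
    fix k
    have "(\<Sum>F | F \<in> ?A \<and> card F = k. x ^ card F) = (\<Sum>F | F \<in> ?A \<and> card F = k. x ^ k)"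
      by (rule sum.cong) auto
    then show "(\<Sum>F | F \<in> ?A \<and> card F = k. x ^ card F) = real (num_matchings G k) * x ^ k"
      by (simp add: num_matchings_def matching_def)
  qed simp
  finally show ?thesis by (simp add: matching_poly_def)
qed

lemma mpoly_empty [simp]: "mpoly {} x = 1"
proof -
  have empty: "{F. F \<subseteq> {} \<and> pairwise disjnt F} = {{}}" by auto
  show ?thesis unfolding mpoly_def empty by simp
qed

lemma mpoly_insert:
  assumes "finite E" "e \<notin> E"
  shows "mpoly (insert e E) x = mpoly E x + x * mpoly {f \<in> E. disjnt e f} x"
proof -
  let ?A = "{F. F \<subseteq> E \<and> pairwise disjnt F}"
  let ?B = "{F. F \<subseteq> {f \<in> E. disjnt e f} \<and> pairwise disjnt F}"
  have fin: "finite ?A" "finite ?B" using assms(1) by simp_all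
  have split: "{F. F \<subseteq> insert e E \<and> pairwise disjnt F} = ?A \<union> insert e ` ?B"
  proof (intro equalityI subsetI)
    fix F assume F: "F \<in> {F. F \<subseteq> insert e E \<and> pairwise disjnt F}"
    show "F \<in> ?A \<union> insert e ` ?B"
    proof (cases "e \<in> F")
      case True
      then have "F = insert e (F - {e})" by auto
      moreover have "F - {e} \<in> ?B" using F True by (auto simp: pairwise_def)
      ultimately show ?thesis by blast
    qed (use F in auto)
  next
    fix F assume "F \<in> ?A \<union> insert e ` ?B"
    then consider "F \<in> ?A" | F' where "F' \<in> ?B" "F = insert e F'" by blast
    then show "F \<in> {F. F \<subseteq> insert e E \<and> pairwise disjnt F}"
    proof cases
      case 2
      then have "pairwise disjnt F" by (auto simp: pairwise_insert intro: disjnt_sym)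
      with 2 show ?thesis by auto
    qed auto
  qed
  have disj: "?A \<inter> insert e ` ?B = {}" using assms(2) by auto
  have inj: "inj_on (insert e) ?B"
    using assms(2) by (auto simp: inj_on_def insert_ident)
  have "(\<Sum>F\<in>insert e ` ?B. x ^ card F) = (\<Sum>F\<in>?B. x ^ card (insert e F))"
    by (simp add: sum.reindex[OF inj])
  also have "\<dots> = (\<Sum>F\<in>?B. x * x ^ card F)"
  proof (rule sum.cong)
    fix F assume "F \<in> ?B"
    then have "F \<subseteq> E" by auto
    then have "finite F" "e \<notin> F" using assms finite_subset by blast+
    then show "x ^ card (insert e F) = x * x ^ card F" by simp
  qed simp
  finally show ?thesis
    unfolding mpoly_def split using fin disj by (simp add: sum.union_disjoint sum_distrib_left)
qed

lemma mpoly_Un: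
  assumes "finite E1" "finite E2" "\<And>e f. e \<in> E1 \<Longrightarrow> f \<in> E2 \<Longrightarrow> disjnt e f" "E1 \<inter> E2 = {}"
  shows "mpoly (E1 \<union> E2) x = mpoly E1 x * mpoly E2 x"
  using assms
proof (induction "card E1" arbitrary: E1 rule: less_induct)
  case less
  show ?case
  proof (cases "E1 = {}")
    case False
    then obtain e where e: "e \<in> E1" by blast
    define E where "E = E1 - {e}"
    have E: "E1 = insert e E" "e \<notin> E" "finite E" using e less.prems(1) by (auto simp: E_def)
    have "card E < card E1" using E by simp
    moreover have sub: "card {f \<in> E. disjnt e f} < card E1"
      using E card_mono[of E "{f \<in> E. disjnt e f}"] by simp
    moreover have "{f \<in> E \<union> E2. disjnt e f} = {f \<in> E. disjnt e f} \<union> E2"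
      using less.prems(3) e by auto
    moreover have "mpoly (E \<union> E2) x = mpoly E x * mpoly E2 x"
      using less.prems E calculation(1) by (intro less.hyps) auto
    moreover have "mpoly ({f \<in> E. disjnt e f} \<union> E2) x = mpoly {f \<in> E. disjnt e f} x * mpoly E2 x"
      using less.prems E by (intro less.hyps[OF sub]) auto
    moreover have "e \<notin> E \<union> E2" using E e less.prems(4) by auto
    ultimately show ?thesis
      using E less.prems(2) by (simp add: mpoly_insert algebra_simps)
  qed simp
qed

abbreviation sub_edges :: "'a ugraph \<Rightarrow> ('a + 'a set) set set" where
  "sub_edges G \<equiv> edges (subdivision G)"

lemma sub_edges_link:
  "sub_edges (link G r H s) =
   insert {Inl r, Inr {r, s}} (insert {Inl s, Inr {r, s}} (sub_edges G \<union> sub_edges H))"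
  by (auto simp: subdivision_def)

lemma sub_edges_memb:
  "simple_graph G \<Longrightarrow> h \<in> sub_edges G \<Longrightarrow> \<exists>v e. h = {Inl v, Inr e} \<and> v \<in> verts G \<and> e \<in> edges G"
  by (auto simp: subdivision_def simple_graph_def)

lemma finite_sub_edges:
  assumes "simple_graph G" shows "finite (sub_edges G)"
proof -
  have "finite (edges G)" by (rule simple_graph_finite_edges[OF assms])
  moreover have "sub_edges G \<subseteq> (\<lambda>(v, e). {Inl v, Inr e}) ` (verts G \<times> edges G)"
    using sub_edges_memb[OF assms] by fastforce
  ultimately show ?thesis
    using assms by (auto intro: finite_subset simp: simple_graph_def)
qed

text \<open>The halves \<open>?h1\<close> and \<open>?h2\<close> of the new edge share its
  subdividing vertex, so a matching contains at most one of them. The results are the recursions of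
  \<open>rooted_det\<close> and \<open>forest\<close>.\<close>

lemma mpoly_sub_link:
  assumes G: "simple_graph G" "r \<in> verts G" and H: "simple_graph H" "s \<in> verts H"
    and disj: "verts G \<inter> verts H = {}"
  defines "without \<equiv> \<lambda>K v. {h \<in> sub_edges K. Inl v \<notin> h}"
  shows "mpoly (sub_edges (link G r H s)) x = mpoly (sub_edges G) x * mpoly (sub_edges H) x +
      x * (mpoly (without G r) x * mpoly (sub_edges H) x + mpoly (sub_edges G) x * mpoly (without H s) x)"
    and "mpoly (without (link G r H s) r) x =
      mpoly (without G r) x * (mpoly (sub_edges H) x + x * mpoly (without H s) x)"
proof -
  let ?e = "{r, s}"
  let ?h1 = "{Inl r, Inr ?e}" and ?h2 = "{Inl s, Inr ?e}"
  have rs: "r \<noteq> s" "s \<notin> verts G" "r \<notin> verts H" using G H disj by auto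
  then have eG: "?e \<notin> edges G" "?e \<notin> edges H" using G H by (auto simp: simple_graph_def)
  have fin: "finite (sub_edges G)" "finite (sub_edges H)" using G H finite_sub_edges by auto
  have dGH: "disjnt h k" if hk: "h \<in> sub_edges G" "k \<in> sub_edges H" for h k
  proof -
    obtain v e where h: "h = {Inl v, Inr e}" "v \<in> verts G" "e \<in> edges G"
      using sub_edges_memb[OF G(1) hk(1)] by blast
    obtain w f where k: "k = {Inl w, Inr f}" "w \<in> verts H" "f \<in> edges H"
      using sub_edges_memb[OF H(1) hk(2)] by blast
    have "e \<noteq> f"
    proof
      assume "e = f"
      then have "e \<subseteq> verts G \<inter> verts H" "card e = 2"
        using h k G(1) H(1) by (auto simp: simple_graph_def)
      with disj show False by simp
    qed
    moreover have "v \<noteq> w" using h k disj by auto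
    ultimately show ?thesis by (auto simp: h k disjnt_def)
  qed
  have ne: "h \<noteq> {}" if "h \<in> sub_edges G" for h using sub_edges_memb[OF G(1) that] by auto
  have inter: "sub_edges G \<inter> sub_edges H = {}" using dGH ne by (fastforce simp: disjnt_def)
  have Inr_G: "Inr ?e \<notin> h" if "h \<in> sub_edges G" for h
    using sub_edges_memb[OF G(1) that] eG by auto
  have Inr_H: "Inr ?e \<notin> h" if "h \<in> sub_edges H" for h
    using sub_edges_memb[OF H(1) that] eG by auto
  have Inl_H: "Inl r \<notin> h" if "h \<in> sub_edges H" for h
    using sub_edges_memb[OF H(1) that] rs by auto
  have Inl_G: "Inl s \<notin> h" if "h \<in> sub_edges G" for h
    using sub_edges_memb[OF G(1) that] rs by auto
  have h12: "?h1 \<noteq> ?h2" "\<not> disjnt ?h1 ?h2" using rs by (auto simp: doubleton_eq_iff disjnt_def)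
  have nin: "?h1 \<notin> insert ?h2 (sub_edges G \<union> sub_edges H)" "?h2 \<notin> sub_edges G \<union> sub_edges H"
    using h12(1) Inr_G Inr_H by auto
  have d1: "{k \<in> insert ?h2 (sub_edges G \<union> sub_edges H). disjnt ?h1 k} = without G r \<union> sub_edges H"
    using h12 Inr_G Inr_H Inl_H unfolding without_def by (auto simp: disjnt_def)
  have d2: "{k \<in> sub_edges G \<union> sub_edges H. disjnt ?h2 k} = sub_edges G \<union> without H s"
    using Inr_G Inr_H Inl_G unfolding without_def by (auto simp: disjnt_def)
  have prod: "mpoly (A \<union> B) x = mpoly A x * mpoly B x"
    if "A \<subseteq> sub_edges G" "B \<subseteq> sub_edges H" for A B
    using that fin finite_subset dGH inter by (intro mpoly_Un) blast+
  have sub: "without G r \<subseteq> sub_edges G" "without H s \<subseteq> sub_edges H" by (auto simp: without_def)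
  show "mpoly (sub_edges (link G r H s)) x = mpoly (sub_edges G) x * mpoly (sub_edges H) x +
      x * (mpoly (without G r) x * mpoly (sub_edges H) x + mpoly (sub_edges G) x * mpoly (without H s) x)"
    unfolding sub_edges_link mpoly_insert[OF finite.insertI[OF finite_UnI[OF fin]] nin(1)] d1
      mpoly_insert[OF finite_UnI[OF fin] nin(2)] d2
    by (simp add: prod sub algebra_simps)
  have w: "without (link G r H s) r = insert ?h2 (without G r \<union> sub_edges H)"
    using rs Inl_H unfolding without_def sub_edges_link by auto
  have d3: "{k \<in> without G r \<union> sub_edges H. disjnt ?h2 k} = without G r \<union> without H s"
    using Inr_G Inr_H Inl_G unfolding without_def by (auto simp: disjnt_def)
  have fin': "finite (without G r \<union> sub_edges H)" and nin': "?h2 \<notin> without G r \<union> sub_edges H"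
    using fin sub nin finite_subset by blast+
  show "mpoly (without (link G r H s) r) x =
      mpoly (without G r) x * (mpoly (sub_edges H) x + x * mpoly (without H s) x)"
    unfolding w mpoly_insert[OF fin' nin'] d3 by (simp add: prod sub algebra_simps)
qed

lemma forest_Vacant: "forest x (replicate_mset k Vacant) = 1"
  by (induction k) simp_all

lemma rooted_det_Vacant: "rooted_det x (replicate_mset k Vacant) = 1"
  by (simp add: rooted_det_def forest_Vacant pivot_replicate)

lemma rep_mpoly:
  assumes "0 < x"
  shows "rep G r M \<Longrightarrow> mpoly (sub_edges G) x = rooted_det x M \<and>
    mpoly {h \<in> sub_edges G. Inl r \<notin> h} x = forest x M"
proof (induction rule: rep.induct)
  case (single r k)
  have "sub_edges (singleton_graph r) = {}" by (simp add: subdivision_def)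
  then show ?case by (simp add: forest_Vacant rooted_det_Vacant)
next
  case (link G r M H s N)
  note sg = rep_simple[OF link.hyps(1)] rep_simple[OF link.hyps(2)]
  show ?case
    using mpoly_sub_link[of G r H s x] sg link.hyps(3) link.IH rooted_det_add_Node[OF assms, of N M]
    by (simp add: elim_eq algebra_simps)
qed

theorem rep_matching_poly:
  assumes "0 < x" "rep G r M"
  shows "matching_poly (subdivision G) x = rooted_det x M"
  using rep_mpoly[OF assms] matching_poly_eq_mpoly finite_sub_edges rep_simple[OF assms(2)] by metis

section \<open>The Laplacian polynomial\<close>

text \<open>Entries depend on vertices rather than indices, so eliminating a vertex or changing the
  enumeration leaves the entry function readable.\<close>

definition vmat :: "('a \<Rightarrow> 'a \<Rightarrow> real) \<Rightarrow> 'a list \<Rightarrow> real mat" where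
  "vmat F vs = mat (length vs) (length vs) (\<lambda>(i, j). F (vs ! i) (vs ! j))"

lemma vmat_carrier [simp]: "vmat F vs \<in> carrier_mat (length vs) (length vs)"
  by (simp add: vmat_def)

lemma vmat_dim [simp]: "dim_row (vmat F vs) = length vs" "dim_col (vmat F vs) = length vs"
  by (simp_all add: vmat_def)

lemma vmat_index [simp]:
  "i < length vs \<Longrightarrow> j < length vs \<Longrightarrow> vmat F vs $$ (i, j) = F (vs ! i) (vs ! j)"
  by (simp add: vmat_def)

lemma vmat_cong:
  "(\<And>a b. a \<in> set vs \<Longrightarrow> b \<in> set vs \<Longrightarrow> F a b = F' a b) \<Longrightarrow> vmat F vs = vmat F' vs"
  by (auto simp: vmat_def)

text \<open>The same permutation acts on rows and columns, the latter by transposition, so its sign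
  enters twice and cancels.\<close>

lemma det_vmat_enumeration:
  assumes "distinct vs" "distinct ws" "set vs = set ws"
  shows "det (vmat F vs) = det (vmat F ws)"
proof -
  define n where "n = length ws"
  have "mset vs = mset ws" using assms by (simp add: set_eq_iff_mset_eq_distinct)
  then obtain p where p: "p permutes {..<length ws}" "permute_list p ws = vs"
    using mset_eq_permutation by blast
  have len: "length vs = n" using p(2) by (auto simp: n_def)
  have p': "p permutes {0..<n}" using p(1) by (simp add: n_def atLeast0LessThan)
  have pn: "p i < n" if "i < n" for i using permutes_in_image[OF p', of i] that by simp
  have nth: "vs ! i = ws ! p i" if "i < n" for i
    using p that permute_list_nth[OF p(1)] by (auto simp: n_def)
  have sq: "signof p * signof p = (1 :: real)" by (cases p rule: sign_cases) simp_all
  define A where "A = vmat F ws"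
  have A: "A \<in> carrier_mat n n" by (simp add: A_def n_def)
  define B where "B = mat n n (\<lambda>(i, j). A $$ (p i, j))"
  have B: "B \<in> carrier_mat n n" by (simp add: B_def)
  have "det (vmat F vs) = det (transpose_mat (vmat F vs))"
    by (rule det_transpose[symmetric, of _ n]) (simp add: len[symmetric])
  also have "transpose_mat (vmat F vs) = mat n n (\<lambda>(i, j). transpose_mat B $$ (p i, j))"
  proof (rule eq_matI)
    fix i j assume "i < dim_row (mat n n (\<lambda>(i, j). transpose_mat B $$ (p i, j)))"
      "j < dim_col (mat n n (\<lambda>(i, j). transpose_mat B $$ (p i, j)))"
    then show "transpose_mat (vmat F vs) $$ (i, j) = mat n n (\<lambda>(i, j). transpose_mat B $$ (p i, j)) $$ (i, j)"
      using len pn nth by (simp add: B_def A_def n_def)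
  qed (simp_all add: len)
  also have "det \<dots> = signof p * det (transpose_mat B)"
    by (rule det_permute_rows[OF _ p']) (use B in simp)
  also have "det (transpose_mat B) = det B" by (rule det_transpose[OF B])
  also have "det B = signof p * det A" unfolding B_def by (rule det_permute_rows[OF A p'])
  finally show ?thesis using sq by (simp add: A_def flip: mult.assoc)
qed

text \<open>Adding \<open>- F v w / F w w\<close> times the row of \<open>w\<close> to the row of \<open>v\<close> clears the column of \<open>w\<close>.\<close>

lemma det_vmat_eliminate:
  assumes dist: "distinct (us @ [w])" and v: "v \<in> set us" and m: "F w w \<noteq> 0"
    and zero: "\<And>u. u \<in> set us \<Longrightarrow> u \<noteq> v \<Longrightarrow> F u w = 0"
    and F': "\<And>a b. a \<in> set us \<Longrightarrow> b \<in> set us \<Longrightarrow>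
      F' a b = F a b - (if a = v then F v w * F w b / F w w else 0)"
  shows "det (vmat F (us @ [w])) = F w w * det (vmat F' us)"
proof -
  define n where "n = length us"
  obtain k where k: "k < n" "us ! k = v" using v by (auto simp: in_set_conv_nth n_def)
  let ?A = "vmat F (us @ [w])"
  have A: "?A \<in> carrier_mat (Suc n) (Suc n)" unfolding n_def by (metis length_append_singleton vmat_carrier)
  define a where "a = - F v w / F w w"
  let ?R = "mat 1 n (\<lambda>(i, j). F w (us ! j))" and ?W = "mat 1 1 (\<lambda>_. F w w)"
  have "addrow a k n ?A = four_block_mat (vmat F' us) (0\<^sub>m n 1) ?R ?W" (is "?L = ?S")
  proof (rule eq_matI)
    fix i j assume "i < dim_row ?S" "j < dim_col ?S"
    then have ij: "i < Suc n" "j < Suc n" by (auto simp: n_def)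
    have L: "?L $$ (i, j) = (if k = i then a * ?A $$ (n, j) + ?A $$ (i, j) else ?A $$ (i, j))"
      using ij A by (subst index_mat_addrow(1)) (auto simp: n_def)
    have col: "F (us ! i) w + (if k = i then a * F w w else 0) = 0" if "i < n"
    proof (cases "k = i")
      case True
      then show ?thesis using k m by (simp add: a_def)
    next
      case False
      then have "us ! i \<noteq> v" using k that dist nth_eq_iff_index_eq[of us k i] by (auto simp: n_def)
      then show ?thesis using zero[of "us ! i"] False that by (simp add: n_def)
    qed
    have ki: "us ! i = v \<longleftrightarrow> k = i" if "i < n"
      using k that dist nth_eq_iff_index_eq[of us k i] by (auto simp: n_def)
    consider "i < n" "j < n" | "i < n" "j = n" | "i = n" "j < n" | "i = n" "j = n" using ij by linarith
    then show "?L $$ (i, j) = ?S $$ (i, j)"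
    proof cases
      case 1
      then show ?thesis unfolding L using ki F'[of "us ! i" "us ! j"] k(2)
        by (simp add: n_def nth_append a_def)
    next
      case 2
      then show ?thesis unfolding L using col by (simp add: n_def nth_append algebra_simps split: if_splits)
    next
      case 3
      then show ?thesis unfolding L using k(1) by (simp add: n_def nth_append)
    next
      case 4
      then show ?thesis unfolding L using k(1) by (simp add: n_def nth_append)
    qed
  qed (simp_all add: n_def)
  moreover have "det (addrow a k n ?A) = det ?A"
    by (rule det_addrow[OF _ _ A]) (use k in auto)
  moreover have "det (four_block_mat (vmat F' us) (0\<^sub>m n 1) ?R ?W) = det (vmat F' us) * det ?W"
    by (rule det_four_block_mat_upper_right_zero_col[of _ n]) (simp_all add: n_def)
  moreover have "det ?W = F w w" by (subst det_single) auto
  ultimately show ?thesis by simp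
qed

text \<open>The weights \<open>\<mu>\<close> are the conductances to the ground, initially all 1.
  Eliminating a leaf changes only the weight of its neighbour, so matrices of this form are closed
  under elimination.\<close>

definition lap_entry :: "real \<Rightarrow> 'a ugraph \<Rightarrow> ('a \<Rightarrow> real) \<Rightarrow> 'a \<Rightarrow> 'a \<Rightarrow> real" where
  "lap_entry x G \<mu> a b = (if a = b then \<mu> a + x * real (vdegree G a) else 0) -
     x * (if {a, b} \<in> edges G then 1 else 0)"

definition enum_verts :: "'a ugraph \<Rightarrow> 'a list" where
  "enum_verts G = (SOME vs. distinct vs \<and> set vs = verts G)"

text \<open>The determinant of \<open>diag \<mu> + x L(G)\<close>.\<close>

definition lap_det :: "real \<Rightarrow> 'a ugraph \<Rightarrow> ('a \<Rightarrow> real) \<Rightarrow> real" where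
  "lap_det x G \<mu> = det (vmat (lap_entry x G \<mu>) (enum_verts G))"

lemma enum_verts: "finite (verts G) \<Longrightarrow> distinct (enum_verts G) \<and> set (enum_verts G) = verts G"
  unfolding enum_verts_def by (rule someI_ex) (metis finite_distinct_list)

lemma lap_det_eq:
  assumes "distinct vs" "set vs = verts G"
  shows "lap_det x G \<mu> = det (vmat (lap_entry x G \<mu>) vs)"
proof -
  have "finite (verts G)" using assms(2) by (metis List.finite_set)
  from enum_verts[OF this] have "set (enum_verts G) = set vs" "distinct (enum_verts G)"
    using assms(2) by simp_all
  then show ?thesis
    unfolding lap_det_def using det_vmat_enumeration assms(1) by blast
qed

lemma lap_det_cong:
  assumes "finite (verts G)" "\<And>v. v \<in> verts G \<Longrightarrow> \<mu> v = \<mu>' v"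
  shows "lap_det x G \<mu> = lap_det x G \<mu>'"
proof -
  have "vmat (lap_entry x G \<mu>) (enum_verts G) = vmat (lap_entry x G \<mu>') (enum_verts G)"
    using enum_verts[OF assms(1)] assms(2) by (intro vmat_cong) (simp add: lap_entry_def)
  then show ?thesis by (simp add: lap_det_def)
qed

text \<open>The diagonal entry of \<open>v\<close> loses \<open>x\<close> with the edge and gains
  \<open>x\<close> minus the correction \<open>x * x / (\<mu> w + x)\<close> of the Schur
  complement; the net weight is the series conductance of edge and ground.\<close>

lemma lap_det_leaf:
  assumes G: "simple_graph G" "v \<in> verts G" "w \<notin> verts G" and m: "\<mu> w + x \<noteq> 0"
  shows "lap_det x (link G v (singleton_graph w) w) \<mu> =
    (\<mu> w + x) * lap_det x G (\<mu>(v := \<mu> v + \<mu> w * x / (\<mu> w + x)))"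
proof -
  let ?G = "link G v (singleton_graph w) w"
  let ?\<mu> = "\<mu>(v := \<mu> v + \<mu> w * x / (\<mu> w + x))"
  let ?F = "lap_entry x ?G \<mu>"
  have sgw: "simple_graph (singleton_graph w)" by (simp add: simple_graph_def)
  have fin: "finite (verts G)" using G by (simp add: simple_graph_def)
  define us where "us = enum_verts G"
  have us: "distinct us" "set us = verts G" using enum_verts[OF fin] by (auto simp: us_def)
  have dw: "vdegree ?G w = 1"
    using vdegree_link'[of G "singleton_graph w" v w w] G sgw by (simp add: vdegree_def[of "singleton_graph w"])
  have du: "vdegree ?G u = (if u = v then Suc (vdegree G v) else vdegree G u)" if "u \<in> verts G" for u
    using vdegree_link[of G "singleton_graph w" v w u] G sgw that by simp
  have noloop: "{a} \<notin> edges G" for a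
  proof
    assume "{a} \<in> edges G"
    then have "card {a} = 2" using G(1) unfolding simple_graph_def by blast
    then show False by simp
  qed
  have notin: "e \<notin> edges G" if "w \<in> e" for e
    using G(1,3) that unfolding simple_graph_def by blast
  have vw: "v \<noteq> w" using G by auto
  have Fww: "?F w w = \<mu> w + x" using dw vw notin by (simp add: lap_entry_def)
  have Fvw: "?F u w = (if u = v then - x else 0)" "?F w u = (if u = v then - x else 0)"
    if "u \<in> verts G" for u
    using that vw G(3) notin by (auto simp: lap_entry_def doubleton_eq_iff insert_commute)
  have Fab: "lap_entry x G ?\<mu> a b = ?F a b - (if a = v then ?F v w * ?F w b / ?F w w else 0)"
    if ab: "a \<in> verts G" "b \<in> verts G" for a b
  proof -
    have e: "{a, b} \<in> edges ?G \<longleftrightarrow> {a, b} \<in> edges G" using ab G(3) by (auto simp: doubleton_eq_iff)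
    show ?thesis
    proof (cases "a = b \<and> a = v")
      case True
      have "\<mu> v + \<mu> w * x / (\<mu> w + x) + x * real (vdegree G v) =
          \<mu> v + x * real (Suc (vdegree G v)) - (- x) * (- x) / (\<mu> w + x)"
        using m by (simp add: field_simps)
      moreover have "lap_entry x G ?\<mu> v v = \<mu> v + \<mu> w * x / (\<mu> w + x) + x * real (vdegree G v)"
        by (simp add: lap_entry_def noloop)
      moreover have "{v, v} \<notin> edges ?G" using e True noloop vw by simp
      then have "?F v v = \<mu> v + x * real (Suc (vdegree G v))"
        using du[OF G(2)] by (simp add: lap_entry_def)
      moreover have "?F v w = - x" "?F w v = - x" using Fvw[OF G(2)] by simp_all
      ultimately have "lap_entry x G ?\<mu> v v = ?F v v - ?F v w * ?F w v / ?F w w"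
        using Fww by simp
      moreover have "a = v" "b = v" using True by auto
      ultimately show ?thesis by simp
    next
      case False
      then have z: "(if a = v then ?F v w * ?F w b / ?F w w else 0) = 0"
        using Fvw(2)[OF ab(2)] by auto
      have "lap_entry x G ?\<mu> a b = ?F a b"
        using False e du[OF ab(1)] unfolding lap_entry_def by auto
      then show ?thesis unfolding z by simp
    qed
  qed
  have "lap_det x ?G \<mu> = det (vmat ?F (us @ [w]))"
    using us G by (intro lap_det_eq) auto
  also have "\<dots> = ?F w w * det (vmat (lap_entry x G ?\<mu>) us)"
  proof (rule det_vmat_eliminate[of us w v])
    show "distinct (us @ [w])" "v \<in> set us" using us G by auto
    show "?F w w \<noteq> 0" using Fww m by simp
    show "?F u w = 0" if "u \<in> set us" "u \<noteq> v" for u using Fvw that us by simp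
    show "lap_entry x G ?\<mu> a b = ?F a b - (if a = v then ?F v w * ?F w b / ?F w w else 0)"
      if "a \<in> set us" "b \<in> set us" for a b using Fab that us by blast
  qed
  finally show ?thesis using Fww us by (simp add: lap_det_eq[of us])
qed

lemma verts_graph_union [simp]: "verts (graph_union G H) = verts G \<union> verts H"
  and edges_graph_union [simp]: "edges (graph_union G H) = edges G \<union> edges H"
  by (simp_all add: graph_union_def)

text \<open>
  Stated for a tree \<open>H\<close> grafted onto an arbitrary graph \<open>G\<close>, so that in the induction a branch can
  be eliminated while the rest of the tree is still present.
\<close>

lemma lap_det_graft:
  assumes x: "0 < x"
  shows "rep H s N \<Longrightarrow> simple_graph G \<Longrightarrow> verts G \<inter> verts H = {s} \<Longrightarrow>
    (\<And>v. v \<in> verts H \<Longrightarrow> v \<noteq> s \<Longrightarrow> \<mu> v = 1) \<Longrightarrow>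
    lap_det x (graph_union G H) \<mu> = forest x N * lap_det x G (\<mu>(s := \<mu> s + pivot x N - 1))"
proof (induction arbitrary: G \<mu> rule: rep.induct)
  case (single s k)
  then have "graph_union G (singleton_graph s) = G"
    by (intro ugraph.equality) auto
  then show ?case by (simp add: forest_Vacant pivot_replicate)
next
  case (link H s N K u N1)
  note sg = rep_simple[OF link.hyps(1)] rep_simple[OF link.hyps(2)]
  let ?U = "graph_union G H"
  let ?G = "link ?U s (singleton_graph u) u"
  have s: "s \<in> verts G" using link.prems(2) by auto
  have us: "u \<noteq> s" "u \<notin> verts H" using sg link.hyps(3) by auto
  have uG: "u \<notin> verts G" using link.prems(2) sg us by auto
  have sgU: "simple_graph ?U" using link.prems(1) sg by (auto simp: simple_graph_def)
  have sgG: "simple_graph ?G"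
    using sgU s us(1) by (auto simp: simple_graph_def)
  have eq: "graph_union G (link H s K u) = graph_union ?G K"
    using sg by (intro ugraph.equality) auto
  have int: "verts ?G \<inter> verts K = {u}"
    using link.prems(2) link.hyps(3) sg by auto
  have ones: "\<mu> v = 1" if "v \<in> verts H \<union> verts K" "v \<noteq> s" for v using link.prems(3) that by simp
  have "\<mu> u = 1" using ones sg us by simp
  let ?\<mu>1 = "\<mu>(u := pivot x N1)"
  let ?\<mu>2 = "?\<mu>1(s := ?\<mu>1 s + ?\<mu>1 u * x / (?\<mu>1 u + x))"
  have p: "0 < pivot x N1" using pivot_ge_1[OF x, of N1] by simp
  have "lap_det x (graph_union ?G K) \<mu> = forest x N1 * lap_det x ?G (\<mu>(u := \<mu> u + pivot x N1 - 1))"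
  proof (rule link.IH(2)[OF sgG int])
    fix v assume v: "v \<in> verts K" "v \<noteq> u"
    then have "v \<noteq> s" using sg link.hyps(3) by auto
    then show "\<mu> v = 1" using ones v by simp
  qed
  also have "\<mu>(u := \<mu> u + pivot x N1 - 1) = ?\<mu>1" using \<open>\<mu> u = 1\<close> by simp
  also have "lap_det x ?G ?\<mu>1 = (?\<mu>1 u + x) * lap_det x ?U ?\<mu>2"
    using uG us s p x by (intro lap_det_leaf[OF sgU]) auto
  also have "lap_det x ?U ?\<mu>2 = forest x N * lap_det x G (?\<mu>2(s := ?\<mu>2 s + pivot x N - 1))"
  proof (rule link.IH(1)[OF link.prems(1)])
    show "verts G \<inter> verts H = {s}" using link.prems(2) s sg by auto
    show "?\<mu>2 v = 1" if "v \<in> verts H" "v \<noteq> s" for v using that ones us by auto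
  qed
  also have "lap_det x G (?\<mu>2(s := ?\<mu>2 s + pivot x N - 1)) =
      lap_det x G (\<mu>(s := \<mu> s + pivot x (add_mset (Node N1) N) - 1))"
    using link.prems(1) uG us by (intro lap_det_cong) (auto simp: simple_graph_def cnd_Node)
  finally show ?case unfolding eq using us by (simp add: elim_Node mult_ac fun_upd_def)
qed

lemma rep_lap_det:
  assumes x: "0 < x" and rep: "rep G r M"
  shows "lap_det x G (\<lambda>_. 1) = rooted_det x M"
proof -
  let ?R = "singleton_graph r"
  have "graph_union ?R G = G" using rep_simple[OF rep] by (intro ugraph.equality) auto
  then have "lap_det x G (\<lambda>_. 1) = forest x M * lap_det x ?R ((\<lambda>_. 1)(r := 1 + pivot x M - 1))"
    using lap_det_graft[OF x rep, of ?R "\<lambda>_. 1"] rep_simple[OF rep] by (simp add: simple_graph_def)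
  also have "lap_det x ?R ((\<lambda>_. 1)(r := 1 + pivot x M - 1)) = pivot x M"
    by (subst lap_det_eq[of "[r]"]) (simp_all add: vmat_def lap_entry_def vdegree_def det_single)
  finally show ?thesis by (simp add: rooted_det_def)
qed

lemma laplacian_carrier: "laplacian_mat G vs \<in> carrier_mat (length vs) (length vs)"
  by (intro carrier_matI) (simp_all add: laplacian_mat_def degree_mat_def adjacency_mat_def)

text \<open>The all-ones vector lies in the kernel. This makes the coefficient \<open>c_n\<close>
  vanish, so the sum in \<open>lap_poly\<close>, which stops before \<open>n\<close>, is the
  complete reversed polynomial.\<close>

lemma laplacian_singular:
  assumes sg: "simple_graph G" and ne: "verts G \<noteq> {}" and vs: "distinct vs" "set vs = verts G"
  shows "det (laplacian_mat G vs) = 0"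
proof -
  let ?n = "length vs" and ?L = "laplacian_mat G vs"
  have L: "?L \<in> carrier_mat ?n ?n" by (rule laplacian_carrier)
  let ?one = "vec ?n (\<lambda>_. 1) :: real vec"
  have "?n > 0" using ne vs by (cases vs) auto
  then have "?one \<noteq> 0\<^sub>v ?n" by (metis index_vec index_zero_vec(1) zero_neq_one)
  moreover have "?L *\<^sub>v ?one = 0\<^sub>v ?n"
  proof (rule eq_vecI)
    fix i assume "i < dim_vec (0\<^sub>v ?n :: real vec)"
    then have i: "i < ?n" by simp
    let ?v = "vs ! i"
    have "(?L *\<^sub>v ?one) $ i = (\<Sum>j = 0..<?n. (if i = j then real (vdegree G ?v) else 0) -
        (if {?v, vs ! j} \<in> edges G then 1 else 0))"
      using i L by (simp add: scalar_prod_def laplacian_mat_def degree_mat_def adjacency_mat_def)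
    also have "\<dots> = real (vdegree G ?v) - (\<Sum>j = 0..<?n. if {?v, vs ! j} \<in> edges G then 1 else 0)"
      using i by (simp add: sum_subtractf)
    also have "(\<Sum>j = 0..<?n. if {?v, vs ! j} \<in> edges G then 1 else 0) =
        (\<Sum>u\<in>verts G. if {?v, u} \<in> edges G then 1 else 0 :: real)"
      unfolding vs(2)[symmetric] sum.distinct_set_conv_list[OF vs(1)] sum_list_sum_nth by simp
    also have "\<dots> = real (card {u \<in> verts G. {?v, u} \<in> edges G})"
      using sg by (simp add: sum.If_cases simple_graph_def Int_def)
    also have "card {u \<in> verts G. {?v, u} \<in> edges G} = card ((\<lambda>u. {?v, u}) ` {u \<in> verts G. {?v, u} \<in> edges G})"
      by (rule card_image[symmetric]) (auto simp: inj_on_def doubleton_eq_iff)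
    also have "(\<lambda>u. {?v, u}) ` {u \<in> verts G. {?v, u} \<in> edges G} = {e \<in> edges G. ?v \<in> e}"
    proof (intro equalityI subsetI)
      fix e assume e: "e \<in> {e \<in> edges G. ?v \<in> e}"
      then have "card e = 2" "e \<subseteq> verts G" using sg by (auto simp: simple_graph_def)
      then obtain a b where "e = {a, b}" by (auto simp: card_2_iff)
      with e \<open>e \<subseteq> verts G\<close> show "e \<in> (\<lambda>u. {?v, u}) ` {u \<in> verts G. {?v, u} \<in> edges G}"
        by (auto simp: insert_commute)
    qed auto
    finally show "(?L *\<^sub>v ?one) $ i = 0\<^sub>v ?n $ i" using i by (simp add: vdegree_def)
  qed (use L in simp)
  ultimately show ?thesis
    unfolding det_0_iff_vec_prod_zero[OF L] by (intro exI[of _ ?one]) simp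
qed

theorem rep_lap_poly:
  assumes x: "0 < x" and rep: "rep G r M"
  shows "lap_poly G x = rooted_det x M"
proof -
  note sg = rep_simple[OF rep]
  have fin: "finite (verts G)" using sg by (simp add: simple_graph_def)
  let ?vs = "enum_verts G"
  note vs = enum_verts[OF fin]
  define n where "n = length ?vs"
  have n: "card (verts G) = n" using vs distinct_card unfolding n_def by metis
  let ?L = "laplacian_mat G ?vs"
  have L: "?L \<in> carrier_mat n n"
    unfolding n_def by (rule laplacian_carrier)
  define cp where "cp = laplacian_char_poly G"
  have cp: "cp = char_poly ?L" by (simp add: cp_def laplacian_char_poly_def enum_verts_def)
  have deg: "degree cp = n" using degree_monic_char_poly[OF L] cp by simp
  let ?V = "vmat (lap_entry x G (\<lambda>_. 1)) ?vs"
  \<comment> \<open>At the argument \<open>-1/x\<close> the matrix \<open>(-1/x) I - L\<close> is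
    \<open>-1/x\<close> times \<open>I + x L\<close>.\<close>
  have "- char_matrix ?L (- 1 / x) = (- 1 / x) \<cdot>\<^sub>m ?V"
  proof (rule eq_matI)
    fix i j assume "i < dim_row ((- 1 / x) \<cdot>\<^sub>m ?V)" "j < dim_col ((- 1 / x) \<cdot>\<^sub>m ?V)"
    then have ij: "i < length ?vs" "j < length ?vs" by simp_all
    have "?vs ! i = ?vs ! j \<longleftrightarrow> i = j" using ij vs nth_eq_iff_index_eq by blast
    then show "(- char_matrix ?L (- 1 / x)) $$ (i, j) = ((- 1 / x) \<cdot>\<^sub>m ?V) $$ (i, j)"
      using ij x by (simp add: char_matrix_def laplacian_mat_def degree_mat_def adjacency_mat_def
          lap_entry_def field_simps)
  qed (use L in \<open>simp_all add: char_matrix_def n_def\<close>)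
  then have "poly cp (- 1 / x) = (- 1 / x) ^ n * det ?V"
    unfolding cp char_poly_matrix[OF L] by (simp add: n_def)
  then have 1: "(- x) ^ n * poly cp (- 1 / x) = det ?V"
    using x by (simp add: power_divide field_simps flip: power_mult_distrib)
  have coeff0: "coeff cp 0 = 0"
  proof -
    have "coeff cp 0 = det (- char_matrix ?L 0)"
      unfolding cp char_poly_matrix[OF L, symmetric] by (simp add: poly_0_coeff_0)
    also have "- char_matrix ?L 0 = (- 1) \<cdot>\<^sub>m ?L"
      using L by (intro eq_matI) (auto simp: char_matrix_def)
    also have "det \<dots> = 0" using laplacian_singular[of G ?vs] sg vs by auto
    finally show ?thesis .
  qed
  have "(- x) ^ n * poly cp (- 1 / x) = (\<Sum>i\<le>n. coeff cp i * (- x) ^ (n - i))"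
    unfolding poly_altdef deg sum_distrib_left
  proof (rule sum.cong)
    fix i assume "i \<in> {..n}"
    then have "(- x) ^ n = (- x) ^ (n - i) * (- x) ^ i" by (simp flip: power_add)
    moreover have "(- x) ^ i * (- 1 / x) ^ i = 1" using x by (simp flip: power_mult_distrib)
    ultimately show "(- x) ^ n * (coeff cp i * (- 1 / x) ^ i) = coeff cp i * (- x) ^ (n - i)"
      by (simp add: mult_ac)
  qed simp
  also have "\<dots> = (\<Sum>k\<le>n. coeff cp (n - k) * (- x) ^ k)"
    by (rule sum.reindex_bij_witness[of _ "\<lambda>k. n - k" "\<lambda>k. n - k"]) auto
  also have "\<dots> = (\<Sum>k<n. coeff cp (n - k) * (- x) ^ k)"
    using coeff0 by (simp add: lessThan_Suc_atMost[symmetric])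
  also have "\<dots> = lap_poly G x"
    unfolding lap_poly_def lap_coeff_def n cp_def[symmetric]
    by (rule sum.cong) (simp_all add: power_minus[of x] mult_ac)
  finally have "lap_poly G x = det ?V" using 1 by simp
  also have "\<dots> = lap_det x G (\<lambda>_. 1)" by (simp add: lap_det_def)
  finally show ?thesis using rep_lap_det[OF x rep] by simp
qed

section \<open>Greedy graphs\<close>

lemma child_rel_adj: "(v, u) \<in> child_rel G r \<Longrightarrow> (v, u) \<in> adj G"
  by (simp add: child_rel_def)

lemma children_verts: "simple_graph G \<Longrightarrow> u \<in> children G r v \<Longrightarrow> u \<in> verts G"
  using adj_verts[of G v u] by (simp add: children_def child_rel_def)

lemma connected_child_reach:
  assumes "connected_graph G" "r \<in> verts G"
  shows "v \<in> verts G \<Longrightarrow> (r, v) \<in> (child_rel G r)\<^sup>*"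
proof -
  have con: "(r, v) \<in> (adj G)\<^sup>*" if "v \<in> verts G" for v using assms that by (simp add: connected_graph_def)
  have "(r, v) \<in> (adj G)\<^sup>* \<Longrightarrow> (r, v) \<in> (child_rel G r)\<^sup>*" for v
  proof (induction "gdist G r v" arbitrary: v)
    case 0
    then show ?case using gdist_parent[of r v G] by fastforce
  next
    case (Suc k)
    then have "v \<noteq> r" by auto
    then obtain u where u: "(r, u) \<in> (adj G)\<^sup>*" "(u, v) \<in> adj G" "gdist G r v = gdist G r u + 1"
      using gdist_parent[OF Suc.prems] by blast
    have "(r, u) \<in> (child_rel G r)\<^sup>*" using Suc.hyps(1)[of u] Suc.hyps(2) u by simp
    moreover have "(u, v) \<in> child_rel G r" using u by (simp add: child_rel_def)
    ultimately show ?case by simp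
  qed
  then show "v \<in> verts G \<Longrightarrow> (r, v) \<in> (child_rel G r)\<^sup>*" using con by blast
qed

lemma subtree_root:
  assumes "connected_graph G" "r \<in> verts G" "simple_graph G"
  shows "subtree G r r = G"
  using connected_child_reach[OF assms(1,2)] assms(3)
  by (intro ugraph.equality) (fastforce simp: subtree_def induced_def simple_graph_def)+

text \<open>Distances, children and subtrees are defined by walks in the whole graph; here they are
  reduced to those of the two sides of a linking edge.\<close>

locale linked =
  fixes G :: "'a ugraph" and r :: 'a and H :: "'a ugraph" and s :: 'a
  assumes sG: "simple_graph G" and cG: "connected_graph G" and r: "r \<in> verts G"
    and sH: "simple_graph H" and cH: "connected_graph H" and s: "s \<in> verts H"
    and disj: "verts G \<inter> verts H = {}"
begin

abbreviation "L \<equiv> link G r H s"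

lemma reach_G: "v \<in> verts G \<Longrightarrow> (r, v) \<in> (adj G)\<^sup>*"
  and reach_H: "v \<in> verts H \<Longrightarrow> (s, v) \<in> (adj H)\<^sup>*"
  using cG cH r s by (auto simp: connected_graph_def)

lemma gdist_link:
  assumes "v \<in> verts L"
  shows "gdist L r v = (if v \<in> verts G then gdist G r v else Suc (gdist H s v))"
proof (rule gdist_unique[OF _ _ _ assms])
  let ?lev = "\<lambda>v. if v \<in> verts G then gdist G r v else Suc (gdist H s v)"
  have nG: "v \<notin> verts G" if "v \<in> verts H" for v using disj that by auto
  show "?lev r = 0" using r by simp
  show "?lev v \<le> ?lev u + 1" if "(u, v) \<in> adj L" for u v
  proof -
    consider "(u, v) \<in> adj G" | "(u, v) \<in> adj H" | "u = r" "v = s" | "u = s" "v = r"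
      using \<open>(u, v) \<in> adj L\<close> by (auto simp: adj_link)
    then show ?thesis
    proof cases
      case 1
      then show ?thesis using adj_verts[OF sG 1] gdist_edge_le[OF reach_G 1] by simp
    next
      case 2
      then show ?thesis using adj_verts[OF sH 2] gdist_edge_le[OF reach_H 2] nG by simp
    qed (use r s nG in simp_all)
  qed
  show "\<exists>u\<in>verts L. (u, v) \<in> adj L \<and> ?lev v = ?lev u + 1" if v: "v \<in> verts L" "v \<noteq> r" for v
  proof (cases "v \<in> verts G")
    case True
    then obtain u where u: "(u, v) \<in> adj G" "gdist G r v = gdist G r u + 1"
      using gdist_parent[OF reach_G v(2)] by blast
    then show ?thesis using adj_verts[OF sG u(1)] True by (intro bexI[of _ u]) (auto simp: adj_link)
  next
    case False
    then have vH: "v \<in> verts H" using v by simp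
    show ?thesis
    proof (cases "v = s")
      case True
      then show ?thesis using r False by (intro bexI[of _ r]) (auto simp: adj_link)
    next
      case False
      then obtain u where u: "(u, v) \<in> adj H" "gdist H s v = gdist H s u + 1"
        using gdist_parent[OF reach_H[OF vH]] by blast
      then show ?thesis using adj_verts[OF sH u(1)] nG by (intro bexI[of _ u]) (auto simp: adj_link)
    qed
  qed
qed

lemma child_rel_link: "child_rel L r = insert (r, s) (child_rel G r \<union> child_rel H s)"
proof -
  have G: "gdist L r v = gdist G r v" if "v \<in> verts G" for v using gdist_link[of v] that by simp
  have H: "gdist L r v = Suc (gdist H s v)" if "v \<in> verts H" for v using gdist_link[of v] that disj by auto
  have 1: "(u, v) \<in> adj G \<Longrightarrow> (u, v) \<in> child_rel L r \<longleftrightarrow> (u, v) \<in> child_rel G r" for u v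
    using adj_verts[OF sG, of u v] G by (simp add: child_rel_def adj_link)
  have 2: "(u, v) \<in> adj H \<Longrightarrow> (u, v) \<in> child_rel L r \<longleftrightarrow> (u, v) \<in> child_rel H s" for u v
    using adj_verts[OF sH, of u v] H by (simp add: child_rel_def adj_link)
  have 3: "(r, s) \<in> child_rel L r" "(s, r) \<notin> child_rel L r"
    using G[OF r] H[OF s] by (simp_all add: child_rel_def adj_link)
  show ?thesis
  proof (intro equalityI subsetI)
    fix p assume p: "p \<in> child_rel L r"
    obtain u v where uv: "p = (u, v)" by (cases p)
    have "(u, v) \<in> adj L" using p uv child_rel_adj[of u v L r] by simp
    then show "p \<in> insert (r, s) (child_rel G r \<union> child_rel H s)"
      using p 1 2 3 unfolding uv adj_link by blast
  next
    fix p assume "p \<in> insert (r, s) (child_rel G r \<union> child_rel H s)"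
    then show "p \<in> child_rel L r"
      using 1 2 3 child_rel_adj[of _ _ G r] child_rel_adj[of _ _ H s] by (cases p) blast
  qed
qed

lemma child_rel_G: "(u, v) \<in> child_rel G r \<Longrightarrow> u \<in> verts G \<and> v \<in> verts G \<and> v \<noteq> r"
  using adj_verts[OF sG] by (auto simp: child_rel_def)

lemma child_rel_H: "(u, v) \<in> child_rel H s \<Longrightarrow> u \<in> verts H \<and> v \<in> verts H"
  using adj_verts[OF sH] by (auto simp: child_rel_def)

lemma children_link_root: "children L r r = insert s (children G r r)"
  using child_rel_H[of r] r disj by (auto simp: children_def child_rel_link)

lemma children_link_G: "v \<in> verts G \<Longrightarrow> v \<noteq> r \<Longrightarrow> children L r v = children G r v"
  using child_rel_H[of v] disj by (auto simp: children_def child_rel_link)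

lemma children_link_H: "v \<in> verts H \<Longrightarrow> children L r v = children H s v"
  using child_rel_G[of v] r disj by (auto simp: children_def child_rel_link)

lemma children_G_verts: "children G r v \<subseteq> verts G - {r}"
  using child_rel_G by (auto simp: children_def)

lemma reach_H_iff:
  assumes "v \<in> verts H"
  shows "(v, w) \<in> (child_rel L r)\<^sup>* \<longleftrightarrow> (v, w) \<in> (child_rel H s)\<^sup>*"
proof
  assume "(v, w) \<in> (child_rel L r)\<^sup>*"
  then have "(v, w) \<in> (child_rel H s)\<^sup>* \<and> w \<in> verts H"
  proof (induction rule: rtrancl_induct)
    case (step y z)
    then have "(y, z) \<in> child_rel H s" using child_rel_G[of y] r disj by (auto simp: child_rel_link)
    with step child_rel_H[of y z] show ?case by (auto intro: rtrancl.rtrancl_into_rtrancl)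
  qed (use assms in simp)
  then show "(v, w) \<in> (child_rel H s)\<^sup>*" by blast
next
  assume "(v, w) \<in> (child_rel H s)\<^sup>*"
  moreover have "child_rel H s \<subseteq> child_rel L r" by (auto simp: child_rel_link)
  ultimately show "(v, w) \<in> (child_rel L r)\<^sup>*" using rtrancl_mono by blast
qed

lemma reach_G_iff:
  assumes "v \<in> verts G" "v \<noteq> r"
  shows "(v, w) \<in> (child_rel L r)\<^sup>* \<longleftrightarrow> (v, w) \<in> (child_rel G r)\<^sup>*"
proof
  assume "(v, w) \<in> (child_rel L r)\<^sup>*"
  then have "(v, w) \<in> (child_rel G r)\<^sup>* \<and> w \<in> verts G \<and> w \<noteq> r"
  proof (induction rule: rtrancl_induct)
    case (step y z)
    then have "(y, z) \<in> child_rel G r" using child_rel_H[of y] disj by (auto simp: child_rel_link)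
    with step child_rel_G[of y z] show ?case by (auto intro: rtrancl.rtrancl_into_rtrancl)
  qed (use assms in simp)
  then show "(v, w) \<in> (child_rel G r)\<^sup>*" by blast
next
  assume "(v, w) \<in> (child_rel G r)\<^sup>*"
  moreover have "child_rel G r \<subseteq> child_rel L r" by (auto simp: child_rel_link)
  ultimately show "(v, w) \<in> (child_rel L r)\<^sup>*" using rtrancl_mono by blast
qed

lemma reach_G_verts: "(v, w) \<in> (child_rel G r)\<^sup>* \<Longrightarrow> v \<in> verts G \<Longrightarrow> v \<noteq> r \<Longrightarrow> w \<in> verts G \<and> w \<noteq> r"
  by (induction rule: rtrancl_induct) (use child_rel_G in auto)

lemma reach_H_verts: "(v, w) \<in> (child_rel H s)\<^sup>* \<Longrightarrow> v \<in> verts H \<Longrightarrow> w \<in> verts H"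
  by (induction rule: rtrancl_induct) (use child_rel_H in auto)

lemma edge_not_in_H: "e \<in> edges G \<Longrightarrow> \<not> e \<subseteq> verts H"
  and edge_not_in_G: "e \<in> edges H \<Longrightarrow> \<not> e \<subseteq> verts G"
proof -
  have no: False if "card e = 2" "e \<subseteq> verts G" "e \<subseteq> verts H" for e
  proof -
    have "e = {}" using that disj by auto
    with that(1) show False by simp
  qed
  show "\<not> e \<subseteq> verts H" if "e \<in> edges G"
    using no[of e] sG that by (auto simp: simple_graph_def)
  show "\<not> e \<subseteq> verts G" if "e \<in> edges H"
    using no[of e] sH that by (auto simp: simple_graph_def)
qed

lemma subtree_link_G:
  assumes "v \<in> verts G" "v \<noteq> r"
  shows "subtree L r v = subtree G r v"
proof -
  let ?W = "{w. (v, w) \<in> (child_rel G r)\<^sup>*}"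
  have W: "?W \<subseteq> verts G" using reach_G_verts assms by blast
  have "\<not> {r, s} \<subseteq> verts G" using s disj by auto
  then have "{e \<in> edges L. e \<subseteq> ?W} = {e \<in> edges G. e \<subseteq> ?W}"
    using W edge_not_in_G by auto
  moreover have "verts L \<inter> ?W = verts G \<inter> ?W" using W by auto
  ultimately show ?thesis
    unfolding subtree_def induced_def reach_G_iff[OF assms] by simp
qed

lemma subtree_link_H:
  assumes "v \<in> verts H"
  shows "subtree L r v = subtree H s v"
proof -
  let ?W = "{w. (v, w) \<in> (child_rel H s)\<^sup>*}"
  have W: "?W \<subseteq> verts H" using reach_H_verts assms by blast
  have "\<not> {r, s} \<subseteq> verts H" using r disj by auto
  then have "{e \<in> edges L. e \<subseteq> ?W} = {e \<in> edges H. e \<subseteq> ?W}"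
    using W edge_not_in_H by auto
  moreover have "verts L \<inter> ?W = verts H \<inter> ?W" using W by auto
  ultimately show ?thesis
    unfolding subtree_def induced_def reach_H_iff[OF assms] by simp
qed

lemma subtree_link_s: "subtree L r s = H"
  using subtree_link_H[OF s] subtree_root[OF cH s sH] by simp

end

lemma linkedI:
  "rep G r M \<Longrightarrow> rep H s N \<Longrightarrow> verts G \<inter> verts H = {} \<Longrightarrow> linked G r H s"
  using rep_simple[of G r M] rep_simple[of H s N] rep_connected[of G r M] rep_connected[of H s N]
  by (simp add: linked_def)

lemma rep_vdegree_children:
  "rep G r M \<Longrightarrow> v \<in> verts G \<Longrightarrow>
   vdegree G v = (if v = r then card (children G r r) else Suc (card (children G r v)))"
proof (induction arbitrary: v rule: rep.induct)
  case (single r k)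
  then show ?case by (simp add: vdegree_def children_def child_rel_def adj_def)
next
  case (link G r M H s N)
  interpret linked G r H s by (rule linkedI[OF link.hyps])
  have fin: "finite (children G r r)" using children_G_verts sG by (auto simp: simple_graph_def intro: finite_subset)
  have sC: "s \<notin> children G r r" using children_G_verts s disj by blast
  consider "v = r" | "v \<in> verts G" "v \<noteq> r" | "v \<in> verts H" using link.prems by auto
  then show ?case
  proof cases
    case 1
    then show ?thesis
      using link.IH(1)[OF r] vdegree_link[OF sG sH r s disj r] fin sC by (simp add: children_link_root)
  next
    case 2
    then show ?thesis
      using link.IH(1)[of v] vdegree_link[OF sG sH r s disj, of v] by (simp add: children_link_G)
  next
    case 3
    then have "v \<noteq> r" using r disj by auto
    then show ?thesis
      using 3 link.IH(2)[OF 3] link.IH(2)[OF s] vdegree_link'[OF sG sH r s disj 3] by (simp add: children_link_H)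
  qed
qed

text \<open>\<open>rep\<close> attaches one branch at a time, whereas the greedy conditions concern
  all children of a vertex at once. Here \<open>\<tau>\<close> assigns to each child its own
  sub-branches, \<open>k\<close> counts the empty slots, and the last clause makes the rooted
  notions of \<open>G\<close> agree with those of the subtrees.\<close>

definition decomposes :: "'a ugraph \<Rightarrow> 'a \<Rightarrow> stree multiset \<Rightarrow> ('a \<Rightarrow> stree multiset) \<Rightarrow> nat \<Rightarrow> bool" where
  "decomposes G r M \<tau> k \<longleftrightarrow>
     finite (children G r r) \<and>
     M = image_mset (\<lambda>u. Node (\<tau> u)) (mset_set (children G r r)) + replicate_mset k Vacant \<and>
     verts G = insert r (\<Union>u\<in>children G r r. verts (subtree G r u)) \<and>
     (\<forall>u\<in>children G r r. rep (subtree G r u) u (\<tau> u) \<and> (\<forall>v\<in>verts (subtree G r u).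
        v \<noteq> r \<and> gdist G r v = Suc (gdist (subtree G r u) u v) \<and>
        children G r v = children (subtree G r u) u v \<and>
        subtree G r v = subtree (subtree G r u) u v))"

lemma rep_decomposes: "rep G r M \<Longrightarrow> \<exists>\<tau> k. decomposes G r M \<tau> k"
proof (induction rule: rep.induct)
  case (single r k)
  have "children (singleton_graph r) r r = {}" by (simp add: children_def child_rel_def adj_def)
  then show ?case by (intro exI[of _ undefined] exI[of _ k]) (simp add: decomposes_def)
next
  case (link G r M H s N)
  interpret linked G r H s by (rule linkedI[OF link.hyps])
  let ?C = "children G r r"
  obtain \<tau> k where "decomposes G r M \<tau> k" using link.IH(1) by blast
  then have fin: "finite ?C"
    and M: "M = image_mset (\<lambda>u. Node (\<tau> u)) (mset_set ?C) + replicate_mset k Vacant"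
    and V: "verts G = insert r (\<Union>u\<in>?C. verts (subtree G r u))"
    and sub: "\<And>u. u \<in> ?C \<Longrightarrow> rep (subtree G r u) u (\<tau> u)"
      "\<And>u v. u \<in> ?C \<Longrightarrow> v \<in> verts (subtree G r u) \<Longrightarrow>
        v \<noteq> r \<and> gdist G r v = Suc (gdist (subtree G r u) u v) \<and>
        children G r v = children (subtree G r u) u v \<and>
        subtree G r v = subtree (subtree G r u) u v"
    unfolding decomposes_def by blast+
  have sC: "s \<notin> ?C" using children_G_verts s disj by blast
  have CL: "children L r r = insert s ?C" by (rule children_link_root)
  have subC: "subtree L r u = subtree G r u" if "u \<in> ?C" for u
    using subtree_link_G[of u] children_G_verts that by blast
  let ?\<tau> = "\<tau>(s := N)"
  have "image_mset (\<lambda>u. Node (?\<tau> u)) (mset_set ?C) = image_mset (\<lambda>u. Node (\<tau> u)) (mset_set ?C)"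
    using sC fin by (intro image_mset_cong) auto
  then have M': "add_mset (Node N) M =
      image_mset (\<lambda>u. Node (?\<tau> u)) (mset_set (children L r r)) + replicate_mset k Vacant"
    using sC fin by (simp add: CL M)
  have V': "verts L = insert r (\<Union>u\<in>children L r r. verts (subtree L r u))"
    using V subC by (simp add: CL subtree_link_s Un_commute)
  have "rep (subtree L r u) u (?\<tau> u) \<and> (\<forall>v\<in>verts (subtree L r u).
        v \<noteq> r \<and> gdist L r v = Suc (gdist (subtree L r u) u v) \<and>
        children L r v = children (subtree L r u) u v \<and>
        subtree L r v = subtree (subtree L r u) u v)" if u: "u \<in> children L r r" for u
  proof (cases "u = s")
    case True
    have "v \<noteq> r \<and> gdist L r v = Suc (gdist H s v) \<and> children L r v = children H s v \<and>
        subtree L r v = subtree H s v" if "v \<in> verts H" for v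
      using gdist_link[of v] that r disj children_link_H[OF that] subtree_link_H[OF that] by auto
    then show ?thesis using True link.hyps(2) by (simp add: subtree_link_s)
  next
    case False
    then have uC: "u \<in> ?C" using u CL by simp
    have "v \<noteq> r \<and> gdist L r v = Suc (gdist (subtree G r u) u v) \<and>
        children L r v = children (subtree G r u) u v \<and>
        subtree L r v = subtree (subtree G r u) u v" if v: "v \<in> verts (subtree G r u)" for v
    proof -
      note S = sub(2)[OF uC v]
      have "v \<in> verts G" using V uC v by blast
      then show ?thesis using S gdist_link[of v] children_link_G[of v] subtree_link_G[of v] by simp
    qed
    then show ?thesis using False sub(1)[OF uC] subC[OF uC] by simp
  qed
  then have "decomposes L r (add_mset (Node N) M) ?\<tau> k"
    using M' V' fin unfolding decomposes_def CL by blast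
  then show ?case by blast
qed

text \<open>A vertex farthest from the root has no children; so a condition on all leaves is never
  vacuous.\<close>

lemma rep_childless_vertex:
  assumes "rep G r M"
  shows "\<exists>v\<in>verts G. children G r v = {}"
proof -
  have fin: "finite (verts G)" "r \<in> verts G" using rep_simple[OF assms] by (auto simp: simple_graph_def)
  then have "Max (gdist G r ` verts G) \<in> gdist G r ` verts G" by (intro Max_in) auto
  then obtain v where v: "v \<in> verts G" "gdist G r v = Max (gdist G r ` verts G)" by auto
  have "u \<notin> children G r v" for u
  proof
    assume "u \<in> children G r v"
    then have u: "(v, u) \<in> adj G" "gdist G r u = gdist G r v + 1"
      by (auto simp: children_def child_rel_def)
    then have "u \<in> verts G" using adj_verts[of G v u] rep_simple[OF assms] by simp
    then have "gdist G r u \<le> gdist G r v" using fin v(2) by simp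
    with u(2) show False by simp
  qed
  with v(1) show ?thesis by blast
qed

lemma full_tree_eq_Node:
  assumes "1 \<le> d"
  shows "full_tree d h = Node (replicate_mset d (full_tree d j)) \<Longrightarrow> h = Suc j"
  using strict_mono_eq[OF nodes_full_strict_mono[OF assms], of h "Suc j"] by simp

lemma decomposes_members:
  assumes "decomposes G r M \<tau> k"
  shows "t \<in># M \<longleftrightarrow> (\<exists>u\<in>children G r r. t = Node (\<tau> u)) \<or> (0 < k \<and> t = Vacant)"
    "size M = card (children G r r) + k"
  using assms by (auto simp: decomposes_def)

definition dary_leaves :: "nat \<Rightarrow> nat \<Rightarrow> 'a ugraph \<Rightarrow> 'a \<Rightarrow> bool" where
  "dary_leaves d h G r \<longleftrightarrow>
     (\<forall>v\<in>verts G. card (children G r v) = 0 \<or> card (children G r v) = d) \<and>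
     (\<forall>v\<in>verts G. children G r v = {} \<longrightarrow> gdist G r v = h - 1)"

lemma dary_leaves_decomposes:
  assumes dec: "decomposes G r M \<tau> k" and ne: "children G r r \<noteq> {}" and h: "1 \<le> h"
  shows "dary_leaves d h G r \<longleftrightarrow> card (children G r r) = d \<and>
    (\<exists>h'. h = Suc h' \<and> 1 \<le> h' \<and> (\<forall>u\<in>children G r r. dary_leaves d h' (subtree G r u) u))"
proof -
  let ?C = "children G r r"
  have V: "verts G = insert r (\<Union>u\<in>?C. verts (subtree G r u))"
    and sub: "\<And>u v. u \<in> ?C \<Longrightarrow> v \<in> verts (subtree G r u) \<Longrightarrow>
        gdist G r v = Suc (gdist (subtree G r u) u v) \<and>
        children G r v = children (subtree G r u) u v"
    and rep: "\<And>u. u \<in> ?C \<Longrightarrow> rep (subtree G r u) u (\<tau> u)"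
    and fin: "finite ?C"
    using dec unfolding decomposes_def by blast+
  have card0: "card ?C \<noteq> 0" using ne fin by simp
  have eq: "dary_leaves d h G r \<longleftrightarrow> card ?C = d \<and> (\<forall>u\<in>?C.
      (\<forall>v\<in>verts (subtree G r u). card (children (subtree G r u) u v) = 0 \<or> card (children (subtree G r u) u v) = d) \<and>
      (\<forall>v\<in>verts (subtree G r u). children (subtree G r u) u v = {} \<longrightarrow> Suc (gdist (subtree G r u) u v) = h - 1))"
    unfolding dary_leaves_def V using sub card0 ne by (simp add: ball_UN ball_conj_distrib cong: ball_cong)
  show ?thesis
  proof
    assume L: "dary_leaves d h G r"
    obtain u where u: "u \<in> ?C" using ne by blast
    obtain v where v: "v \<in> verts (subtree G r u)" "children (subtree G r u) u v = {}"
      using rep_childless_vertex[OF rep[OF u]] by blast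
    \<comment> \<open>A leaf below the root has positive distance, which rules out
      \<open>h = 1\<close> and the truncated subtraction in \<open>dary_leaves\<close>.\<close>
    then have "Suc (gdist (subtree G r u) u v) = h - 1" using L u unfolding eq by blast
    then obtain h' where h': "h = Suc h'" "1 \<le> h'" by (cases h) auto
    then have "\<forall>u\<in>?C. dary_leaves d h' (subtree G r u) u"
      using L[unfolded eq] h' unfolding dary_leaves_def by (metis diff_Suc_1)
    with L h' show "card ?C = d \<and> (\<exists>h'. h = Suc h' \<and> 1 \<le> h' \<and> (\<forall>u\<in>?C. dary_leaves d h' (subtree G r u) u))"
      unfolding eq by blast
  next
    assume "card ?C = d \<and> (\<exists>h'. h = Suc h' \<and> 1 \<le> h' \<and> (\<forall>u\<in>?C. dary_leaves d h' (subtree G r u) u))"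
    then show "dary_leaves d h G r" unfolding eq by (auto simp: dary_leaves_def)
  qed
qed

lemma rep_dary_leaves:
  assumes d: "1 \<le> d"
  shows "rep G r M \<Longrightarrow> regular d (Node M) \<Longrightarrow> 1 \<le> h \<Longrightarrow>
    dary_leaves d h G r \<longleftrightarrow> Node M = full_tree d h"
proof (induction h arbitrary: G r M)
  case (Suc h)
  obtain \<tau> k where dec: "decomposes G r M \<tau> k" using rep_decomposes[OF Suc.prems(1)] by blast
  let ?C = "children G r r"
  have V: "verts G = insert r (\<Union>u\<in>?C. verts (subtree G r u))"
    and rep: "\<And>u. u \<in> ?C \<Longrightarrow> rep (subtree G r u) u (\<tau> u)"
    and fin: "finite ?C"
    using dec unfolding decomposes_def by blast+
  have sz: "size M = d" and regM: "\<And>t. t \<in># M \<Longrightarrow> regular d t" using Suc.prems(2) by auto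
  have reg: "\<And>u. u \<in> ?C \<Longrightarrow> regular d (Node (\<tau> u))"
    using regM decomposes_members(1)[OF dec] by blast
  show ?case
  proof (cases "?C = {}")
    case True
    then have "M = replicate_mset d Vacant"
      using dec sz by (auto simp: decomposes_def)
    moreover have "dary_leaves d (Suc h) G r \<longleftrightarrow> h = 0"
      using True V by (simp add: dary_leaves_def)
    moreover have "full_tree d (Suc h) = Node (replicate_mset d (full_tree d 0)) \<Longrightarrow> Suc h = Suc 0"
      by (rule full_tree_eq_Node[OF d])
    ultimately show ?thesis by auto
  next
    case False
    have "dary_leaves d (Suc h) G r \<longleftrightarrow> card ?C = d \<and> 1 \<le> h \<and>
        (\<forall>u\<in>?C. dary_leaves d h (subtree G r u) u)"
      using dary_leaves_decomposes[OF dec False Suc.prems(3), of d] by auto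
    also have "\<dots> \<longleftrightarrow> card ?C = d \<and> 1 \<le> h \<and> (\<forall>u\<in>?C. Node (\<tau> u) = full_tree d h)"
      using Suc.IH[OF rep reg] by auto
    also have "\<dots> \<longleftrightarrow> (\<forall>t\<in>#M. t = full_tree d h)"
    proof
      assume "card ?C = d \<and> 1 \<le> h \<and> (\<forall>u\<in>?C. Node (\<tau> u) = full_tree d h)"
      then show "\<forall>t\<in>#M. t = full_tree d h" using decomposes_members[OF dec] sz by auto
    next
      assume all: "\<forall>t\<in>#M. t = full_tree d h"
      then have C: "\<forall>u\<in>?C. Node (\<tau> u) = full_tree d h" using decomposes_members[OF dec] by blast
      then have "h \<noteq> 0" using False by (cases h) auto
      then have "full_tree d h \<noteq> Vacant" by (cases h) auto
      then have "Vacant \<notin># M" using all by auto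
      then have "k = 0" using decomposes_members(1)[OF dec] by auto
      then show "card ?C = d \<and> 1 \<le> h \<and> (\<forall>u\<in>?C. Node (\<tau> u) = full_tree d h)"
        using C \<open>h \<noteq> 0\<close> sz decomposes_members(2)[OF dec] by simp
    qed
    also have "\<dots> \<longleftrightarrow> Node M = full_tree d (Suc h)"
    proof
      assume "\<forall>t\<in>#M. t = full_tree d h"
      then have "M = replicate_mset d (full_tree d h)"
        using mset_all_eq_replicate[OF _ sz] by blast
      then show "Node M = full_tree d (Suc h)" by (simp only: full_tree.simps)
    next
      assume "Node M = full_tree d (Suc h)"
      then have rM: "M = replicate_mset d (full_tree d h)" by simp
      show "\<forall>t\<in>#M. t = full_tree d h" unfolding rM Ball_def in_replicate_mset by blast
    qed
    finally show ?thesis .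
  qed
qed simp

lemma rep_complete_dary:
  assumes "1 \<le> d" "rep G r M" "regular d (Node M)"
  shows "complete_dary d h G r \<longleftrightarrow> 1 \<le> h \<and> Node M = full_tree d h"
  using rep_dary_leaves[OF assms] rep_tree[OF assms(2)] rep_simple[OF assms(2)]
  unfolding complete_dary_def rooted_dary_def dary_leaves_def by blast

definition incomplete_children :: "nat \<Rightarrow> 'a ugraph \<Rightarrow> 'a \<Rightarrow> 'a \<Rightarrow> 'a set" where
  "incomplete_children d G r v = {u \<in> children G r v. \<not> (\<exists>h. complete_dary d h (subtree G r u) u)}"

text \<open>The graph form of \<open>greedy d k\<close>. Filling \<open>k\<close> levels means that
  vertices at distance at most \<open>k - 2\<close> have all \<open>d\<close> children; distance
  \<open>k\<close> is the partly filled level.\<close>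

definition level_filled :: "nat \<Rightarrow> nat \<Rightarrow> 'a ugraph \<Rightarrow> 'a \<Rightarrow> bool" where
  "level_filled d k G r \<longleftrightarrow> (\<forall>v\<in>verts G. gdist G r v \<le> k \<and>
     (gdist G r v + 2 \<le> k \<longrightarrow> card (children G r v) = d) \<and>
     card (incomplete_children d G r v) \<le> 1)"

lemma greedy_full_tree:
  assumes d: "1 \<le> d" and "greedy d k (full_tree d h)"
  shows "h = k \<or> h = Suc k"
proof -
  have "nodes (full_tree d k) \<le> nodes (full_tree d h)" "nodes (full_tree d h) \<le> nodes (full_tree d (Suc k))"
    using greedy_nodes[OF assms] by blast+
  then have "k \<le> h" "h \<le> Suc k"
    using strict_mono_less_eq[OF nodes_full_strict_mono[OF d]] by blast+
  then show ?thesis by auto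
qed

text \<open>A complete tree that satisfies \<open>greedy d k\<close> has height \<open>k\<close> or
  \<open>Suc k\<close>, so completeness of any height amounts to being one of these two. Empty slots
  occur only for \<open>k = 0\<close>, where they are complete.\<close>

lemma decomposes_almost_complete:
  assumes d: "1 \<le> d" and dec: "decomposes G r M \<tau> j"
    and reg: "\<And>t. t \<in># M \<Longrightarrow> regular d t" and greedy: "\<And>t. t \<in># M \<Longrightarrow> greedy d k t"
  shows "almost_complete d k M \<longleftrightarrow> card (incomplete_children d G r r) \<le> 1"
proof -
  let ?C = "children G r r"
  let ?P = "\<lambda>t. t \<noteq> full_tree d k \<and> t \<noteq> full_tree d (Suc k)"
  have fin: "finite ?C"
    and M: "M = image_mset (\<lambda>u. Node (\<tau> u)) (mset_set ?C) + replicate_mset j Vacant"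
    and rep: "\<And>u. u \<in> ?C \<Longrightarrow> rep (subtree G r u) u (\<tau> u)"
    using dec unfolding decomposes_def by blast+
  have "?P (Node (\<tau> u)) \<longleftrightarrow> \<not> (\<exists>h. complete_dary d h (subtree G r u) u)" if u: "u \<in> ?C" for u
  proof -
    have mem: "Node (\<tau> u) \<in># M" using decomposes_members(1)[OF dec] u by blast
    have "(\<exists>h. complete_dary d h (subtree G r u) u) \<longleftrightarrow> (\<exists>h. 1 \<le> h \<and> Node (\<tau> u) = full_tree d h)"
      using rep_complete_dary[OF d rep[OF u] reg[OF mem]] by blast
    also have "\<dots> \<longleftrightarrow> \<not> ?P (Node (\<tau> u))"
    proof
      assume "\<exists>h. 1 \<le> h \<and> Node (\<tau> u) = full_tree d h"
      then show "\<not> ?P (Node (\<tau> u))" using greedy[OF mem] greedy_full_tree[OF d] by metis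
    next
      assume "\<not> ?P (Node (\<tau> u))"
      then obtain h where h: "Node (\<tau> u) = full_tree d h" by blast
      then have "1 \<le> h" by (cases h) auto
      with h show "\<exists>h. 1 \<le> h \<and> Node (\<tau> u) = full_tree d h" by blast
    qed
    finally show ?thesis by blast
  qed
  then have C: "{u \<in> ?C. ?P (Node (\<tau> u))} = incomplete_children d G r r"
    unfolding incomplete_children_def by blast
  have "\<not> ?P Vacant" if "0 < j"
  proof -
    have "greedy d k Vacant" using greedy decomposes_members(1)[OF dec] that by blast
    then have "k = 0" by (cases k) auto
    then show ?thesis by simp
  qed
  then have "filter_mset ?P (replicate_mset j Vacant) = {#}"
    by (cases "j = 0") (auto simp: filter_mset_eq_conv in_replicate_mset)
  then have "filter_mset ?P M = image_mset (\<lambda>u. Node (\<tau> u)) (mset_set {u \<in> ?C. ?P (Node (\<tau> u))})"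
    using fin by (simp add: M filter_mset_image_mset)
  then have "size (filter_mset ?P M) = card (incomplete_children d G r r)"
    using C by (simp only: size_image_mset size_mset_set)
  then show ?thesis by (simp add: almost_complete_def)
qed

lemma decomposes_incomplete:
  assumes dec: "decomposes G r M \<tau> k" and u: "u \<in> children G r r" and v: "v \<in> verts (subtree G r u)"
  shows "incomplete_children d (subtree G r u) u v = incomplete_children d G r v"
proof -
  have rep: "rep (subtree G r u) u (\<tau> u)" and ch: "children G r v = children (subtree G r u) u v"
    and st: "\<And>w. w \<in> verts (subtree G r u) \<Longrightarrow> subtree G r w = subtree (subtree G r u) u w"
    using dec u v unfolding decomposes_def by blast+
  have "subtree G r w = subtree (subtree G r u) u w" if "w \<in> children (subtree G r u) u v" for w
    using st children_verts[OF conjunct1[OF rep_simple[OF rep]] that] by blast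
  then show ?thesis
    unfolding incomplete_children_def ch by (intro Collect_cong conj_cong refl) simp
qed

lemma level_filled_decomposes:
  assumes dec: "decomposes G r M \<tau> j"
  shows "level_filled d (Suc k) G r \<longleftrightarrow>
    (1 \<le> k \<longrightarrow> card (children G r r) = d) \<and> card (incomplete_children d G r r) \<le> 1 \<and>
    (\<forall>u\<in>children G r r. level_filled d k (subtree G r u) u)"
proof -
  let ?C = "children G r r"
  have V: "verts G = insert r (\<Union>u\<in>?C. verts (subtree G r u))"
    and sub: "\<And>u v. u \<in> ?C \<Longrightarrow> v \<in> verts (subtree G r u) \<Longrightarrow>
        gdist G r v = Suc (gdist (subtree G r u) u v) \<and>
        children G r v = children (subtree G r u) u v"
    using dec unfolding decomposes_def by blast+
  let ?ok = "\<lambda>k G r v. gdist G r v \<le> k \<and>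
     (gdist G r v + 2 \<le> k \<longrightarrow> card (children G r v) = d) \<and> card (incomplete_children d G r v) \<le> 1"
  have "?ok (Suc k) G r r \<longleftrightarrow> (1 \<le> k \<longrightarrow> card ?C = d) \<and> card (incomplete_children d G r r) \<le> 1"
    by auto
  moreover have "?ok (Suc k) G r v \<longleftrightarrow> ?ok k (subtree G r u) u v"
    if "u \<in> ?C" "v \<in> verts (subtree G r u)" for u v
    using sub[OF that] decomposes_incomplete[OF dec that, of d] by simp
  then have "(\<forall>u\<in>?C. \<forall>v\<in>verts (subtree G r u). ?ok (Suc k) G r v) \<longleftrightarrow>
      (\<forall>u\<in>?C. \<forall>v\<in>verts (subtree G r u). ?ok k (subtree G r u) u v)" by blast
  moreover have "level_filled d (Suc k) G r \<longleftrightarrow>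
      ?ok (Suc k) G r r \<and> (\<forall>u\<in>?C. \<forall>v\<in>verts (subtree G r u). ?ok (Suc k) G r v)"
    unfolding level_filled_def by (subst V) (simp only: ball_simps ball_UN)
  ultimately show ?thesis unfolding level_filled_def[of d k] by simp
qed

lemma rep_level_filled:
  assumes d: "1 \<le> d"
  shows "rep G r M \<Longrightarrow> regular d (Node M) \<Longrightarrow> level_filled d k G r \<longleftrightarrow> greedy d k (Node M)"
proof (induction k arbitrary: G r M)
  case 0
  obtain \<tau> k where dec: "decomposes G r M \<tau> k" using rep_decomposes[OF 0(1)] by blast
  let ?C = "children G r r"
  have V: "verts G = insert r (\<Union>u\<in>?C. verts (subtree G r u))"
    and rep: "\<And>u. u \<in> ?C \<Longrightarrow> rep (subtree G r u) u (\<tau> u)"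
    and sub: "\<And>u v. u \<in> ?C \<Longrightarrow> v \<in> verts (subtree G r u) \<Longrightarrow> gdist G r v = Suc (gdist (subtree G r u) u v)"
    and fin: "finite ?C"
    using dec unfolding decomposes_def by blast+
  have "?C = {} \<longleftrightarrow> M = replicate_mset d Vacant"
  proof
    assume "?C = {}"
    then show "M = replicate_mset d Vacant" using dec 0(2) by (auto simp: decomposes_def)
  next
    assume "M = replicate_mset d Vacant"
    then have "Node (\<tau> u) \<notin># M" for u by (simp add: in_replicate_mset)
    then show "?C = {}" using decomposes_members(1)[OF dec] by blast
  qed
  moreover have "level_filled d 0 G r \<longleftrightarrow> ?C = {}"
  proof
    assume L: "level_filled d 0 G r"
    have "u \<notin> ?C" for u
    proof
      assume u: "u \<in> ?C"
      then have "u \<in> verts (subtree G r u)" using rep_simple[OF rep[OF u]] by blast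
      then have "gdist G r u \<noteq> 0" "u \<in> verts G" using sub[OF u] V u by auto
      then show False using L by (simp add: level_filled_def)
    qed
    then show "?C = {}" by blast
  next
    assume "?C = {}"
    then show "level_filled d 0 G r"
      using V by (simp add: level_filled_def incomplete_children_def)
  qed
  ultimately show ?case by simp
next
  case (Suc k)
  obtain \<tau> j where dec: "decomposes G r M \<tau> j" using rep_decomposes[OF Suc.prems(1)] by blast
  let ?C = "children G r r"
  have rep: "\<And>u. u \<in> ?C \<Longrightarrow> rep (subtree G r u) u (\<tau> u)"
    using dec unfolding decomposes_def by blast
  have sz: "size M = d" and regM: "\<And>t. t \<in># M \<Longrightarrow> regular d t" using Suc.prems(2) by auto
  have reg: "\<And>u. u \<in> ?C \<Longrightarrow> regular d (Node (\<tau> u))"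
    using regM decomposes_members(1)[OF dec] by blast
  have IH: "level_filled d k (subtree G r u) u \<longleftrightarrow> greedy d k (Node (\<tau> u))" if "u \<in> ?C" for u
    using Suc.IH[OF rep[OF that] reg[OF that]] .
  have members: "(\<forall>t\<in>#M. greedy d k t) \<longleftrightarrow>
      (1 \<le> k \<longrightarrow> card ?C = d) \<and> (\<forall>u\<in>?C. greedy d k (Node (\<tau> u)))"
  proof -
    have "greedy d k Vacant \<longleftrightarrow> k = 0" by (cases k) auto
    then have "(\<forall>t\<in>#M. greedy d k t) \<longleftrightarrow> (\<forall>u\<in>?C. greedy d k (Node (\<tau> u))) \<and> (0 < j \<longrightarrow> k = 0)"
      using decomposes_members(1)[OF dec] by auto
    also have "(0 < j \<longrightarrow> k = 0) \<longleftrightarrow> (1 \<le> k \<longrightarrow> card ?C = d)"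
      using decomposes_members(2)[OF dec] sz by auto
    finally show ?thesis by blast
  qed
  have "level_filled d (Suc k) G r \<longleftrightarrow>
      (\<forall>t\<in>#M. greedy d k t) \<and> card (incomplete_children d G r r) \<le> 1"
    unfolding level_filled_decomposes[OF dec] members using IH by blast
  also have "\<dots> \<longleftrightarrow> (\<forall>t\<in>#M. greedy d k t) \<and> almost_complete d k M"
    using decomposes_almost_complete[OF d dec regM, of k] by blast
  finally show ?case using sz by auto
qed

theorem rep_greedy_tree_rooted:
  assumes d: "1 \<le> d" and rep: "rep G r M" and reg: "root_regular d M"
  shows "greedy_tree_rooted n d G r \<longleftrightarrow> nodes (Node M) = n \<and> (\<exists>k. greedy_root d k M)"
proof -
  obtain \<tau> j where dec: "decomposes G r M \<tau> j" using rep_decomposes[OF rep] by blast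
  let ?C = "children G r r"
  have V: "verts G = insert r (\<Union>u\<in>?C. verts (subtree G r u))"
    and repC: "\<And>u. u \<in> ?C \<Longrightarrow> rep (subtree G r u) u (\<tau> u)"
    and sub: "\<And>u v. u \<in> ?C \<Longrightarrow> v \<in> verts (subtree G r u) \<Longrightarrow> v \<noteq> r \<and>
        gdist G r v = Suc (gdist (subtree G r u) u v) \<and>
        children G r v = children (subtree G r u) u v"
    using dec unfolding decomposes_def by blast+
  have fin: "finite (verts G)" and r: "r \<in> verts G" using rep_simple[OF rep] by (auto simp: simple_graph_def)
  have sz: "size M = Suc d" and regM: "\<And>t. t \<in># M \<Longrightarrow> regular d t" using reg by (auto simp: root_regular_def)
  have lf: "level_filled d k (subtree G r u) u \<longleftrightarrow> greedy d k (Node (\<tau> u))" if "u \<in> ?C" for u k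
    using rep_level_filled[OF d repC[OF that]] regM decomposes_members(1)[OF dec] that by blast
  have degr: "vdegree G r = card ?C" using rep_vdegree_children[OF rep r] by simp
  have deg: "vdegree G v = Suc (card (children G r v))" if "v \<in> verts G" "v \<noteq> r" for v
    using rep_vdegree_children[OF rep that(1)] that(2) by simp
  have vac: "Vacant \<notin># M \<longleftrightarrow> card ?C = Suc d"
    using decomposes_members[OF dec] sz by auto
  show ?thesis
  proof
    assume gt: "greedy_tree_rooted n d G r"
    then have n: "card (verts G) = n" and dr: "vdegree G r = Suc d"
      and inc: "\<And>v. v \<in> verts G \<Longrightarrow> card (incomplete_children d G r v) \<le> 1"
      and full: "\<And>v w. v \<in> verts G \<Longrightarrow> w \<in> verts G \<Longrightarrow> gdist G r v + 2 \<le> gdist G r w \<Longrightarrow> vdegree G v = Suc d"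
      by (auto simp: greedy_tree_rooted_def incomplete_children_def)
    have C: "card ?C = Suc d" using dr degr by simp
    \<comment> \<open>The height of the whole tree; branches lie one level deeper, so their
      parameter is \<open>H - 1\<close>.\<close>
    define H where "H = Max (gdist G r ` verts G)"
    have H: "gdist G r v \<le> H" if "v \<in> verts G" for v using that fin by (simp add: H_def)
    have "H \<in> gdist G r ` verts G" unfolding H_def using fin r by (intro Max_in) auto
    then obtain w where w: "w \<in> verts G" "gdist G r w = H" by auto
    obtain u where u: "u \<in> ?C" using C by (cases "?C = {}") auto
    then have "u \<in> verts (subtree G r u)" using rep_simple[OF repC[OF u]] by blast
    then have "gdist G r u \<noteq> 0" "u \<in> verts G" using sub[OF u] V u by auto
    then obtain k where k: "H = Suc k" using H[of u] by (cases H) auto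
    have "level_filled d k (subtree G r u) u" if u: "u \<in> ?C" for u
      unfolding level_filled_def
    proof
      fix v assume v: "v \<in> verts (subtree G r u)"
      note S = sub[OF u v]
      have vG: "v \<in> verts G" using V u v by auto
      have "incomplete_children d (subtree G r u) u v = incomplete_children d G r v"
        by (rule decomposes_incomplete[OF dec u v])
      then have "card (incomplete_children d (subtree G r u) u v) \<le> 1" using inc[OF vG] by simp
      moreover have "gdist (subtree G r u) u v \<le> k" using H[OF vG] S k by simp
      moreover have "card (children (subtree G r u) u v) = d" if "gdist (subtree G r u) u v + 2 \<le> k"
        using full[OF vG w(1)] that S w(2) k deg[OF vG] by simp
      ultimately show "gdist (subtree G r u) u v \<le> k \<and>
          (gdist (subtree G r u) u v + 2 \<le> k \<longrightarrow> card (children (subtree G r u) u v) = d) \<and>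
          card (incomplete_children d (subtree G r u) u v) \<le> 1" by blast
    qed
    then have "\<forall>u\<in>?C. greedy d k (Node (\<tau> u))" using lf by blast
    then have gM: "greedy d k t" if "t \<in># M" for t
      using that vac C decomposes_members(1)[OF dec, of t] by auto
    have "almost_complete d k M"
      using decomposes_almost_complete[OF d dec regM gM] inc[OF r] by blast
    then have "greedy_root d k M" using sz vac C gM by (simp add: greedy_root_def)
    then show "nodes (Node M) = n \<and> (\<exists>k. greedy_root d k M)" using rep_card[OF rep] n by auto
  next
    assume "nodes (Node M) = n \<and> (\<exists>k. greedy_root d k M)"
    then obtain k where n: "nodes (Node M) = n" and gr: "greedy_root d k M" by blast
    have C: "card ?C = Suc d" and gM: "\<And>t. t \<in># M \<Longrightarrow> greedy d k t" and ac: "almost_complete d k M"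
      using gr vac by (auto simp: greedy_root_def)
    have lfC: "level_filled d k (subtree G r u) u" if "u \<in> ?C" for u
      using lf[OF that] gM decomposes_members(1)[OF dec] that by blast
    have inc_r: "card (incomplete_children d G r r) \<le> 1"
      using decomposes_almost_complete[OF d dec regM gM] ac by blast
    have props: "gdist G r v \<le> Suc k \<and> (gdist G r v + 2 \<le> Suc k \<longrightarrow> vdegree G v = Suc d) \<and>
        card (incomplete_children d G r v) \<le> 1" if v: "v \<in> verts G" for v
    proof (cases "v = r")
      case True
      then show ?thesis using inc_r degr C by simp
    next
      case False
      then obtain u where u: "u \<in> ?C" "v \<in> verts (subtree G r u)" using V v by auto
      note S = sub[OF u]
      have L: "gdist (subtree G r u) u v \<le> k"
        "gdist (subtree G r u) u v + 2 \<le> k \<longrightarrow> card (children (subtree G r u) u v) = d"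
        "card (incomplete_children d (subtree G r u) u v) \<le> 1"
        using lfC[OF u(1)] u(2) by (auto simp: level_filled_def)
      have "incomplete_children d (subtree G r u) u v = incomplete_children d G r v"
        by (rule decomposes_incomplete[OF dec u])
      then show ?thesis using L S deg[OF v False] by simp
    qed
    have degle: "vdegree G v \<le> Suc d" if "v \<in> verts G" for v
      using rep_regular_degree[OF rep] regM that degr C by (cases "v = r") auto
    have "max_degree G = d + 1"
      unfolding max_degree_def
    proof (rule Max_eqI)
      show "d + 1 \<in> vdegree G ` verts G" using r degr C by (intro image_eqI[of _ _ r]) simp_all
    qed (use fin degle in auto)
    \<comment> \<open>A vertex of degree 1 is not among those of degree \<open>d + 1\<close>, which
      is at least 2; so it lies at distance \<open>k\<close> or \<open>Suc k\<close>, the last two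
      levels.\<close>
    moreover have "gdist G r v \<le> gdist G r w + 1"
      if "v \<in> verts G" "w \<in> verts G" "vdegree G w = 1" for v w
      using props[OF that(1)] props[OF that(2)] that(3) d by auto
    moreover have "vdegree G v = d + 1"
      if "v \<in> verts G" "w \<in> verts G" "gdist G r v + 2 \<le> gdist G r w" for v w
      using props[OF that(1)] props[OF that(2)] that(3) by auto
    ultimately show "greedy_tree_rooted n d G r"
      using rep_tree[OF rep] rep_card[OF rep] n r degr C props
      unfolding greedy_tree_rooted_def incomplete_children_def by auto
  qed
qed

section \<open>Brooms and the main theorem\<close>

text \<open>The first vertex \<open>a\<close> is arbitrary because the induction prepends a
  vertex.\<close>

lemma rep_path:
  "rep \<lparr>verts = {a..a + m}, edges = {{i, i + 1} | i. a \<le> i \<and> i < a + m}\<rparr> (a :: nat) (path_kids m)"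
proof (induction m arbitrary: a)
  case 0
  have "\<lparr>verts = {a..a + 0}, edges = {{i, i + 1} | i. a \<le> i \<and> i < a + 0}\<rparr> = singleton_graph a"
    by (intro ugraph.equality) auto
  then show ?case using rep.single[of a 0] by (simp only: replicate_mset_0 path_kids.simps)
next
  case (Suc m)
  let ?P = "\<lparr>verts = {Suc a..Suc a + m}, edges = {{i, i + 1} | i. Suc a \<le> i \<and> i < Suc a + m}\<rparr>"
  have "rep (link (singleton_graph a) a ?P (Suc a)) a (add_mset (Node (path_kids m)) (replicate_mset 0 Vacant))"
    by (intro rep.link rep.single Suc) auto
  moreover have "link (singleton_graph a) a ?P (Suc a) =
      \<lparr>verts = {a..a + Suc m}, edges = {{i, i + 1} | i. a \<le> i \<and> i < a + Suc m}\<rparr>"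
  proof (intro ugraph.equality)
    have "a = i \<or> Suc a \<le> i" if "a \<le> i" for i using that by auto
    then show "edges (link (singleton_graph a) a ?P (Suc a)) =
        edges \<lparr>verts = {a..a + Suc m}, edges = {{i, i + 1} | i. a \<le> i \<and> i < a + Suc m}\<rparr>"
      by fastforce
  qed auto
  ultimately show ?case by simp
qed

lemma rep_star:
  "finite L \<Longrightarrow> rep G r M \<Longrightarrow> L \<inter> verts G = {} \<Longrightarrow>
   rep (graph_union G (star_graph r L)) r (replicate_mset (card L) leaf + M)"
proof (induction L rule: finite_induct)
  case empty
  then have "graph_union G (star_graph r {}) = G"
    using rep_simple[OF empty.prems(1)] by (intro ugraph.equality) (auto simp: star_graph_def)
  then show ?case using empty by simp
next
  case (insert l L)
  have "rep (link (graph_union G (star_graph r L)) r (singleton_graph l) l) r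
      (add_mset (Node (replicate_mset 0 Vacant)) (replicate_mset (card L) leaf + M))"
    using insert rep_simple[OF insert.prems(1)] by (intro rep.link rep.single) (auto simp: star_graph_def)
  moreover have "link (graph_union G (star_graph r L)) r (singleton_graph l) l =
      graph_union G (star_graph r (insert l L))"
    by (intro ugraph.equality) (auto simp: star_graph_def)
  ultimately show ?case using insert by simp
qed

lemma rep_broom: "rep (broom (d + 2 + m) d) 0 (broom_kids d m)"
proof -
  have P: "path_graph (m + 2) = \<lparr>verts = {0..0 + Suc m}, edges = {{i, i + 1} | i. 0 \<le> i \<and> i < 0 + Suc m}\<rparr>"
    by (intro ugraph.equality) (auto simp: path_graph_def)
  have "rep (path_graph (m + 2)) 0 (path_kids (Suc m))"
    unfolding P by (rule rep_path)
  then have "rep (graph_union (path_graph (m + 2)) (star_graph 0 {m + 2..<d + 2 + m})) 0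
      (replicate_mset (card {m + 2..<d + 2 + m}) leaf + path_kids (Suc m))"
    by (rule rep_star[rotated]) (auto simp: path_graph_def)
  then show ?thesis by (simp add: broom_def broom_kids_def add.commute)
qed

lemma max_degree_ge: "finite (verts G) \<Longrightarrow> v \<in> verts G \<Longrightarrow> vdegree G v \<le> max_degree G"
  unfolding max_degree_def by simp

lemma max_degree_attained: "finite (verts G) \<Longrightarrow> verts G \<noteq> {} \<Longrightarrow> \<exists>v\<in>verts G. vdegree G v = max_degree G"
  using Max_in[of "vdegree G ` verts G"] unfolding max_degree_def by (metis finite_imageI image_iff image_is_empty)

lemma tree_rep_bounded:
  assumes "tree T" "max_degree T = d + 1" "r \<in> verts T"
  shows "\<exists>M. rep T r M \<and> (\<forall>t\<in>#M. no_vacant t \<and> branching_le d t) \<and> size M = vdegree T r"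
proof -
  obtain M where M: "rep T r M" "\<forall>t\<in>#M. no_vacant t" using tree_rep[OF assms(1,3)] by blast
  have fin: "finite (verts T)" using rep_simple[OF M(1)] by (simp add: simple_graph_def)
  have "\<forall>v\<in>verts T - {r}. vdegree T v \<le> Suc d" using max_degree_ge[OF fin] assms(2) by fastforce
  then have "\<forall>t\<in>#M. branching_le d t" using rep_branching[OF M] by blast
  moreover have "size M = vdegree T r"
    using rep_degree_root[OF M(1)] size_filter_no_vacant[OF M(2)] by simp
  ultimately show ?thesis using M by blast
qed

lemma tree_rep_regular:
  assumes "tree T" "max_degree T = d + 1" "r \<in> verts T"
  shows "\<exists>M. rep T r M \<and> root_regular d M"
proof -
  obtain M where M: "rep T r M" "\<forall>t\<in>#M. no_vacant t \<and> branching_le d t" "size M = vdegree T r"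
    using tree_rep_bounded[OF assms] by blast
  have "finite (verts T)" using rep_simple[OF M(1)] by (simp add: simple_graph_def)
  then have "size M \<le> Suc d" using max_degree_ge[of T r] assms(2,3) M(3) by simp
  then have "root_regular d (image_mset (pad d) M + replicate_mset (Suc d - size M) Vacant)"
    using M(2) regular_pad by (auto simp: root_regular_def in_replicate_mset)
  then show ?thesis using rep_pad[OF M(1)] by blast
qed

theorem theorem4p3:
  fixes d n :: nat and T :: "'a ugraph"
  assumes "1 \<le> d" and "tree T" and "card (verts T) = n" and "max_degree T = d + 1"
  shows "(\<exists>G :: nat ugraph. greedy_tree n d G) \<and>
    (\<forall>G :: nat ugraph. greedy_tree n d G \<longrightarrow> (\<forall>x :: real. 0 < x \<longrightarrow>
      matching_poly (subdivision G) x \<le> matching_poly (subdivision T) x \<and>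
      matching_poly (subdivision T) x \<le> matching_poly (subdivision (broom n d)) x \<and>
      lap_poly G x \<le> lap_poly T x \<and>
      lap_poly T x \<le> lap_poly (broom n d) x \<and>
      (matching_poly (subdivision T) x = matching_poly (subdivision G) x \<longleftrightarrow> T \<cong>\<^sub>G G) \<and>
      (matching_poly (subdivision T) x = matching_poly (subdivision (broom n d)) x \<longleftrightarrow> T \<cong>\<^sub>G broom n d) \<and>
      (lap_poly T x = lap_poly G x \<longleftrightarrow> T \<cong>\<^sub>G G) \<and>
      (lap_poly T x = lap_poly (broom n d) x \<longleftrightarrow> T \<cong>\<^sub>G broom n d)))"
proof -
  have fin: "finite (verts T)" "verts T \<noteq> {}"
    using assms(2) by (auto simp: tree_def simple_graph_def connected_graph_def)
  obtain r where r: "r \<in> verts T" "vdegree T r = d + 1"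
    using max_degree_attained[OF fin] assms(4) by auto
  \<comment> \<open>Two representations at the same vertex of maximum degree: \<open>B\<close>
    without empty slots for the upper bound, \<open>M\<close> padded with slots for the lower
    bound.\<close>
  obtain B where B: "rep T r B" "\<forall>t\<in>#B. no_vacant t \<and> branching_le d t" "size B = Suc d"
    using tree_rep_bounded[OF assms(2,4) r(1)] r(2) by auto
  obtain M where M: "rep T r M" "root_regular d M"
    using tree_rep_regular[OF assms(2,4) r(1)] by blast
  have nM: "nodes (Node M) = n" and nB: "nodes (Node B) = n"
    using rep_card[OF M(1)] rep_card[OF B(1)] assms(3) by simp_all
  have "1 \<le> nodes t" if "t \<in># B" for t
  proof -
    have "no_vacant t" using B(2) that by blast
    then show ?thesis by (cases t) simp_all
  qed
  then have "size B \<le> (\<Sum>t\<in>#B. nodes t)" using sum_mset_ge_replicate[of B 1 nodes] by simp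
  then have n: "d + 2 \<le> n" using nB B(3) by simp
  then obtain m where m: "n = d + 2 + m" using le_Suc_ex by blast
  have broom: "rep (broom n d) 0 (broom_kids d m)" unfolding m by (rule rep_broom)

  \<comment> \<open>The greedy multiset does not involve \<open>x\<close>; the value 1 merely
    produces one.\<close>
  obtain M0 k0 where M0: "greedy_root d k0 M0" "root_regular d M0" "nodes (Node M0) = n"
    using greedy_minimal[of 1, OF _ assms(1) M(2)] nM n by auto
  obtain G0 :: "nat ugraph" and r0 where G0: "rep G0 r0 M0" using rep_exists_nat by blast
  have ex: "greedy_tree n d G0"
    unfolding greedy_tree_def using rep_greedy_tree_rooted[OF assms(1) G0 M0(2)] M0 by blast

  have "matching_poly (subdivision G) x \<le> matching_poly (subdivision T) x \<and>
      matching_poly (subdivision T) x \<le> matching_poly (subdivision (broom n d)) x \<and>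
      lap_poly G x \<le> lap_poly T x \<and>
      lap_poly T x \<le> lap_poly (broom n d) x \<and>
      (matching_poly (subdivision T) x = matching_poly (subdivision G) x \<longleftrightarrow> T \<cong>\<^sub>G G) \<and>
      (matching_poly (subdivision T) x = matching_poly (subdivision (broom n d)) x \<longleftrightarrow> T \<cong>\<^sub>G broom n d) \<and>
      (lap_poly T x = lap_poly G x \<longleftrightarrow> T \<cong>\<^sub>G G) \<and>
      (lap_poly T x = lap_poly (broom n d) x \<longleftrightarrow> T \<cong>\<^sub>G broom n d)"
    if G: "greedy_tree n d G" and x: "0 < x" for G :: "nat ugraph" and x :: real
  proof -
    obtain s where s: "greedy_tree_rooted n d G s" using G by (auto simp: greedy_tree_def)
    then have "tree G" "max_degree G = d + 1" "s \<in> verts G"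
      unfolding greedy_tree_rooted_def by blast+
    from tree_rep_regular[OF this] obtain K where K: "rep G s K" "root_regular d K" by blast
    then obtain k where k: "greedy_root d k K" "nodes (Node K) = n"
      using rep_greedy_tree_rooted[OF assms(1) K] s by blast
    obtain K' k' where K': "greedy_root d k' K'" "nodes (Node K') = n"
      "rooted_det x K' \<le> rooted_det x M" "rooted_det x K' = rooted_det x M \<longrightarrow> reroot M K'"
      using greedy_minimal[OF x assms(1) M(2)] nM n by auto
    \<comment> \<open>The minimizer found for this \<open>x\<close> and the given greedy tree have
      the same multiset by uniqueness.\<close>
    have "K' = K" using greedy_root_unique[OF assms(1) K'(1) k(1)] K'(2) k(2) by simp
    have same: "rooted_det x B = rooted_det x M"
      using rep_matching_poly[OF x B(1)] rep_matching_poly[OF x M(1)] by simp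
    have low: "rooted_det x K \<le> rooted_det x M" using K'(3) \<open>K' = K\<close> by simp
    have up: "rooted_det x M \<le> rooted_det x (broom_kids d m)"
      using broom_maximum(1)[OF x assms(1) B(2,3)] nB m same by simp
    have polyT: "matching_poly (subdivision T) x = rooted_det x M" "lap_poly T x = rooted_det x M"
      using rep_matching_poly[OF x M(1)] rep_lap_poly[OF x M(1)] .
    have polyG: "matching_poly (subdivision G) x = rooted_det x K" "lap_poly G x = rooted_det x K"
      using rep_matching_poly[OF x K(1)] rep_lap_poly[OF x K(1)] .
    have polyB: "matching_poly (subdivision (broom n d)) x = rooted_det x (broom_kids d m)"
      "lap_poly (broom n d) x = rooted_det x (broom_kids d m)"
      using rep_matching_poly[OF x broom] rep_lap_poly[OF x broom] .
    \<comment> \<open>The isomorphic graph \<open>H\<close> is represented by both multisets, so its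
      matching polynomial equals both determinants.\<close>
    have iso_poly: "rooted_det x M = rooted_det x N" if H: "T \<cong>\<^sub>G H" "rep H u N" for H :: "nat ugraph" and u N
    proof -
      obtain v where "rep H v M" using iso_rep[OF H(1) _ M(1)] rep_simple[OF H(2)] by blast
      then show ?thesis using rep_matching_poly[OF x, of H] H(2) by metis
    qed
    have eqG: "rooted_det x M = rooted_det x K \<longleftrightarrow> T \<cong>\<^sub>G G"
    proof
      assume "rooted_det x M = rooted_det x K"
      then have "reroot M K" using K'(4) \<open>K' = K\<close> by simp
      then obtain v where "rep T v K" using reroot_rep[OF _ M(1)] by blast
      then show "T \<cong>\<^sub>G G" using K(1) by (rule rep_iso)
    qed (use iso_poly K(1) in blast)
    have eqB: "rooted_det x M = rooted_det x (broom_kids d m) \<longleftrightarrow> T \<cong>\<^sub>G broom n d"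
    proof
      assume "rooted_det x M = rooted_det x (broom_kids d m)"
      then have "reroot B (broom_kids d m)"
        using broom_maximum(2)[OF x assms(1) B(2,3)] nB m same by simp
      then obtain v where "rep T v (broom_kids d m)" using reroot_rep[OF _ B(1)] by blast
      then show "T \<cong>\<^sub>G broom n d" using broom by (rule rep_iso)
    qed (use iso_poly broom in blast)
    show ?thesis unfolding polyT polyG polyB using low up eqG eqB by blast
  qed
  with ex show ?thesis by blast
qed

end
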